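(* Let $G$ be a cocompact lattice in $\mathrm{Sol}$ or in $\mathbb{R}^d\rtimes_M\mathbb{R}$, where $d \geq 1$ and $M$ is a positive definite $d\times d$ matrix with all eigenvalues not equal to $1$. Then $n\preceq \mathrm{RF}_G(n)$. More generally, if $G$ is a cocompact lattice in a connected, simply connected, nondegenerate, split abelian by abelian solvable Lie group, then $n\preceq\mathrm{RF}_G(n)$.
   Context: $\mathrm{Sol}$ is the Lie group $\mathbb{R}^2\rtimes\mathbb{R}$ where $t\in\mathbb{R}$ acts on $\mathbb{R}^2$ by $\mathrm{diag}(e^t,e^{-t})$. $\mathbb{R}^d\rtimes_M\mathbb{R}$ is the semidirect product where $t\in\mathbb{R}$ acts on $\mathbb{R}^d$ by the matrix $M^t$. Nondegenerate, split abelian by abelian: let $\mathfrak{g}\neq 0$ be a real solvable Lie algebra and $\mathfrak{a}$ a Cartan subalgebra; there are finitely many nonzero linear functionals (roots) $\alpha_i:\mathfrak{a}\to\mathbb{C}$ such that $\mathfrak{g}=\mathfrak{a}\oplus\bigoplus_i\mathfrak{g}_{\alpha_i}$, where the $\mathfrak{g}_{\alpha_i}$ are the generalized root spaces. The Lie algebra $\mathfrak{g}$ is split abelian by abelian if it is a semidirect product of $\mathfrak{a}$ and $\bigoplus_i\mathfrak{g}_{\alpha_i}$ with both being abelian Lie algebras; it is nondegenerate if the roots are all real-valued and span the dual space $\mathfrak{a}^*$. A connected, simply connected solvable Lie group has these properties if its Lie algebra does. $\mathbb{N}$ denotes the positive integers. For a finitely generated, residually finite group $G$ with finite generating subset $S$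 and word length $\|\cdot\|_S$, for $x\in G\setminus\{1\}$ let $\mathrm{D}_G(x)=\min\{|H| : \varphi:G\to H \text{ a surjective homomorphism},\ |H|<\infty,\ \varphi(x)\ne 1\}$, and $\mathrm{RF}_{G}(n)=\mathrm{RF}_{G,S}(n)=\max\{\mathrm{D}_G(x) : \|x\|_S\le n,\ x\ne 1\}$. For nondecreasing functions $f,g$ on $\mathbb{N}$, $f\preceq g$ means that there is a constant $C>0$ (which may be taken to be an integer) with $f(n)\le C\,g(Cn)$ for all $n$; the choice of $S$ does not affect $\mathrm{RF}_G$ up to this relation in both directions. *)

theory Defs
  imports "HOL-Analysis.Analysis" "HOL-Algebra.Solvable_Groups"
begin

section \<open>Residual finiteness growth\<close>

text \<open>
  Every finite group is isomorphic to one whose elements are natural numbers, so letting the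
  finite quotients range over \<^typ>\<open>nat monoid\<close> loses nothing.
\<close>

definition detected_by :: "('g, 'b) monoid_scheme \<Rightarrow> 'g \<Rightarrow> nat monoid \<Rightarrow> bool" where
  "detected_by G x H \<longleftrightarrow>
     group H \<and> finite (carrier H) \<and> (\<exists>\<phi> \<in> epi G H. \<phi> x \<noteq> \<one>\<^bsub>H\<^esub>)"

definition residually_finite :: "('g, 'b) monoid_scheme \<Rightarrow> bool" where
  "residually_finite G \<longleftrightarrow> (\<forall>x \<in> carrier G. x \<noteq> \<one>\<^bsub>G\<^esub> \<longrightarrow> (\<exists>H. detected_by G x H))"

definition finite_generating_set :: "('g, 'b) monoid_scheme \<Rightarrow> 'g set \<Rightarrow> bool" where
  "finite_generating_set G S \<longleftrightarrow> finite S \<and> S \<subseteq> carrier G \<and> generate G S = carrier G"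

definition word_length :: "('g, 'b) monoid_scheme \<Rightarrow> 'g set \<Rightarrow> 'g \<Rightarrow> nat" where
  "word_length G S x =
     (LEAST k. \<exists>ws. length ws = k \<and> set ws \<subseteq> S \<union> m_inv G ` S \<and>
                    foldr (\<lambda>a b. a \<otimes>\<^bsub>G\<^esub> b) ws \<one>\<^bsub>G\<^esub> = x)"

definition D_RF :: "('g, 'b) monoid_scheme \<Rightarrow> 'g \<Rightarrow> nat" where
  "D_RF G x = (LEAST k. \<exists>H. detected_by G x H \<and> order H = k)"

text \<open>
  Meaningful for a nontrivial residually finite \<open>G\<close>, a finite generating set \<open>S\<close> and \<open>n \<ge> 1\<close>:
  the set whose maximum is taken is then finite and nonempty.
\<close>

definition RF :: "('g, 'b) monoid_scheme \<Rightarrow> 'g set \<Rightarrow> nat \<Rightarrow> nat" where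
  "RF G S n = Max {D_RF G x | x. x \<in> carrier G \<and> x \<noteq> \<one>\<^bsub>G\<^esub> \<and> word_length G S x \<le> n}"

definition growth_le :: "(nat \<Rightarrow> nat) \<Rightarrow> (nat \<Rightarrow> nat) \<Rightarrow> bool"  (infix \<open>\<preceq>\<close> 50) where
  "f \<preceq> g \<longleftrightarrow> (\<exists>C>0. \<forall>n\<ge>1. f n \<le> C * g (C * n))"

text \<open>
  That the function \<open>RF\<close> of a group is defined at all presupposes that the group is finitely
  generated and residually finite; these are part of the assertion.
\<close>

definition RF_bounded_below_by :: "('g, 'b) monoid_scheme \<Rightarrow> (nat \<Rightarrow> nat) \<Rightarrow> bool" where
  "RF_bounded_below_by G f \<longleftrightarrow>
     (\<exists>S. finite_generating_set G S) \<and> residually_finite G \<and>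
     (\<forall>S. finite_generating_set G S \<longrightarrow> f \<preceq> RF G S)"


section \<open>Cocompact lattices\<close>

definition coset_topology :: "('g, 'b) monoid_scheme \<Rightarrow> 'g topology \<Rightarrow> 'g set \<Rightarrow> 'g set topology" where
  "coset_topology G T \<Gamma> = topology (\<lambda>W. W \<subseteq> rcosets\<^bsub>G\<^esub> \<Gamma> \<and> openin T (\<Union>W))"

lemma openin_coset_topology:
  assumes "group G" "subgroup \<Gamma> G"
  shows "openin (coset_topology G T \<Gamma>) W \<longleftrightarrow> W \<subseteq> rcosets\<^bsub>G\<^esub> \<Gamma> \<and> openin T (\<Union>W)"
proof -
  have disj: "pairwise disjnt (rcosets\<^bsub>G\<^esub> \<Gamma>)"
    using group.rcos_disjoint[OF assms] by simp
  have int: "\<Union>(V \<inter> W) = \<Union>V \<inter> \<Union>W"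
    if "V \<subseteq> rcosets\<^bsub>G\<^esub> \<Gamma>" "W \<subseteq> rcosets\<^bsub>G\<^esub> \<Gamma>" for V W
  proof (intro equalityI subsetI)
    fix x assume "x \<in> \<Union>V \<inter> \<Union>W"
    then obtain P Q where PQ: "P \<in> V" "x \<in> P" "Q \<in> W" "x \<in> Q" by blast
    then have "P = Q" using disj that unfolding pairwise_def disjnt_def by fast
    with PQ show "x \<in> \<Union>(V \<inter> W)" by blast
  qed blast
  have un: "\<Union>(\<Union>K) = \<Union>(Union ` K)" for K :: "'a set set set"
    by blast
  have "istopology (\<lambda>W. W \<subseteq> rcosets\<^bsub>G\<^esub> \<Gamma> \<and> openin T (\<Union>W))"
    unfolding istopology_def
  proof (intro conjI allI impI)
    fix V W
    assume "V \<subseteq> rcosets\<^bsub>G\<^esub> \<Gamma> \<and> openin T (\<Union>V)" "W \<subseteq> rcosets\<^bsub>G\<^esub> \<Gamma> \<and> openin T (\<Union>W)"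
    then show "V \<inter> W \<subseteq> rcosets\<^bsub>G\<^esub> \<Gamma>" "openin T (\<Union>(V \<inter> W))"
      by (blast, metis int openin_Int)
  next
    fix K
    assume "\<forall>W\<in>K. W \<subseteq> rcosets\<^bsub>G\<^esub> \<Gamma> \<and> openin T (\<Union>W)"
    then show "\<Union>K \<subseteq> rcosets\<^bsub>G\<^esub> \<Gamma>" "openin T (\<Union>(\<Union>K))"
      by (blast, unfold un, blast intro: openin_Union)
  qed
  then show ?thesis
    by (simp add: coset_topology_def)
qed

text \<open>\<open>T\<close> is the topology of the ambient group \<open>G\<close>.\<close>

definition cocompact_lattice :: "('g, 'b) monoid_scheme \<Rightarrow> 'g topology \<Rightarrow> 'g set \<Rightarrow> bool" where
  "cocompact_lattice G T \<Gamma> \<longleftrightarrow>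
     subgroup \<Gamma> G \<and>
     subtopology T \<Gamma> = discrete_topology \<Gamma> \<and>
     compact_space (coset_topology G T \<Gamma>)"


section \<open>Semidirect products of a vector space with the real line\<close>

definition semidirect_line :: "(real \<Rightarrow> real^'d^'d) \<Rightarrow> ((real^'d) \<times> real) monoid" where
  "semidirect_line A =
     \<lparr> carrier = UNIV,
       monoid.mult = (\<lambda>(x, s) (y, t). (x + A s *v y, s + t)),
       one = (0, 0) \<rparr>"

definition Sol :: "((real^2) \<times> real) monoid" where
  "Sol = semidirect_line (\<lambda>t. vector [vector [exp t, 0], vector [0, exp (- t)]])"

definition positive_definite :: "real^'d^'d \<Rightarrow> bool" where
  "positive_definite M \<longleftrightarrow> transpose M = M \<and> (\<forall>x. x \<noteq> 0 \<longrightarrow> x \<bullet> (M *v x) > 0)"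

definition mat_eigenvalue :: "real^'d^'d \<Rightarrow> real \<Rightarrow> bool" where
  "mat_eigenvalue M c \<longleftrightarrow> (\<exists>v. v \<noteq> 0 \<and> M *v v = c *\<^sub>R v)"

text \<open>
  The real power \<open>M\<^sup>t\<close> of a positive definite matrix, by spectral calculus: it acts on the
  eigenspace of \<open>M\<close> for \<open>c > 0\<close> as multiplication by \<open>c\<^sup>t\<close>.  As \<open>M\<close> is orthogonally
  diagonalizable, there is exactly one such matrix.
\<close>

definition mat_rpow :: "real^'d^'d \<Rightarrow> real \<Rightarrow> real^'d^'d" where
  "mat_rpow M t =
     (THE P. \<forall>c v. M *v v = c *\<^sub>R v \<longrightarrow> P *v v = (c powr t) *\<^sub>R v)"


section \<open>Lie groups\<close>

primrec Ck_on :: "nat \<Rightarrow> 'a::euclidean_space set \<Rightarrow> ('a \<Rightarrow> 'b::euclidean_space) \<Rightarrow> bool" where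
  "Ck_on 0 U f \<longleftrightarrow> continuous_on U f"
| "Ck_on (Suc k) U f \<longleftrightarrow>
     (\<forall>x\<in>U. f differentiable (at x)) \<and>
     (\<forall>v. Ck_on k U (\<lambda>x. frechet_derivative f (at x) v))"

text \<open>To be used for open \<open>U\<close> only.\<close>

definition smooth_on :: "'a::euclidean_space set \<Rightarrow> ('a \<Rightarrow> 'b::euclidean_space) \<Rightarrow> bool" where
  "smooth_on U f \<longleftrightarrow> (\<forall>k. Ck_on k U f)"

text \<open>
  A chart is a pair of its domain and its coordinate map; the latter is irrelevant outside the
  domain.
\<close>

type_synonym ('g, 'e) chart = "'g set \<times> ('g \<Rightarrow> 'e)"

abbreviation chart_image :: "('g, 'e) chart \<Rightarrow> 'e set" where
  "chart_image c \<equiv> snd c ` fst c"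

abbreviation chart_inv :: "('g, 'e) chart \<Rightarrow> 'e \<Rightarrow> 'g" where
  "chart_inv c \<equiv> inv_into (fst c) (snd c)"

definition chart_on :: "'g topology \<Rightarrow> ('g, 'e::euclidean_space) chart \<Rightarrow> bool" where
  "chart_on T c \<longleftrightarrow>
     openin T (fst c) \<and> open (chart_image c) \<and>
     homeomorphic_map (subtopology T (fst c)) (top_of_set (chart_image c)) (snd c)"

definition smooth_atlas :: "'g topology \<Rightarrow> ('g, 'e::euclidean_space) chart set \<Rightarrow> bool" where
  "smooth_atlas T A \<longleftrightarrow>
     (\<forall>c\<in>A. chart_on T c) \<and> (\<Union>c\<in>A. fst c) = topspace T \<and>
     (\<forall>c\<in>A. \<forall>c'\<in>A. smooth_on (snd c ` (fst c \<inter> fst c')) (snd c' \<circ> chart_inv c))"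

definition smooth_manifold :: "'g topology \<Rightarrow> ('g, 'e::euclidean_space) chart set \<Rightarrow> bool" where
  "smooth_manifold T A \<longleftrightarrow>
     Hausdorff_space T \<and>
     (\<exists>B. countable B \<and> (\<forall>V\<in>B. openin T V) \<and> (\<forall>U. openin T U \<longrightarrow> (\<exists>B'\<subseteq>B. U = \<Union>B'))) \<and>
     smooth_atlas T A"

definition lie_group ::
    "('g, 'b) monoid_scheme \<Rightarrow> 'g topology \<Rightarrow> ('g, 'e::euclidean_space) chart set \<Rightarrow> bool" where
  "lie_group G T A \<longleftrightarrow>
     group G \<and> topspace T = carrier G \<and> smooth_manifold T A \<and>
     continuous_map (prod_topology T T) T (\<lambda>(x, y). x \<otimes>\<^bsub>G\<^esub> y) \<and>
     continuous_map T T (m_inv G) \<and>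
     (\<forall>c1\<in>A. \<forall>c2\<in>A. \<forall>c3\<in>A.
        smooth_on
          {(u, v). u \<in> chart_image c1 \<and> v \<in> chart_image c2 \<and>
                   chart_inv c1 u \<otimes>\<^bsub>G\<^esub> chart_inv c2 v \<in> fst c3}
          (\<lambda>(u, v). snd c3 (chart_inv c1 u \<otimes>\<^bsub>G\<^esub> chart_inv c2 v))) \<and>
     (\<forall>c1\<in>A. \<forall>c2\<in>A.
        smooth_on
          {u \<in> chart_image c1. inv\<^bsub>G\<^esub> (chart_inv c1 u) \<in> fst c2}
          (\<lambda>u. snd c2 (inv\<^bsub>G\<^esub> (chart_inv c1 u))))"

text \<open>
  The definition of the library predicate \<^const>\<open>simply_connected\<close> (any two loops are freely
  homotopic; this includes path-connectedness), for an arbitrary topological space.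
\<close>

definition simply_connected_space :: "'g topology \<Rightarrow> bool" where
  "simply_connected_space T \<longleftrightarrow>
     (\<forall>p q. pathin T p \<and> p 1 = p 0 \<and> pathin T q \<and> q 1 = q 0 \<longrightarrow>
            homotopic_with (\<lambda>r. r 1 = r 0) (top_of_set {0..1}) T p q)"

text \<open>
  A chart \<open>c\<close> around \<open>1\<close> identifies the tangent space at \<open>1\<close> with the model space \<open>'e\<close>.
  \<open>left_invariant_field G c X\<close> is the coordinate expression of the left-invariant vector field
  with value \<open>X\<close> at \<open>1\<close>: at the point \<open>g\<close> with coordinates \<open>u\<close> it is the image of \<open>X\<close> under the
  differential at \<open>1\<close> of the left translation by \<open>g\<close>.  The Lie bracket on the tangent space is
  the value at \<open>1\<close> of the commutator \<open>[V, W] = DW(V) - DV(W)\<close> of these vector fields.  Different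
  charts give isomorphic Lie algebras.
\<close>

definition left_invariant_field ::
    "('g, 'b) monoid_scheme \<Rightarrow> ('g, 'e::euclidean_space) chart \<Rightarrow> 'e \<Rightarrow> 'e \<Rightarrow> 'e" where
  "left_invariant_field G c X u =
     frechet_derivative (\<lambda>v. snd c (chart_inv c u \<otimes>\<^bsub>G\<^esub> chart_inv c v)) (at (snd c \<one>\<^bsub>G\<^esub>)) X"

definition vector_field_commutator ::
    "('e::euclidean_space \<Rightarrow> 'e) \<Rightarrow> ('e \<Rightarrow> 'e) \<Rightarrow> 'e \<Rightarrow> 'e" where
  "vector_field_commutator V W p =
     frechet_derivative W (at p) (V p) - frechet_derivative V (at p) (W p)"

definition lie_bracket ::
    "('g, 'b) monoid_scheme \<Rightarrow> ('g, 'e::euclidean_space) chart \<Rightarrow> 'e \<Rightarrow> 'e \<Rightarrow> 'e" where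
  "lie_bracket G c X Y =
     vector_field_commutator (left_invariant_field G c X) (left_invariant_field G c Y)
       (snd c \<one>\<^bsub>G\<^esub>)"


section \<open>Lie algebras\<close>

text \<open>
  A finite-dimensional real Lie algebra is given by a bracket on a type \<open>'e\<close> of class
  \<^class>\<open>euclidean_space\<close> (whose inner product plays no role).  Such a type has positive
  dimension, so the Lie algebra is nonzero.
\<close>

definition lie_algebra :: "('e::euclidean_space \<Rightarrow> 'e \<Rightarrow> 'e) \<Rightarrow> bool" where
  "lie_algebra br \<longleftrightarrow>
     (\<forall>x. linear (br x)) \<and> (\<forall>y. linear (\<lambda>x. br x y)) \<and> (\<forall>x. br x x = 0) \<and>
     (\<forall>x y z. br x (br y z) + br y (br z x) + br z (br x y) = 0)"

definition lie_span :: "('e::euclidean_space \<Rightarrow> 'e \<Rightarrow> 'e) \<Rightarrow> 'e set \<Rightarrow> 'e set \<Rightarrow> 'e set" where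
  "lie_span br A B = span {br x y | x y. x \<in> A \<and> y \<in> B}"

primrec lie_derived_series :: "('e::euclidean_space \<Rightarrow> 'e \<Rightarrow> 'e) \<Rightarrow> nat \<Rightarrow> 'e set" where
  "lie_derived_series br 0 = UNIV"
| "lie_derived_series br (Suc k) =
     lie_span br (lie_derived_series br k) (lie_derived_series br k)"

definition solvable_lie_algebra :: "('e::euclidean_space \<Rightarrow> 'e \<Rightarrow> 'e) \<Rightarrow> bool" where
  "solvable_lie_algebra br \<longleftrightarrow> lie_algebra br \<and> (\<exists>k. lie_derived_series br k = {0})"

primrec lower_central_series ::
    "('e::euclidean_space \<Rightarrow> 'e \<Rightarrow> 'e) \<Rightarrow> 'e set \<Rightarrow> nat \<Rightarrow> 'e set" where
  "lower_central_series br \<aa> 0 = \<aa>"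
| "lower_central_series br \<aa> (Suc k) = lie_span br \<aa> (lower_central_series br \<aa> k)"

definition lie_subalgebra :: "('e::euclidean_space \<Rightarrow> 'e \<Rightarrow> 'e) \<Rightarrow> 'e set \<Rightarrow> bool" where
  "lie_subalgebra br \<aa> \<longleftrightarrow> subspace \<aa> \<and> (\<forall>x\<in>\<aa>. \<forall>y\<in>\<aa>. br x y \<in> \<aa>)"

definition lie_ideal :: "('e::euclidean_space \<Rightarrow> 'e \<Rightarrow> 'e) \<Rightarrow> 'e set \<Rightarrow> bool" where
  "lie_ideal br I \<longleftrightarrow> subspace I \<and> (\<forall>x. \<forall>y\<in>I. br x y \<in> I)"

definition lie_abelian :: "('e::euclidean_space \<Rightarrow> 'e \<Rightarrow> 'e) \<Rightarrow> 'e set \<Rightarrow> bool" where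
  "lie_abelian br \<aa> \<longleftrightarrow> (\<forall>x\<in>\<aa>. \<forall>y\<in>\<aa>. br x y = 0)"

definition cartan_subalgebra :: "('e::euclidean_space \<Rightarrow> 'e \<Rightarrow> 'e) \<Rightarrow> 'e set \<Rightarrow> bool" where
  "cartan_subalgebra br \<aa> \<longleftrightarrow>
     lie_subalgebra br \<aa> \<and> (\<exists>k. lower_central_series br \<aa> k = {0}) \<and>
     {x. \<forall>y\<in>\<aa>. br x y \<in> \<aa>} = \<aa>"

definition functional_on :: "'e::euclidean_space set \<Rightarrow> ('e \<Rightarrow> 'f::real_vector) \<Rightarrow> bool" where
  "functional_on \<aa> f \<longleftrightarrow>
     f \<in> extensional \<aa> \<and>
     (\<forall>x\<in>\<aa>. \<forall>y\<in>\<aa>. f (x + y) = f x + f y) \<and> (\<forall>r. \<forall>x\<in>\<aa>. f (r *\<^sub>R x) = r *\<^sub>R f x)"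

text \<open>
  Since roots may a priori take complex values, root spaces live in the complexification, where
  \<open>(x, y) :: 'e \<times> 'e\<close> stands for \<open>x + i y\<close>.  \<open>ad_minus br h c\<close> is the operator \<open>ad h - c\<close> on it.
\<close>

definition ad_minus ::
    "('e::euclidean_space \<Rightarrow> 'e \<Rightarrow> 'e) \<Rightarrow> 'e \<Rightarrow> complex \<Rightarrow> 'e \<times> 'e \<Rightarrow> 'e \<times> 'e" where
  "ad_minus br h c = (\<lambda>(x, y).
     (br h x - (Re c *\<^sub>R x - Im c *\<^sub>R y), br h y - (Re c *\<^sub>R y + Im c *\<^sub>R x)))"

definition root_space ::
    "('e::euclidean_space \<Rightarrow> 'e \<Rightarrow> 'e) \<Rightarrow> 'e set \<Rightarrow> ('e \<Rightarrow> complex) \<Rightarrow> ('e \<times> 'e) set" where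
  "root_space br \<aa> \<alpha> = {z. \<forall>h\<in>\<aa>. \<exists>k. (ad_minus br h (\<alpha> h) ^^ k) z = 0}"

definition lie_roots ::
    "('e::euclidean_space \<Rightarrow> 'e \<Rightarrow> 'e) \<Rightarrow> 'e set \<Rightarrow> ('e \<Rightarrow> complex) set" where
  "lie_roots br \<aa> =
     {\<alpha>. functional_on \<aa> \<alpha> \<and> (\<exists>h\<in>\<aa>. \<alpha> h \<noteq> 0) \<and> root_space br \<aa> \<alpha> \<noteq> {0}}"

text \<open>
  The real points of the sum of the root spaces; the real span suffices because each root space
  is a complex subspace.  For real-valued roots this is the sum of the generalized root spaces
  taken in the real Lie algebra itself.
\<close>

definition root_space_sum :: "('e::euclidean_space \<Rightarrow> 'e \<Rightarrow> 'e) \<Rightarrow> 'e set \<Rightarrow> 'e set" where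
  "root_space_sum br \<aa> = {x. (x, 0) \<in> span (\<Union>\<alpha>\<in>lie_roots br \<aa>. root_space br \<aa> \<alpha>)}"

definition split_abelian_by_abelian ::
    "('e::euclidean_space \<Rightarrow> 'e \<Rightarrow> 'e) \<Rightarrow> 'e set \<Rightarrow> bool" where
  "split_abelian_by_abelian br \<aa> \<longleftrightarrow>
     lie_subalgebra br \<aa> \<and> lie_ideal br (root_space_sum br \<aa>) \<and>
     \<aa> \<inter> root_space_sum br \<aa> = {0} \<and>
     {x + y | x y. x \<in> \<aa> \<and> y \<in> root_space_sum br \<aa>} = UNIV \<and>
     lie_abelian br \<aa> \<and> lie_abelian br (root_space_sum br \<aa>)"

definition nondegenerate_roots :: "('e::euclidean_space \<Rightarrow> 'e \<Rightarrow> 'e) \<Rightarrow> 'e set \<Rightarrow> bool" where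
  "nondegenerate_roots br \<aa> \<longleftrightarrow>
     (\<forall>\<alpha>\<in>lie_roots br \<aa>. \<forall>h\<in>\<aa>. \<alpha> h \<in> \<real>) \<and>
     (\<forall>f::'e \<Rightarrow> real. functional_on \<aa> f \<longrightarrow>
        (\<exists>R r. finite R \<and> R \<subseteq> lie_roots br \<aa> \<and>
               (\<forall>h\<in>\<aa>. f h = (\<Sum>\<alpha>\<in>R. r \<alpha> * Re (\<alpha> h)))))"

text \<open>All Cartan subalgebras of a solvable Lie algebra are conjugate, so the choice is immaterial.\<close>

definition nondegenerate_split_lie_algebra :: "('e::euclidean_space \<Rightarrow> 'e \<Rightarrow> 'e) \<Rightarrow> bool" where
  "nondegenerate_split_lie_algebra br \<longleftrightarrow>
     solvable_lie_algebra br \<and>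
     (\<exists>\<aa>. cartan_subalgebra br \<aa> \<and> split_abelian_by_abelian br \<aa> \<and> nondegenerate_roots br \<aa>)"

definition nondegenerate_split_lie_group ::
    "('g, 'b) monoid_scheme \<Rightarrow> ('g, 'e::euclidean_space) chart set \<Rightarrow> bool" where
  "nondegenerate_split_lie_group G A \<longleftrightarrow>
     (\<exists>c\<in>A. \<one>\<^bsub>G\<^esub> \<in> fst c \<and> nondegenerate_split_lie_algebra (lie_bracket G c))"

end

theory Submission
  imports Defs "HOL-Algebra.Multiplicative_Group" "HOL-Algebra.Zassenhaus"
begin

text \<open>
  Let the ambient group be a semidirect product of vector groups \<open>N\<close> and \<open>A\<close>.  A cocompact lattice
  \<open>\<Gamma>\<close> meets \<open>N\<close> in an element \<open>v \<noteq> 1\<close>, and as the elements of \<open>A\<close> contract the root spaces, \<open>v\<close> is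
  exponentially distorted: \<open>v\<^sup>m\<close> has word length \<open>O(ln m)\<close>.  For \<open>L = lcm(1, ..., n) \<le> 16\<^sup>n\<close> the
  element \<open>v\<^sup>L\<close> thus has word length \<open>O(n)\<close>, but it dies in every quotient of order at most \<open>n\<close>, since
  that order divides \<open>L\<close>.  Residual finiteness holds because \<open>\<Gamma> \<inter> N\<close> is a discrete subgroup of a
  vector space and the finitely generated group \<open>\<Gamma> / (\<Gamma> \<inter> N)\<close> is abelian.

  A Lie group with a nondegenerate split Lie algebra is isomorphic to such a semidirect product:
  near the unit, integrating the adjoint representation along straight lines in a chart gives a
  local isomorphism; its inverse extends to the whole product because vector groups are simply
  connected, and is injective because the centre is trivial.
\<close>


section \<open>The least common multiple of an initial segment\<close>

text \<open>Nothing is known about the position of the lattice relative to the splitting: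
  \<open>\<Gamma>\<close> need not be the product of its intersections with the two factors, and the
  elements that contract root spaces need not lie in \<open>\<Gamma>\<close>. So exponential
  distortion is established for words in the ambient group whose letters are merely bounded.
  Cocompactness then replaces such a word by one of the same length over a finite subset of
  \<open>\<Gamma>\<close>, up to a bounded remainder. For the lower bound a single nonzero element
  of the intersection with the normal factor is enough. The passage from Lie algebra to group uses
  the adjoint representation because the group law in one chart defines it directly, by
  differentiation. In the model an element is determined by its adjoint operator. Hence, once the
  adjoint operators of the two groups are matched pointwise, multiplicativity of both
  representations makes the matching a local homomorphism, with no second differential equation to
  solve.\<close>

lemma prime_power_dvd_central_binomial:
  fixes p :: nat
  assumes p: "prime p" and q: "n < p ^ k" "p ^ k \<le> 2 * n"
  shows "p dvd (2 * n choose n)"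
proof -
  \<comment> \<open>Vandermonde isolates a row \<open>p ^ k\<close> of Pascal's triangle, whose
    inner entries are divisible by \<open>p\<close>. The term \<open>i = 0\<close> vanishes because
    \<open>2 * n - p ^ k < n\<close>.\<close>
  have "(2 * n choose n) = (\<Sum>i\<le>n. (p ^ k choose i) * ((2 * n - p ^ k) choose (n - i)))"
    using vandermonde[of "p ^ k" "2 * n - p ^ k" n] q by simp
  moreover have "p dvd (p ^ k choose i) * ((2 * n - p ^ k) choose (n - i))" if "i \<le> n" for i
  proof (cases "i = 0")
    case True
    then show ?thesis using q by (simp add: binomial_eq_0)
  next
    case False
    then have i: "0 < i" "i < p ^ k" using that q by auto
    \<comment> \<open>The absorption identity: if \<open>p\<close> did not divide the coefficient,
      all of \<open>p ^ k\<close> would have to divide the smaller number \<open>i\<close>.\<close>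
    have "i * (p ^ k choose i) = p ^ k * ((p ^ k - 1) choose (i - 1))"
      using times_binomial_minus1_eq i by simp
    then have d: "p ^ k dvd i * (p ^ k choose i)" by simp
    have "p dvd (p ^ k choose i)"
    proof (rule ccontr)
      assume "\<not> p dvd (p ^ k choose i)"
      then have "coprime (p ^ k) (p ^ k choose i)"
        using p by (simp add: prime_imp_coprime)
      then have "p ^ k dvd i" using d coprime_dvd_mult_left_iff by blast
      then show False using i by (simp add: dvd_imp_le leD)
    qed
    then show ?thesis by simp
  qed
  ultimately show ?thesis by (auto intro!: dvd_sum)
qed

text \<open>Compared prime by prime. The exact power \<open>p ^ k\<close> in some
  \<open>j \<le> 2 * n\<close> is either at most \<open>n\<close>, or
  \<open>p ^ (k - 1) \<le> n\<close> because \<open>p \<ge> 2\<close>, and then the one missing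
  factor \<open>p\<close> is supplied by the central binomial coefficient.\<close>

lemma Lcm_double_dvd: "Lcm {1..2 * n} dvd Lcm {1..n} * (2 * n choose n :: nat)"
proof (rule Lcm_least)
  fix j assume j: "j \<in> {1..2 * n}"
  show "j dvd Lcm {1..n} * (2 * n choose n)"
  proof (rule multiplicity_le_imp_dvd)
    show "j \<noteq> 0" using j by simp
    fix p :: nat assume p: "prime p"
    define k where "k = multiplicity p j"
    have pk: "p ^ k dvd j" by (simp add: k_def multiplicity_dvd)
    then have le: "p ^ k \<le> 2 * n" using j by (meson atLeastAtMost_iff dvd_imp_le le_trans less_le_trans zero_less_one)
    have ne: "Lcm {1..n} * (2 * n choose n) \<noteq> (0::nat)"
      by (auto simp: Lcm_0_iff)
    have "p ^ k dvd Lcm {1..n} * (2 * n choose n)"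
    proof (cases "p ^ k \<le> n")
      case True
      then have "p ^ k \<in> {1..n}" using p by (simp add: prime_gt_0_nat Suc_leI)
      then show ?thesis by (meson dvd_Lcm dvd_mult2)
    next
      case False
      then have n: "n < p ^ k" by simp
      show ?thesis
      proof (cases k)
        case (Suc l)
        have "2 * p ^ l \<le> p ^ k" using Suc prime_ge_2_nat[OF p] by simp
        then have "p ^ l \<in> {1..n}" using le p by (simp add: prime_gt_0_nat Suc_leI)
        then have "p ^ l dvd Lcm {1..n}" by simp
        then have "p ^ l * p dvd Lcm {1..n} * (2 * n choose n)"
          using prime_power_dvd_central_binomial[OF p n le] by (rule mult_dvd_mono)
        then show ?thesis using Suc by (simp add: mult.commute)
      qed simp
    qed
    then show "multiplicity p j \<le> multiplicity p (Lcm {1..n} * (2 * n choose n))"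
      unfolding k_def[symmetric] using ne p
      by (intro multiplicity_geI) (auto simp: not_prime_unit)
  qed
qed

text \<open>Induction by halving. Doubling costs only the factor \<open>4 ^ m\<close>, so base 4
  would suit even \<open>n\<close>; with base 16 the surplus \<open>16 ^ 2 = 4 * 64\<close> also
  absorbs the factor \<open>n \<le> 16 * 4 ^ m\<close> that an odd \<open>n\<close> brings in. Any
  constant base serves later.\<close>

lemma Lcm_le_power: "Lcm {1..n} \<le> (16::nat) ^ n"
proof (induction n rule: less_induct)
  case (less n)
  have two: "Lcm {1..2 * m} \<le> (64::nat) ^ m" if IH: "Lcm {1..m} \<le> (16::nat) ^ m" for m
  proof -
    have "Lcm {1..2 * m} \<le> Lcm {1..m} * (2 * m choose m :: nat)"
      by (rule dvd_imp_le[OF Lcm_double_dvd]) (auto simp: Lcm_0_iff intro!: Nat.gr0I)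
    also have "\<dots> \<le> 16 ^ m * 4 ^ m"
    proof (rule mult_mono[OF IH])
      show "(2 * m choose m) \<le> 4 ^ m"
        using binomial_le_pow2[of "2 * m" m] by (simp add: power_mult)
    qed auto
    finally show ?thesis by (simp add: power_mult_distrib[symmetric])
  qed
  show ?case
  proof (cases "n = 0")
    case False
    define m where "m = n div 2"
    have m: "Lcm {1..m} \<le> (16::nat) ^ m" using less[of m] False by (simp add: m_def)
    show ?thesis
    proof (cases "even n")
      case True
      then have n: "n = 2 * m" by (simp add: m_def)
      have "(64::nat) ^ m \<le> 256 ^ m" by (rule power_mono) auto
      then show ?thesis using two[OF m] unfolding n by (simp add: power_mult)
    next
      case odd: False
      then have n: "n = Suc (2 * m)" by (simp add: m_def)
      have "{1..n} = insert n {1..2 * m}" using n by auto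
      then have "Lcm {1..n} = lcm n (Lcm {1..2 * m})" by (simp add: Lcm_insert)
      also have "\<dots> \<le> n * Lcm {1..2 * m}" using False
        by (intro dvd_imp_le) (auto simp: Lcm_0_iff intro!: Nat.gr0I)
      also have "\<dots> \<le> n * 64 ^ m" using two[OF m] by simp
      also have "n \<le> 16 * 4 ^ m" unfolding n by (induction m) auto
      finally have "Lcm {1..n} \<le> 16 * 4 ^ m * (64::nat) ^ m" by simp
      also have "\<dots> = 16 * (4 * 64) ^ m" by (simp only: power_mult_distrib mult.assoc)
      also have "\<dots> = 16 ^ n" unfolding n by (simp add: power_mult)
      finally show ?thesis .
    qed
  qed simp
qed


section \<open>Finite quotients of abelian-by-abelian groups\<close>

context group begin

lemma commutes_nat_pow:
  assumes "s \<in> carrier G" "g \<in> carrier G" "s \<otimes> g = g \<otimes> s"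
  shows "s [^] (n::nat) \<otimes> g = g \<otimes> s [^] n"
proof (induction n)
  case (Suc n)
  have "s [^] Suc n \<otimes> g = s [^] n \<otimes> (g \<otimes> s)"
    using assms by (simp add: m_assoc)
  also have "\<dots> = g \<otimes> s [^] Suc n"
    using assms Suc by (simp add: m_assoc[symmetric])
  finally show ?case .
qed (use assms in simp)

lemma commutes_inv:
  assumes "z \<in> carrier G" "h \<in> carrier G" "z \<otimes> h = h \<otimes> z"
  shows "z \<otimes> inv h = inv h \<otimes> z"
proof -
  have "z \<otimes> inv h = inv h \<otimes> (h \<otimes> z) \<otimes> inv h"
    using assms by (simp flip: m_assoc)
  also have "\<dots> = inv h \<otimes> z"
    unfolding assms(3)[symmetric] using assms(1,2) by (simp add: m_assoc)
  finally show ?thesis .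
qed

text \<open>Pigeonhole: the commutators of the powers of \<open>s\<close> with \<open>g\<close> stay
  in the finite \<open>A\<close>, so they coincide for some exponents \<open>i < j\<close>.
  Cancelling \<open>s [^] i\<close> leaves that \<open>s [^] (j - i)\<close> commutes with
  \<open>g\<close>.\<close>

lemma power_commutes_if_finite_commutators:
  assumes "finite A" and comm: "\<And>g h. g \<in> carrier G \<Longrightarrow> h \<in> carrier G \<Longrightarrow> g \<otimes> h \<otimes> inv g \<otimes> inv h \<in> A"
    and s: "s \<in> carrier G" and g: "g \<in> carrier G"
  shows "\<exists>m>0. s [^] (m::nat) \<otimes> g = g \<otimes> s [^] m"
proof -
  define f where "f i = s [^] i \<otimes> g \<otimes> inv (s [^] i) \<otimes> inv g" for i :: nat
  have "range f \<subseteq> A" using comm s g by (auto simp: f_def)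
  then have "finite (range f)" using assms(1) finite_subset by blast
  then have "\<not> inj f" using finite_imageD by blast
  then obtain i j where ij: "i < j" "f i = f j"
    unfolding inj_def by (metis linorder_neqE_nat)
  define m where "m = j - i"
  have cl: "s [^] i \<in> carrier G" "s [^] m \<in> carrier G" using s by auto
  have "j = i + m" using ij by (simp add: m_def)
  then have sj: "s [^] j = s [^] i \<otimes> s [^] m" using s by (simp add: nat_pow_mult)
  have "s [^] i \<otimes> g \<otimes> inv (s [^] i) = s [^] j \<otimes> g \<otimes> inv (s [^] j)"
    using ij(2) s g unfolding f_def by (simp add: right_cancel)
  then have "s [^] i \<otimes> (g \<otimes> inv (s [^] i)) = s [^] i \<otimes> (s [^] m \<otimes> g \<otimes> inv (s [^] m) \<otimes> inv (s [^] i))"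
    unfolding sj using cl g by (simp add: m_assoc inv_mult_group)
  then have "g \<otimes> inv (s [^] i) = s [^] m \<otimes> g \<otimes> inv (s [^] m) \<otimes> inv (s [^] i)"
    using cl g by (simp only: Units_l_cancel Units_eq m_closed inv_closed)
  then have "g = s [^] m \<otimes> g \<otimes> inv (s [^] m)"
    using cl g by (simp only: right_cancel m_closed inv_closed)
  then have "g \<otimes> s [^] m = s [^] m \<otimes> g \<otimes> (inv (s [^] m) \<otimes> s [^] m)"
    using cl g by (metis inv_closed m_assoc m_closed)
  then have "s [^] m \<otimes> g = g \<otimes> s [^] m" using cl g by simp
  then show ?thesis using ij by (intro exI[of _ m]) (simp add: m_def)
qed

lemma central_if_commutes_generators:
  assumes "generate G S = carrier G" "S \<subseteq> carrier G" "z \<in> carrier G"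
    and "\<And>g. g \<in> S \<Longrightarrow> z \<otimes> g = g \<otimes> z" "h \<in> carrier G"
  shows "z \<otimes> h = h \<otimes> z"
proof -
  have "h \<in> generate G S" using assms by simp
  then show ?thesis
  proof induction
    case one then show ?case using assms by simp
  next
    case (incl h) then show ?case using assms by simp
  next
    case (inv h)
    have h: "h \<in> carrier G" using inv assms by blast
    show ?case using commutes_inv[OF assms(3) h assms(4)[OF inv]] .
  next
    case (eng h1 h2)
    then have "h1 \<in> carrier G" "h2 \<in> carrier G" using assms by auto
    then show ?case using eng assms(3) by (metis m_assoc m_closed)
  qed
qed

text \<open>The exponents found for the single generators are multiplied together; commuting with
  all generators is the same as being central.\<close>

lemma generators_have_central_power:
  assumes S: "finite S" "S \<subseteq> carrier G" "generate G S = carrier G" and "finite A"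
    and comm: "\<And>g h. g \<in> carrier G \<Longrightarrow> h \<in> carrier G \<Longrightarrow> g \<otimes> h \<otimes> inv g \<otimes> inv h \<in> A"
    and s: "s \<in> carrier G"
  shows "\<exists>m>0. \<forall>h\<in>carrier G. s [^] (m::nat) \<otimes> h = h \<otimes> s [^] m"
proof -
  have "\<exists>m>0. \<forall>g\<in>F. s [^] (m::nat) \<otimes> g = g \<otimes> s [^] m" if "finite F" "F \<subseteq> carrier G" for F
    using that
  proof (induction F)
    case empty
    then show ?case by (auto intro: exI[of _ 1])
  next
    case (insert g F)
    then obtain m :: nat where m: "m > 0" "\<And>g. g \<in> F \<Longrightarrow> s [^] m \<otimes> g = g \<otimes> s [^] m" by auto
    obtain l :: nat where l: "l > 0" "s [^] l \<otimes> g = g \<otimes> s [^] l"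
      using power_commutes_if_finite_commutators[OF assms(4) comm s] insert by blast
    have "s [^] (m * l) \<otimes> h = h \<otimes> s [^] (m * l)" if "h \<in> insert g F" for h
    proof (cases "h = g")
      case True
      have "(s [^] l) [^] m \<otimes> g = g \<otimes> (s [^] l) [^] m"
        by (rule commutes_nat_pow) (use s l insert in auto)
      then show ?thesis using True s by (simp add: nat_pow_pow mult.commute)
    next
      case False
      then have "(s [^] m) [^] l \<otimes> h = h \<otimes> (s [^] m) [^] l"
        using s m(2)[of h] insert.prems that by (intro commutes_nat_pow[of "s [^] m"]) auto
      then show ?thesis using s by (simp add: nat_pow_pow)
    qed
    then show ?case using m l by (intro exI[of _ "m * l"]) auto
  qed
  from this[OF S(1,2)] obtain m :: nat where "m > 0" "\<And>g. g \<in> S \<Longrightarrow> s [^] m \<otimes> g = g \<otimes> s [^] m" by auto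
  then show ?thesis
    using central_if_commutes_generators[OF S(3,2)] s by (intro exI[of _ m]) auto
qed

lemma central_generate_normal:
  assumes "z \<in> carrier G" "\<And>h. h \<in> carrier G \<Longrightarrow> z \<otimes> h = h \<otimes> z"
  shows "generate G {z} \<lhd> G"
proof (rule normal_invI)
  show "subgroup (generate G {z}) G" using assms by (intro generate_is_subgroup) auto
  fix x h assume "x \<in> carrier G" "h \<in> generate G {z}"
  moreover have "x \<otimes> h = h \<otimes> x" if "x \<in> carrier G" "h \<in> generate G {z}" for x h
    using that(2,1)
  proof induction
    case (inv h)
    then show ?case using assms(1) commutes_inv[OF inv(2) assms(1)] assms(2)[OF inv(2)]
      by (metis singletonD)
  next
    case (eng h1 h2)
    then have "h1 \<in> carrier G" "h2 \<in> carrier G" using generate_in_carrier[of "{z}"] assms by auto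
    then show ?case using eng by (metis m_assoc)
  qed (use assms in auto)
  moreover have "h \<in> carrier G" using calculation(2) generate_in_carrier[of "{z}"] assms by auto
  ultimately show "x \<otimes> h \<otimes> inv x \<in> generate G {z}" by (simp add: m_assoc)
qed

lemma monolith_central_ord:
  assumes mono: "\<And>N. N \<lhd> G \<Longrightarrow> N \<noteq> {\<one>} \<Longrightarrow> x \<in> N" and x: "x \<noteq> \<one>"
    and z: "z \<in> carrier G" and c: "\<And>h. h \<in> carrier G \<Longrightarrow> z \<otimes> h = h \<otimes> z"
  shows "ord z \<noteq> 0"
proof
  assume o: "ord z = 0"
  have x_pow: "\<exists>k::int. x = z [^] (int j * k)" if "j > 0" for j :: nat
  proof -
    have "z [^] j \<noteq> \<one>" using o z that by (simp add: pow_eq_id)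
    then have "generate G {z [^] j} \<noteq> {\<one>}" using generate.incl[of "z [^] j" "{z [^] j}" G] by auto
    moreover have "generate G {z [^] j} \<lhd> G"
      using z c by (intro central_generate_normal commutes_nat_pow[of z]) auto
    ultimately have "x \<in> generate G {z [^] j}" using mono by blast
    then obtain k :: int where "x = (z [^] j) [^] k" using generate_pow[of "z [^] j"] z by auto
    then have "x = z [^] (int j * k)" using z by (simp add: int_pow_int flip: int_pow_pow)
    then show ?thesis by blast
  qed
  \<comment> \<open>The element \<open>x\<close> also lies in the subgroup generated by the power of
    \<open>z\<close> with exponent \<open>2 * \<bar>a\<bar>\<close>. In infinite order exponents are
    unique, so \<open>2 * \<bar>a\<bar>\<close> divides \<open>a\<close>, which is impossible for
    \<open>a \<noteq> 0\<close>.\<close>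
  obtain a where a: "x = z [^] (a::int)" using x_pow[of 1] by auto
  have "a \<noteq> 0" using a x z by auto
  then obtain k where k: "x = z [^] (int (2 * nat \<bar>a\<bar>) * k)" using x_pow[of "2 * nat \<bar>a\<bar>"] by auto
  then have "int (2 * nat \<bar>a\<bar>) * k = a" using a z o int_pow_eq[of z a "int (2 * nat \<bar>a\<bar>) * k"] by simp
  then have "2 * \<bar>a\<bar> dvd a" by (metis dvd_triv_left int_nat_eq abs_ge_zero of_nat_mult of_nat_numeral)
  then show False using \<open>a \<noteq> 0\<close> dvd_imp_le_int[of a "2 * \<bar>a\<bar>"] by simp
qed

text \<open>As \<open>A\<close> contains all commutators, every subgroup containing \<open>A\<close>
  is normal. Generators can therefore be adjoined one at a time, each enlarging the subgroup at most
  by the product with a finite cyclic group.\<close>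

lemma finite_if_torsion_fg:
  assumes "finite A" "A \<lhd> G"
    and comm: "\<And>g h. g \<in> carrier G \<Longrightarrow> h \<in> carrier G \<Longrightarrow> g \<otimes> h \<otimes> inv g \<otimes> inv h \<in> A"
    and "finite S" "S \<subseteq> carrier G" "\<And>s. s \<in> S \<Longrightarrow> ord s \<noteq> 0"
  shows "finite (generate G (S \<union> A))"
  using assms(4-)
proof (induction S)
  case empty
  have "generate G A = A"
    using assms(2) normal_imp_subgroup generate_subgroup_incl[of A A] generate.incl[of _ A G]
    by blast
  then show ?case using assms(1) by simp
next
  case (insert s S)
  have A: "A \<subseteq> carrier G" using assms(2) normal_imp_subgroup subgroup.subset by blast
  define B where "B = generate G (S \<union> A)"
  have B: "finite B" "subgroup B G" "A \<subseteq> B" "S \<subseteq> B" "B \<subseteq> carrier G"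
    unfolding B_def using insert A generate.incl[of _ "S \<union> A" G]
    by (auto intro!: generate_is_subgroup generate_incl)
  have "B \<lhd> G"
  proof (rule normal_invI[OF B(2)])
    fix g h assume gh: "g \<in> carrier G" "h \<in> B"
    then have h: "h \<in> carrier G" using B by blast
    then have "g \<otimes> h \<otimes> inv g \<otimes> inv h \<otimes> h \<in> B"
      using comm[OF gh(1) h] gh(2) B(3) by (auto intro: subgroup.m_closed[OF B(2), of "g \<otimes> h \<otimes> inv g \<otimes> inv h"])
    then show "g \<otimes> h \<otimes> inv g \<in> B" using gh(1) h by (simp add: m_assoc)
  qed
  have s: "s \<in> carrier G" "ord s \<noteq> 0" using insert by auto
  define H where "H = generate G {s}"
  have H: "subgroup H G" "s \<in> H" "H \<subseteq> carrier G" unfolding H_def using s generate.incl[of s "{s}" G] generate_incl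
    by (auto intro!: generate_is_subgroup)
  have "ord s = card H" using s generate_pow_card by (simp add: H_def)
  then have "finite H" using s card.infinite by metis
  have sub: "subgroup (B <#> H) G" using mult_norm_subgroup[OF \<open>B \<lhd> G\<close> H(1)] .
  have "B <#> H = (\<lambda>(b, h). b \<otimes> h) ` (B \<times> H)" by (auto simp: set_mult_def)
  then have fin: "finite (B <#> H)" using B(1) \<open>finite H\<close> by simp
  have "insert s S \<union> A \<subseteq> B <#> H"
  proof
    fix y assume "y \<in> insert s S \<union> A"
    then consider "y = s" | "y \<in> B" using B by blast
    then show "y \<in> B <#> H"
    proof cases
      case 1
      then have "y = \<one> \<otimes> s" using s by simp
      then show ?thesis using H subgroup.one_closed[OF B(2)] unfolding set_mult_def by blast
    next
      case 2
      then have "y = y \<otimes> \<one>" using B by auto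
      then show ?thesis using 2 subgroup.one_closed[OF H(1)] unfolding set_mult_def by blast
    qed
  qed
  then have "generate G (insert s S \<union> A) \<subseteq> B <#> H"
    using sub generate_subgroup_incl by blast
  then show ?case using fin finite_subset by blast
qed

text \<open>
  The powers of a central element of infinite order generate normal subgroups with trivial
  intersection, which a monolith (an \<open>x \<noteq> 1\<close> in every nontrivial normal subgroup) forbids; so the
  centre is torsion, and every generator has a central power.
\<close>

lemma finite_if_monolithic:
  assumes S: "finite S" "S \<subseteq> carrier G" "generate G S = carrier G" and A: "finite A" "A \<lhd> G"
    and comm: "\<And>g h. g \<in> carrier G \<Longrightarrow> h \<in> carrier G \<Longrightarrow> g \<otimes> h \<otimes> inv g \<otimes> inv h \<in> A"
    and x: "x \<noteq> \<one>" and mono: "\<And>N. N \<lhd> G \<Longrightarrow> N \<noteq> {\<one>} \<Longrightarrow> x \<in> N"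
  shows "finite (carrier G)"
proof -
  have "ord s \<noteq> 0" if "s \<in> S" for s
  proof -
    have s: "s \<in> carrier G" using that S by blast
    obtain m :: nat where m: "m > 0" "\<And>h. h \<in> carrier G \<Longrightarrow> s [^] m \<otimes> h = h \<otimes> s [^] m"
      using generators_have_central_power[OF S A(1) comm s] by auto
    have "ord (s [^] m) \<noteq> 0" using m s by (intro monolith_central_ord[OF mono x]) auto
    then have "s [^] (m * ord (s [^] m)) = \<one>" "m * ord (s [^] m) \<noteq> 0"
      using m s by (auto simp flip: nat_pow_pow)
    then show ?thesis using ord_eq_0[OF s] by blast
  qed
  then have "finite (generate G (S \<union> A))"
    using finite_if_torsion_fg[OF A comm S(1,2)] by blast
  moreover have "carrier G \<subseteq> generate G (S \<union> A)"
    using S(3) mono_generate[of S "S \<union> A"] by auto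
  ultimately show ?thesis using finite_subset by blast
qed

end

section \<open>Finite quotients that detect a given element\<close>

lemma finite_group_iso_nat:
  assumes Q: "group Q" "finite (carrier Q)"
  shows "\<exists>(H::nat monoid) e. group H \<and> finite (carrier H) \<and> e \<in> iso Q H"
proof -
  interpret group Q by (rule Q)
  obtain e :: "'a \<Rightarrow> nat" where e: "inj_on e (carrier Q)"
    using finite_imp_inj_to_nat_seg[OF Q(2)] by blast
  define d where "d = inv_into (carrier Q) e"
  have d: "d (e x) = x" if "x \<in> carrier Q" for x
    unfolding d_def using e that by simp
  define H where "H = \<lparr>carrier = e ` carrier Q, monoid.mult = (\<lambda>a b. e (d a \<otimes>\<^bsub>Q\<^esub> d b)), one = e \<one>\<^bsub>Q\<^esub>\<rparr>"
  have "group H"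
  proof (rule groupI)
    fix x assume "x \<in> carrier H"
    then obtain y where y: "y \<in> carrier Q" "x = e y" by (auto simp: H_def)
    show "\<exists>y\<in>carrier H. y \<otimes>\<^bsub>H\<^esub> x = \<one>\<^bsub>H\<^esub>"
      by (rule bexI[of _ "e (inv\<^bsub>Q\<^esub> y)"]) (use y in \<open>auto simp: H_def d\<close>)
  qed (auto simp: H_def d m_assoc)
  moreover have "e \<in> iso Q H"
    unfolding iso_def hom_def bij_betw_def using e by (auto simp: H_def d)
  moreover have "finite (carrier H)" using Q by (simp add: H_def)
  ultimately show ?thesis by blast
qed

lemma (in group_hom) normal_preimage:
  assumes "N \<lhd> H"
  shows "{g \<in> carrier G. h g \<in> N} \<lhd> G"
proof -
  have N: "subgroup N H" using assms normal_imp_subgroup by blast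
  show ?thesis
  proof (rule G.normal_invI)
    show "subgroup {g \<in> carrier G. h g \<in> N} G"
      using subgroup.one_closed[OF N] subgroup.m_inv_closed[OF N] subgroup.m_closed[OF N]
      by (intro G.subgroupI) (auto intro!: exI[of _ \<one>])
    fix g k assume "g \<in> carrier G" "k \<in> {g \<in> carrier G. h g \<in> N}"
    then show "g \<otimes> k \<otimes> inv g \<in> {g \<in> carrier G. h g \<in> N}"
      using assms by (auto simp: H.normal_inv_iff)
  qed
qed

context group begin

lemma detected_by_finite_index:
  assumes "M \<lhd> G" "finite (carrier (G Mod M))" "x \<in> carrier G" "x \<notin> M"
  shows "\<exists>H. detected_by G x H"
proof -
  interpret M: normal M G by (rule assms)
  obtain H :: "nat monoid" and e where H: "group H" "finite (carrier H)" "e \<in> iso (G Mod M) H"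
    using finite_group_iso_nat[OF M.factorgroup_is_group assms(2)] by blast
  interpret Q: group "G Mod M" by (rule M.factorgroup_is_group)
  have e: "e \<in> hom (G Mod M) H" "bij_betw e (carrier (G Mod M)) (carrier H)"
    using H by (auto simp: iso_def)
  have im: "(\<lambda>a. M #> a) ` carrier G = carrier (G Mod M)"
    by (auto simp: FactGroup_def RCOSETS_def)
  have "e \<circ> (\<lambda>a. M #> a) \<in> epi G H"
  proof -
    have "e \<circ> (\<lambda>a. M #> a) \<in> hom G H"
      using e(1) M.r_coset_hom_Mod by (auto simp: hom_def Pi_def)
    moreover have "(e \<circ> (\<lambda>a. M #> a)) ` carrier G = carrier H"
      using e(2) unfolding bij_betw_def by (simp only: image_comp[symmetric] im)
    ultimately show ?thesis unfolding epi_def by blast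
  qed
  moreover have "(e \<circ> (\<lambda>a. M #> a)) x \<noteq> \<one>\<^bsub>H\<^esub>"
  proof
    assume "(e \<circ> (\<lambda>a. M #> a)) x = \<one>\<^bsub>H\<^esub>"
    then have "e (M #> x) = e \<one>\<^bsub>G Mod M\<^esub>"
      using hom_one[OF e(1) Q.group_axioms H(1)] by simp
    then have "M #> x = \<one>\<^bsub>G Mod M\<^esub>"
      using e(2) im assms(3) unfolding bij_betw_def by (metis Q.one_closed image_eqI inj_onD)
    then have "x \<in> M" using rcos_self[OF assms(3) M.subgroup_axioms] by (simp add: FactGroup_def)
    then show False using assms by simp
  qed
  ultimately show ?thesis using H unfolding detected_by_def by blast
qed

lemma subgroup_chain_Union:
  assumes "C \<noteq> {}" "\<And>N. N \<in> C \<Longrightarrow> N \<lhd> G" "\<And>N N'. N \<in> C \<Longrightarrow> N' \<in> C \<Longrightarrow> N \<subseteq> N' \<or> N' \<subseteq> N"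
  shows "\<Union>C \<lhd> G"
proof (rule normal_invI)
  have sub: "subgroup N G" if "N \<in> C" for N using assms(2) that normal_imp_subgroup by blast
  show "subgroup (\<Union>C) G"
  proof (rule subgroupI)
    show "\<Union>C \<subseteq> carrier G" using sub subgroup.subset by blast
    show "\<Union>C \<noteq> {}" using assms(1) sub subgroup.one_closed by blast
    show "inv a \<in> \<Union>C" if "a \<in> \<Union>C" for a
      using that subgroup.m_inv_closed[OF sub, of _ a] by auto
    fix a b assume "a \<in> \<Union>C" "b \<in> \<Union>C"
    then obtain N N' where N: "N \<in> C" "N' \<in> C" "a \<in> N" "b \<in> N'" by blast
    then consider "N \<subseteq> N'" | "N' \<subseteq> N" using assms(3) by blast
    then show "a \<otimes> b \<in> \<Union>C"
    proof cases
      case 1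
      then show ?thesis using N subgroup.m_closed[OF sub[of N'], of a b] by blast
    next
      case 2
      then show ?thesis using N subgroup.m_closed[OF sub[of N], of a b] by blast
    qed
  qed
  fix x h assume "x \<in> carrier G" "h \<in> \<Union>C"
  then show "x \<otimes> h \<otimes> inv x \<in> \<Union>C" using assms(2) normal_inv_iff by blast
qed

lemma ex_maximal_normal_avoiding:
  assumes "K \<lhd> G" "x \<notin> K"
  shows "\<exists>M. M \<lhd> G \<and> K \<subseteq> M \<and> x \<notin> M \<and> (\<forall>N. N \<lhd> G \<longrightarrow> M \<subseteq> N \<longrightarrow> x \<notin> N \<longrightarrow> N = M)"
proof -
  let ?A = "{N. N \<lhd> G \<and> K \<subseteq> N \<and> x \<notin> N}"
  have "\<exists>M\<in>?A. \<forall>N\<in>?A. M \<subseteq> N \<longrightarrow> N = M"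
  proof (rule subset_Zorn_nonempty)
    show "?A \<noteq> {}" using assms by blast
    fix C assume C: "C \<noteq> {}" "subset.chain ?A C"
    have "\<Union>C \<lhd> G"
      using C by (intro subgroup_chain_Union) (auto simp: subset.chain_def)
    then show "\<Union>C \<in> ?A" using C by (auto simp: subset.chain_def)
  qed
  then obtain M where M: "M \<in> ?A" and max: "\<And>N. N \<in> ?A \<Longrightarrow> M \<subseteq> N \<Longrightarrow> N = M" by auto
  have "N = M" if "N \<lhd> G" "M \<subseteq> N" "x \<notin> N" for N
    using max[of N] M that by auto
  then show ?thesis using M by (intro exI[of _ M]) auto
qed

text \<open>The quotient by a normal subgroup that is maximal among those avoiding \<open>x\<close> is monolithic.\<close>

lemma detected_by_abelian_quotient_extension:
  assumes S: "finite S" "S \<subseteq> carrier G" "generate G S = carrier G" and A: "A \<lhd> G"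
    and comm: "\<And>g h. g \<in> carrier G \<Longrightarrow> h \<in> carrier G \<Longrightarrow> g \<otimes> h \<otimes> inv g \<otimes> inv h \<in> A"
    and K: "K \<lhd> G" "finite ((\<lambda>a. K #> a) ` A)" and x: "x \<in> carrier G" "x \<notin> K"
  shows "\<exists>H. detected_by G x H"
proof -
  obtain M where M: "M \<lhd> G" "K \<subseteq> M" "x \<notin> M"
    and max: "\<And>N. N \<lhd> G \<Longrightarrow> M \<subseteq> N \<Longrightarrow> x \<notin> N \<Longrightarrow> N = M"
    using ex_maximal_normal_avoiding[OF K(1) x(2)] by blast
  interpret M: normal M G by (rule M)
  interpret A: normal A G by (rule A)
  define \<pi> where "\<pi> a = M #> a" for a
  interpret \<pi>: group_hom G "G Mod M" \<pi>
    unfolding \<pi>_def group_hom_def group_hom_axioms_def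
    using M.r_coset_hom_Mod M.factorgroup_is_group group_axioms by simp
  have surj: "\<pi> ` carrier G = carrier (G Mod M)"
    by (auto simp: \<pi>_def FactGroup_def RCOSETS_def)
  have ker: "\<pi> a = \<one>\<^bsub>G Mod M\<^esub> \<longleftrightarrow> a \<in> M" if "a \<in> carrier G" for a
    using that rcos_self[OF that M.subgroup_axioms] M.rcos_const[of a] group_axioms
    by (auto simp: \<pi>_def FactGroup_def)
  have "finite (carrier (G Mod M))"
  proof (rule \<pi>.H.finite_if_monolithic[of "\<pi> ` S" "\<pi> ` A" "\<pi> x"])
    show "finite (\<pi> ` S)" using S by simp
    show "\<pi> ` S \<subseteq> carrier (G Mod M)" using S surj by blast
    show "generate (G Mod M) (\<pi> ` S) = carrier (G Mod M)"
      using \<pi>.generate_img[OF S(2)] S(3) surj by simp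
    \<comment> \<open>Since \<open>K \<subseteq> M\<close>, the coset of \<open>a\<close> modulo
      \<open>M\<close> depends only on its coset modulo \<open>K\<close>, of which there are
      finitely many.\<close>
    have "\<pi> a = M <#> (K #> a)" if "a \<in> A" for a
    proof -
      have a: "a \<in> carrier G" using that A.subset by blast
      have "M <#> K = M"
      proof
        show "M <#> K \<subseteq> M" using M(2) by (auto simp: set_mult_def)
        show "M \<subseteq> M <#> K"
          using subgroup.one_closed[OF normal_imp_subgroup[OF K(1)]] M.subset
          by (force simp: set_mult_def)
      qed
      then show ?thesis unfolding \<pi>_def
        using setmult_rcos_assoc[of M K a] M.subset a K(1) normal_imp_subgroup subgroup.subset by metis
    qed
    then have "\<pi> ` A \<subseteq> (\<lambda>k. M <#> k) ` (\<lambda>a. K #> a) ` A" by auto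
    then show "finite (\<pi> ` A)" using K(2) finite_subset by blast
    show "\<pi> ` A \<lhd> G Mod M"
      using A.surj_hom_normal_subgroup[OF \<pi>.group_hom_axioms surj] .
    show "g \<otimes>\<^bsub>G Mod M\<^esub> h \<otimes>\<^bsub>G Mod M\<^esub> inv\<^bsub>G Mod M\<^esub> g \<otimes>\<^bsub>G Mod M\<^esub> inv\<^bsub>G Mod M\<^esub> h \<in> \<pi> ` A"
      if "g \<in> carrier (G Mod M)" "h \<in> carrier (G Mod M)" for g h
    proof -
      have "g \<in> \<pi> ` carrier G" "h \<in> \<pi> ` carrier G" using that surj by auto
      then obtain g' h' where gh: "g' \<in> carrier G" "h' \<in> carrier G" "g = \<pi> g'" "h = \<pi> h'"
        by (elim imageE)
      then have "g \<otimes>\<^bsub>G Mod M\<^esub> h \<otimes>\<^bsub>G Mod M\<^esub> inv\<^bsub>G Mod M\<^esub> g \<otimes>\<^bsub>G Mod M\<^esub> inv\<^bsub>G Mod M\<^esub> h = \<pi> (g' \<otimes> h' \<otimes> inv g' \<otimes> inv h')"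
        by simp
      then show ?thesis using comm[OF gh(1,2)] by (simp only: imageI)
    qed
    show "\<pi> x \<noteq> \<one>\<^bsub>G Mod M\<^esub>" using ker x M by blast
    fix N assume N: "N \<lhd> G Mod M" "N \<noteq> {\<one>\<^bsub>G Mod M\<^esub>}"
    \<comment> \<open>The preimage of a nontrivial normal subgroup of the quotient lies strictly
      above \<open>M\<close>, so by maximality of \<open>M\<close> it contains
      \<open>x\<close>.\<close>
    define P where "P = {g \<in> carrier G. \<pi> g \<in> N}"
    have Ns: "subgroup N (G Mod M)" using N normal_imp_subgroup by blast
    have "P \<lhd> G" unfolding P_def by (rule \<pi>.normal_preimage[OF N(1)])
    moreover have "M \<subseteq> P" using ker subgroup.one_closed[OF Ns] M.subset by (auto simp: P_def)
    moreover have "P \<noteq> M"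
    proof -
      obtain y where "y \<in> N" "y \<noteq> \<one>\<^bsub>G Mod M\<^esub>" using N(2) subgroup.one_closed[OF Ns] by blast
      moreover from this obtain g where "g \<in> carrier G" "y = \<pi> g"
        using surj subgroup.subset[OF Ns] by blast
      ultimately show ?thesis using ker unfolding P_def by blast
    qed
    ultimately have "x \<in> P" using max by blast
    then show "\<pi> x \<in> N" by (simp add: P_def)
  qed
  then show ?thesis using detected_by_finite_index M x by blast
qed

text \<open>Elements outside \<open>A\<close> are covered by the choice \<open>K = A\<close>, whose
  image of \<open>A\<close> is a single coset; only the elements of \<open>A\<close> require the
  hypothesis on subgroups \<open>K\<close>.\<close>

lemma residually_finite_abelian_by_abelianI:
  assumes S: "finite S" "S \<subseteq> carrier G" "generate G S = carrier G" and A: "A \<lhd> G"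
    and comm: "\<And>g h. g \<in> carrier G \<Longrightarrow> h \<in> carrier G \<Longrightarrow> g \<otimes> h \<otimes> inv g \<otimes> inv h \<in> A"
    and K: "\<And>x. x \<in> A \<Longrightarrow> x \<noteq> \<one> \<Longrightarrow> \<exists>K. K \<lhd> G \<and> finite ((\<lambda>a. K #> a) ` A) \<and> x \<notin> K"
  shows "residually_finite G"
  unfolding residually_finite_def
proof (intro ballI impI)
  fix x assume x: "x \<in> carrier G" "x \<noteq> \<one>"
  show "\<exists>H. detected_by G x H"
  proof (cases "x \<in> A")
    case True
    then obtain K where "K \<lhd> G" "finite ((\<lambda>a. K #> a) ` A)" "x \<notin> K" using K x by blast
    then show ?thesis
      using detected_by_abelian_quotient_extension[OF S A comm] x by blast
  next
    case False
    interpret A: normal A G by (rule A)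
    have "(\<lambda>a. A #> a) ` A \<subseteq> {A}" using A.rcos_const group_axioms by auto
    then have "finite ((\<lambda>a. A #> a) ` A)" using finite_subset by blast
    then show ?thesis
      using detected_by_abelian_quotient_extension[OF S A comm A] x False by blast
  qed
qed

end


section \<open>Exponentially distorted elements\<close>

context group begin

lemma word_length_le:
  assumes "set ws \<subseteq> S \<union> m_inv G ` S" "foldr (\<lambda>a b. a \<otimes> b) ws \<one> = x"
  shows "word_length G S x \<le> length ws"
  unfolding word_length_def by (rule Least_le) (use assms in blast)

lemma foldr_mult_closed:
  assumes "set ws \<subseteq> carrier G" "b \<in> carrier G"
  shows "foldr (\<lambda>a b. a \<otimes> b) ws b \<in> carrier G"
  using assms by (induction ws) auto

lemma foldr_mult_append:
  assumes "set ws \<subseteq> carrier G" "set vs \<subseteq> carrier G"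
  shows "foldr (\<lambda>a b. a \<otimes> b) (ws @ vs) \<one> = foldr (\<lambda>a b. a \<otimes> b) ws \<one> \<otimes> foldr (\<lambda>a b. a \<otimes> b) vs \<one>"
  using assms by (induction ws) (auto simp: foldr_mult_closed m_assoc)

lemma generate_imp_word:
  assumes "S \<subseteq> carrier G" "x \<in> generate G S"
  shows "\<exists>ws. set ws \<subseteq> S \<union> m_inv G ` S \<and> foldr (\<lambda>a b. a \<otimes> b) ws \<one> = x"
  using assms(2)
proof induction
  case one
  show ?case by (rule exI[of _ "[]"]) simp
next
  case (incl h)
  then show ?case using assms by (intro exI[of _ "[h]"]) auto
next
  case (inv h)
  then have "h \<in> carrier G" using assms by blast
  then show ?case using inv by (intro exI[of _ "[inv h]"]) auto
next
  case (eng h1 h2)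
  then obtain ws vs where w: "set ws \<subseteq> S \<union> m_inv G ` S" "foldr (\<lambda>a b. a \<otimes> b) ws \<one> = h1"
    "set vs \<subseteq> S \<union> m_inv G ` S" "foldr (\<lambda>a b. a \<otimes> b) vs \<one> = h2" by blast
  have "S \<union> m_inv G ` S \<subseteq> carrier G" using assms by auto
  then show ?case using w foldr_mult_append[of ws vs] by (intro exI[of _ "ws @ vs"]) auto
qed

lemma word_length_word:
  assumes "S \<subseteq> carrier G" "x \<in> generate G S"
  shows "\<exists>ws. length ws = word_length G S x \<and> set ws \<subseteq> S \<union> m_inv G ` S \<and> foldr (\<lambda>a b. a \<otimes> b) ws \<one> = x"
  unfolding word_length_def by (rule LeastI_ex) (use generate_imp_word[OF assms] in blast)

lemma word_length_one: "word_length G S \<one> = 0"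
  using word_length_le[of "[]" S \<one>] by simp

lemma word_length_mult:
  assumes S: "S \<subseteq> carrier G" and x: "x \<in> generate G S" and y: "y \<in> generate G S"
  shows "word_length G S (x \<otimes> y) \<le> word_length G S x + word_length G S y"
proof -
  obtain ws vs where w: "length ws = word_length G S x" "set ws \<subseteq> S \<union> m_inv G ` S" "foldr (\<lambda>a b. a \<otimes> b) ws \<one> = x"
    "length vs = word_length G S y" "set vs \<subseteq> S \<union> m_inv G ` S" "foldr (\<lambda>a b. a \<otimes> b) vs \<one> = y"
    using word_length_word[OF S x] word_length_word[OF S y] by blast
  have "S \<union> m_inv G ` S \<subseteq> carrier G" using S by auto
  then have "word_length G S (x \<otimes> y) \<le> length (ws @ vs)"
    using w foldr_mult_append[of ws vs] by (intro word_length_le) auto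
  then show ?thesis using w by simp
qed

lemma finite_word_length_ball:
  assumes "finite S" "S \<subseteq> carrier G" "generate G S = carrier G"
  shows "finite {x \<in> carrier G. word_length G S x \<le> n}"
proof (rule finite_subset)
  let ?W = "{ws. set ws \<subseteq> S \<union> m_inv G ` S \<and> length ws \<le> n}"
  show "finite ((\<lambda>ws. foldr (\<lambda>a b. a \<otimes> b) ws \<one>) ` ?W)"
    using assms(1) by (intro finite_imageI finite_lists_length_le) auto
  show "{x \<in> carrier G. word_length G S x \<le> n} \<subseteq> (\<lambda>ws. foldr (\<lambda>a b. a \<otimes> b) ws \<one>) ` ?W"
    using word_length_word[OF assms(2)] assms(3) by force
qed

lemma less_D_RF:
  assumes x: "x \<in> carrier G" and L: "\<And>j. 1 \<le> j \<Longrightarrow> j \<le> n \<Longrightarrow> j dvd L"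
    and det: "\<exists>H. detected_by G (x [^] (L::nat)) H"
  shows "n < D_RF G (x [^] L)"
proof -
  have "\<exists>H. detected_by G (x [^] L) H \<and> order H = D_RF G (x [^] L)"
    unfolding D_RF_def by (rule LeastI_ex) (use det in blast)
  then obtain H where dH: "detected_by G (x [^] L) H" and oH: "order H = D_RF G (x [^] L)"
    by blast
  from dH obtain \<phi> where H: "group H" "finite (carrier H)"
    "\<phi> \<in> hom G H" "\<phi> (x [^] L) \<noteq> \<one>\<^bsub>H\<^esub>"
    unfolding detected_by_def epi_def by blast
  interpret H: group H by (rule H)
  interpret \<phi>: group_hom G H \<phi>
    unfolding group_hom_def group_hom_axioms_def using H group_axioms by simp
  show ?thesis
  proof (rule ccontr)
    assume "\<not> ?thesis"
    moreover have "0 < order H" using H H.order_gt_0_iff_finite by blast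
    ultimately have "order H dvd L" using L[of "order H"] oH by simp
    then obtain k where "L = order H * k" by blast
    then have "\<phi> x [^]\<^bsub>H\<^esub> L = \<one>\<^bsub>H\<^esub>"
      using H.pow_order_eq_1[of "\<phi> x"] x by (simp add: H.nat_pow_pow[symmetric])
    then show False using H x by (simp add: \<phi>.hom_nat_pow)
  qed
qed

lemma D_RF_le_RF:
  assumes "finite_generating_set G S" "x \<in> carrier G" "x \<noteq> \<one>" "word_length G S x \<le> n"
  shows "D_RF G x \<le> RF G S n"
proof -
  have "{D_RF G x | x. x \<in> carrier G \<and> x \<noteq> \<one> \<and> word_length G S x \<le> n}
        \<subseteq> D_RF G ` {x \<in> carrier G. word_length G S x \<le> n}" by blast
  then have "finite {D_RF G x | x. x \<in> carrier G \<and> x \<noteq> \<one> \<and> word_length G S x \<le> n}"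
    using finite_word_length_ball assms(1) unfolding finite_generating_set_def
    by (meson finite_imageI finite_subset)
  then show ?thesis unfolding RF_def by (rule Max_ge) (use assms in blast)
qed

lemma linear_le_RF_if_exponentially_distorted:
  assumes rf: "residually_finite G" and S: "finite_generating_set G S"
    and x: "x \<in> carrier G" "\<And>m::nat. m \<ge> 1 \<Longrightarrow> x [^] m \<noteq> \<one>"
    and len: "\<And>m::nat. m \<ge> 1 \<Longrightarrow> real (word_length G S (x [^] m)) \<le> c * (1 + ln (real m))"
  shows "(\<lambda>n. n) \<preceq> RF G S"
proof -
  \<comment> \<open>From \<open>ln L \<le> n * ln 16\<close> and \<open>n \<ge> 1\<close> the word
    length of \<open>x [^] L\<close> is at most \<open>c * (1 + ln 16) * n\<close>. The added 1
    makes \<open>C\<close> positive, as \<open>\<preceq>\<close> demands.\<close>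
  define C where "C = nat \<lceil>c * (1 + ln 16)\<rceil> + 1"
  have c0: "c \<ge> 0" using len[of 1] by (simp add: order_trans[of 0 "real (word_length G S (x [^] Suc 0))" c])
  have C: "c * (1 + ln 16) \<le> real C" unfolding C_def by linarith
  have "n \<le> C * RF G S (C * n)" if n: "n \<ge> 1" for n
  proof -
    define L where "L = (Lcm {1..n} :: nat)"
    have L0: "L \<noteq> 0" unfolding L_def by (auto simp: Lcm_0_iff)
    then have L: "L \<ge> 1" by simp
    have "ln (real L) \<le> ln (real (16 ^ n))" using Lcm_le_power[of n] L unfolding L_def[symmetric]
      by (subst ln_le_cancel_iff) (auto simp del: of_nat_power)
    also have "\<dots> = real n * ln 16" by (simp add: ln_realpow)
    finally have "c * (1 + ln (real L)) \<le> c * (real n + real n * ln 16)"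
      using c0 n by (intro mult_left_mono) auto
    also have "\<dots> = c * (1 + ln 16) * real n" by (simp add: algebra_simps)
    also have "\<dots> \<le> real (C * n)" using C n mult_right_mono[of "c * (1 + ln 16)" "real C" "real n"] by simp
    finally have "real (word_length G S (x [^] L)) \<le> real (C * n)" using len[OF L] by linarith
    then have wl: "word_length G S (x [^] L) \<le> C * n" by linarith
    have "n < D_RF G (x [^] L)"
    proof (rule less_D_RF[OF x(1)])
      show "\<exists>H. detected_by G (x [^] L) H"
        using rf x L unfolding residually_finite_def by simp
    qed (simp add: L_def)
    also have "\<dots> \<le> RF G S (C * n)" using D_RF_le_RF[OF S _ _ wl] x L by simp
    also have "\<dots> \<le> C * RF G S (C * n)" by (simp add: C_def)
    finally show ?thesis by simp
  qed
  then show ?thesis unfolding growth_le_def by (intro exI[of _ C]) (simp add: C_def)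
qed

end

lemma epi_comp: "h \<in> epi G H \<Longrightarrow> k \<in> epi H K \<Longrightarrow> k \<circ> h \<in> epi G K"
  unfolding epi_def using hom_compose[of h G H k K] by (simp only: mem_Collect_eq image_comp[symmetric])

text \<open>Allows the bound to be proved for a subgroup of the model and carried over to the given
  lattice. Every finite generating set of the target is the image of one of the source, so the
  quantification over all \<open>S\<close> survives.\<close>

lemma RF_bounded_below_by_iso:
  assumes G: "group G" and K: "group K" and h: "h \<in> iso G K" and rf: "RF_bounded_below_by G f"
  shows "RF_bounded_below_by K f"
proof -
  interpret G: group G by (rule G)
  interpret K: group K by (rule K)
  interpret h: group_hom G K h
    unfolding group_hom_def group_hom_axioms_def using h G K by (simp add: iso_def)
  have bij: "bij_betw h (carrier G) (carrier K)" using h by (simp add: iso_def)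
  have inj: "h x = h y \<longleftrightarrow> x = y" if "x \<in> carrier G" "y \<in> carrier G" for x y
    using bij that unfolding bij_betw_def by (meson inj_on_eq_iff)
  have det: "detected_by K (h x) H \<longleftrightarrow> detected_by G x H" if x: "x \<in> carrier G" for x H
  proof
    assume "detected_by K (h x) H"
    then obtain \<phi> where "group H" "finite (carrier H)" "\<phi> \<in> epi K H" "\<phi> (h x) \<noteq> \<one>\<^bsub>H\<^esub>"
      unfolding detected_by_def by blast
    moreover from this have "\<phi> \<circ> h \<in> epi G H"
      using h by (intro epi_comp[of h G K]) (auto simp: iso_iff_mon_epi)
    ultimately show "detected_by G x H"
      unfolding detected_by_def by (auto intro!: bexI[of _ "\<phi> \<circ> h"])
  next
    assume "detected_by G x H"
    then obtain \<phi> where p: "group H" "finite (carrier H)" "\<phi> \<in> epi G H" "\<phi> x \<noteq> \<one>\<^bsub>H\<^esub>"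
      unfolding detected_by_def by blast
    define g where "g = inv_into (carrier G) h"
    have gi: "g \<in> iso K G" unfolding g_def using G.iso_set_sym[OF h] .
    have "\<phi> \<circ> g \<in> epi K H"
      using gi p(3) by (intro epi_comp[of g K G]) (auto simp: iso_iff_mon_epi)
    moreover have "g (h x) = x" unfolding g_def using bij x by (simp add: bij_betw_def)
    ultimately show "detected_by K (h x) H"
      using p unfolding detected_by_def by (auto intro!: bexI[of _ "\<phi> \<circ> g"])
  qed
  have D: "D_RF K (h x) = D_RF G x" if "x \<in> carrier G" for x
    unfolding D_RF_def using det[OF that] by simp
  have fold: "foldr (\<lambda>a b. a \<otimes>\<^bsub>K\<^esub> b) (map h ws) \<one>\<^bsub>K\<^esub> = h (foldr (\<lambda>a b. a \<otimes>\<^bsub>G\<^esub> b) ws \<one>\<^bsub>G\<^esub>)"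
    if "set ws \<subseteq> carrier G" for ws
    using that by (induction ws) (auto simp: G.foldr_mult_closed)
  have wl: "word_length K (h ` S) (h x) = word_length G S x" if S: "S \<subseteq> carrier G" and x: "x \<in> carrier G" for S x
  proof -
    have e: "h ` (S \<union> m_inv G ` S) = h ` S \<union> m_inv K ` h ` S"
      unfolding image_Un image_image using S by (intro arg_cong2[of _ _ _ _ "(\<union>)"] image_cong) auto
    have sub: "S \<union> m_inv G ` S \<subseteq> carrier G" using S by auto
    have "(\<exists>ws. length ws = k \<and> set ws \<subseteq> h ` S \<union> m_inv K ` h ` S \<and> foldr (\<lambda>a b. a \<otimes>\<^bsub>K\<^esub> b) ws \<one>\<^bsub>K\<^esub> = h x) \<longleftrightarrow>
      (\<exists>ws. length ws = k \<and> set ws \<subseteq> S \<union> m_inv G ` S \<and> foldr (\<lambda>a b. a \<otimes>\<^bsub>G\<^esub> b) ws \<one>\<^bsub>G\<^esub> = x)" (is "?l = ?r") for k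
    proof
      assume ?l
      then obtain vs where v: "length vs = k" "set vs \<subseteq> h ` (S \<union> m_inv G ` S)" "foldr (\<lambda>a b. a \<otimes>\<^bsub>K\<^esub> b) vs \<one>\<^bsub>K\<^esub> = h x"
        using e by auto
      then have "vs \<in> map h ` lists (S \<union> m_inv G ` S)" by (simp add: lists_image[symmetric] in_lists_conv_set subset_iff)
      then obtain ws where ws: "vs = map h ws" "set ws \<subseteq> S \<union> m_inv G ` S" by (auto simp: in_lists_conv_set)
      then have "h (foldr (\<lambda>a b. a \<otimes>\<^bsub>G\<^esub> b) ws \<one>\<^bsub>G\<^esub>) = h x" using v fold[of ws] sub by simp
      then have "foldr (\<lambda>a b. a \<otimes>\<^bsub>G\<^esub> b) ws \<one>\<^bsub>G\<^esub> = x"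
        using inj x G.foldr_mult_closed[of ws "\<one>\<^bsub>G\<^esub>"] ws sub by simp
      then show ?r using ws v by (intro exI[of _ ws]) auto
    next
      assume ?r
      then obtain ws where ws: "length ws = k" "set ws \<subseteq> S \<union> m_inv G ` S" "foldr (\<lambda>a b. a \<otimes>\<^bsub>G\<^esub> b) ws \<one>\<^bsub>G\<^esub> = x" by blast
      then show ?l using fold[of ws] sub e[symmetric] by (intro exI[of _ "map h ws"]) auto
    qed
    then show ?thesis unfolding word_length_def by simp
  qed
  have one: "h x = \<one>\<^bsub>K\<^esub> \<longleftrightarrow> x = \<one>\<^bsub>G\<^esub>" if "x \<in> carrier G" for x
    using inj[OF that G.one_closed] by simp
  have carK: "carrier K = h ` carrier G" using bij by (simp add: bij_betw_def)
  have RF: "RF K (h ` S) n = RF G S n" if S: "S \<subseteq> carrier G" for S n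
  proof -
    have "{D_RF K y | y. y \<in> carrier K \<and> y \<noteq> \<one>\<^bsub>K\<^esub> \<and> word_length K (h ` S) y \<le> n} =
          {D_RF G x | x. x \<in> carrier G \<and> x \<noteq> \<one>\<^bsub>G\<^esub> \<and> word_length G S x \<le> n}"
      unfolding carK using D wl[OF S] one by (auto simp: image_iff) metis+
    then show ?thesis unfolding RF_def by simp
  qed
  have fg: "finite_generating_set K (h ` S) \<longleftrightarrow> finite_generating_set G S" if S: "S \<subseteq> carrier G" for S
  proof -
    have "finite (h ` S) \<longleftrightarrow> finite S"
      using bij S by (meson bij_betw_def finite_image_iff inj_on_subset)
    moreover have "generate K (h ` S) = carrier K \<longleftrightarrow> generate G S = carrier G"
      using h.generate_img[OF S] carK bij G.generate_incl[OF S]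
      by (metis bij_betw_def inj_on_image_eq_iff order_refl)
    ultimately show ?thesis unfolding finite_generating_set_def using S carK by auto
  qed
  show ?thesis
    unfolding RF_bounded_below_by_def
  proof (intro conjI allI impI)
    show "\<exists>S. finite_generating_set K S"
      using rf fg unfolding RF_bounded_below_by_def finite_generating_set_def by metis
    show "residually_finite K"
      unfolding residually_finite_def carK
    proof (intro ballI impI)
      fix y assume y: "y \<in> h ` carrier G" "y \<noteq> \<one>\<^bsub>K\<^esub>"
      then obtain x where x: "x \<in> carrier G" "y = h x" by blast
      then obtain H where "detected_by G x H"
        using rf y unfolding RF_bounded_below_by_def residually_finite_def by (metis h.hom_one)
      then show "\<exists>H. detected_by K y H" using det x by blast
    qed
    fix S assume S: "finite_generating_set K S"
    then obtain S' where S': "S' \<subseteq> carrier G" "S = h ` S'"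
      unfolding finite_generating_set_def carK by (meson subset_imageE)
    then have "f \<preceq> RF G S'" using rf fg S unfolding RF_bounded_below_by_def by blast
    then show "f \<preceq> RF K S" unfolding growth_le_def S' using RF[OF S'(1)] by simp
  qed
qed


section \<open>Semidirect products of vector groups and their lattices\<close>

definition model_monoid :: "('e::real_vector \<Rightarrow> 'e \<Rightarrow> 'e) \<Rightarrow> 'e monoid" where
  "model_monoid \<rho> = \<lparr>carrier = UNIV, monoid.mult = (\<lambda>x y. x + \<rho> x y), one = 0\<rparr>"

text \<open>
  The space \<open>'e\<close> is \<open>ker q \<oplus> range q\<close>, and \<open>x + \<rho> x y\<close> is the multiplication of the semidirect
  product in which the vector group \<open>range q\<close> acts on the vector group \<open>ker q\<close> by \<open>\<rho>\<close>; for
  convenience \<open>\<rho> x\<close> is defined for all \<open>x\<close>, depends on \<open>q x\<close> only and is the identity on \<open>range q\<close>.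
\<close>

locale model_group =
  fixes q :: "'e::euclidean_space \<Rightarrow> 'e" and \<rho> :: "'e \<Rightarrow> 'e \<Rightarrow> 'e"
  assumes q_linear: "linear q" and q_q [simp]: "q (q x) = q x"
    and rho_linear: "linear (\<rho> x)" and rho_q: "\<rho> (q x) = \<rho> x" and q_rho [simp]: "q (\<rho> x y) = q y"
    and rho_fix [simp]: "\<rho> x (q y) = q y" and rho_add: "\<rho> (x + y) v = \<rho> x (\<rho> y v)"
    and rho_0 [simp]: "\<rho> 0 v = v"
    and rho_cont: "continuous_on UNIV (\<lambda>z. \<rho> (fst z) (snd z))"
    and faithful: "(\<And>v. q v = 0 \<Longrightarrow> \<rho> x v = v) \<Longrightarrow> q x = 0"
    and contract: "q v = 0 \<Longrightarrow>
      v \<in> span {v. q v = 0 \<and> (\<exists>x C d. 0 < d \<and> d < 1 \<and> (\<forall>j::nat. norm (\<rho> (real j *\<^sub>R x) v) \<le> C * d ^ j))}"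
begin

definition mul :: "'e \<Rightarrow> 'e \<Rightarrow> 'e" (infixl "\<star>" 70) where "x \<star> y = x + \<rho> x y"
definition iv :: "'e \<Rightarrow> 'e" where "iv x = - \<rho> (- x) x"

lemmas q_simps [simp] = linear_0[OF q_linear] linear_add[OF q_linear] linear_diff[OF q_linear]
  linear_neg[OF q_linear] linear_scale[OF q_linear]
lemmas rho_simps [simp] = linear_0[OF rho_linear] linear_add[OF rho_linear] linear_diff[OF rho_linear]
  linear_neg[OF rho_linear] linear_scale[OF rho_linear]

lemma rho_cong: "q x = q y \<Longrightarrow> \<rho> x = \<rho> y"
  by (metis rho_q)

lemma rho_ker [simp]: "q x = 0 \<Longrightarrow> \<rho> x v = v"
  using rho_cong[of x 0] by simp

lemma q_mul [simp]: "q (x \<star> y) = q x + q y"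
  by (simp add: mul_def)

lemma q_iv [simp]: "q (iv x) = - q x"
  by (simp add: iv_def)

lemma rho_mul: "\<rho> (x \<star> y) v = \<rho> x (\<rho> y v)"
  using rho_cong[of "x \<star> y" "x + y"] by (simp add: rho_add)

lemma rho_minus [simp]: "\<rho> x (\<rho> (- x) v) = v" "\<rho> (- x) (\<rho> x v) = v"
  by (simp_all flip: rho_add)

lemma mul_assoc: "x \<star> y \<star> z = x \<star> (y \<star> z)"
  using rho_mul[of x y z] unfolding mul_def by simp

lemma mul_0 [simp]: "x \<star> 0 = x" "0 \<star> x = x"
  by (simp_all add: mul_def)

lemma rho_iv: "\<rho> (iv x) = \<rho> (- x)"
  by (rule rho_cong) simp

lemma iv_mul [simp]: "iv x \<star> x = 0" "x \<star> iv x = 0"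
  by (simp_all add: mul_def rho_iv) (simp_all add: iv_def)

lemma iv_mul_cancel [simp]: "iv x \<star> (x \<star> y) = y" "x \<star> (iv x \<star> y) = y"
  by (simp_all flip: mul_assoc)

lemma mul_eq_0_iff: "iv x \<star> y = 0 \<longleftrightarrow> x = y"
  by (metis iv_mul(1) iv_mul_cancel(2) mul_0(1))

lemma ker_mul [simp]: "q x = 0 \<Longrightarrow> x \<star> y = x + y"
  by (simp add: mul_def)

lemma conj_ker: "q v = 0 \<Longrightarrow> x \<star> v \<star> iv x = \<rho> x v"
  by (simp add: mul_def rho_add) (simp add: iv_def mul_def rho_add[symmetric])

abbreviation "MG \<equiv> model_monoid \<rho>"

lemma MG_simps [simp]: "carrier MG = UNIV" "\<one>\<^bsub>MG\<^esub> = 0" "x \<otimes>\<^bsub>MG\<^esub> y = x \<star> y"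
  by (simp_all add: model_monoid_def mul_def)

lemma group_MG: "group MG"
proof (rule groupI)
  fix x assume "x \<in> carrier MG"
  show "\<exists>y\<in>carrier MG. y \<otimes>\<^bsub>MG\<^esub> x = \<one>\<^bsub>MG\<^esub>"
    by (rule bexI[of _ "iv x"]) simp_all
qed (simp_all add: mul_assoc)

sublocale MG: group MG by (rule group_MG)

lemma inv_MG [simp]: "inv\<^bsub>MG\<^esub> x = iv x"
  using MG.inv_equality[of "iv x" x] by simp

lemma iv_iv [simp]: "iv (iv x) = x"
  using MG.inv_inv[of x] by simp

lemma iv_mul_rev: "iv (x \<star> y) = iv y \<star> iv x"
  using MG.inv_mult_group[of x y] by simp

lemma continuous_on_rho [continuous_intros]:
  assumes "continuous_on S f" "continuous_on S g"
  shows "continuous_on S (\<lambda>x. \<rho> (f x) (g x))"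
  using continuous_on_compose2[OF rho_cont continuous_on_Pair[OF assms]] by simp

lemma continuous_on_mul [continuous_intros]:
  assumes "continuous_on S f" "continuous_on S g"
  shows "continuous_on S (\<lambda>x. f x \<star> g x)"
  unfolding mul_def by (intro continuous_intros assms)

lemma continuous_on_iv [continuous_intros]:
  assumes "continuous_on S f" shows "continuous_on S (\<lambda>x. iv (f x))"
  unfolding iv_def by (intro continuous_intros assms)

text \<open>Continuity on a compact product of balls. The shape
  \<open>x \<star> y \<star> iv z\<close> covers the correcting letters in
  \<open>word_approximation\<close> as well as the conjugates in
  \<open>ex_nonzero_ker\<close>.\<close>

lemma bounded_mul_mul_iv:
  "\<exists>r'. \<forall>x y z. norm x \<le> r \<longrightarrow> norm y \<le> r \<longrightarrow> norm z \<le> r \<longrightarrow> norm (x \<star> y \<star> iv z) \<le> r'"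
proof -
  let ?f = "\<lambda>w. fst w \<star> fst (snd w) \<star> iv (snd (snd w))"
  let ?B = "cball 0 r :: 'e set"
  have "compact (?f ` (?B \<times> ?B \<times> ?B))"
    by (intro compact_continuous_image continuous_intros compact_Times compact_cball)
  then have "bounded (?f ` (?B \<times> ?B \<times> ?B))" by (rule compact_imp_bounded)
  then obtain r' where "\<forall>y\<in>?f ` (?B \<times> ?B \<times> ?B). norm y \<le> r'"
    unfolding bounded_iff by (elim exE)
  then have r: "norm (?f w) \<le> r'" if "w \<in> ?B \<times> ?B \<times> ?B" for w
    using that by (rule bspec[OF _ imageI])
  have "norm (x \<star> y \<star> iv z) \<le> r'" if "norm x \<le> r" "norm y \<le> r" "norm z \<le> r" for x y z
    using r[of "(x, y, z)"] that by simp
  then show ?thesis by blast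
qed

definition pr :: "'e list \<Rightarrow> 'e" where "pr ks = foldr (\<star>) ks 0"

lemma pr_simps [simp]: "pr [] = 0" "pr (k # ks) = k \<star> pr ks"
  by (simp_all add: pr_def)

lemma pr_append [simp]: "pr (ks @ ls) = pr ks \<star> pr ls"
  by (induction ks) (simp_all add: mul_assoc)

lemma pr_replicate_ker: "q v = 0 \<Longrightarrow> pr (replicate n v) = real n *\<^sub>R v"
  by (induction n) (simp_all add: algebra_simps)

lemma pr_replicate_q: "pr (replicate n (q v)) = real n *\<^sub>R q v"
proof (induction n)
  case (Suc n)
  have "\<rho> (q v) (real n *\<^sub>R q v) = real n *\<^sub>R q v" by (simp del: rho_simps add: linear_scale[OF rho_linear])
  then show ?case using Suc by (simp add: mul_def algebra_simps)
qed simp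

text \<open>In \<open>x = (x - q x) \<star> q x\<close> both factors lie on lines along which
  \<open>\<star>\<close> is addition, so each is cut into \<open>N\<close> equal short
  steps.\<close>

lemma ex_pr_unit: "\<exists>ks. (\<forall>k\<in>set ks. norm k \<le> 1) \<and> pr ks = x"
proof -
  define v where "v = x - q x"
  obtain N :: nat where N: "norm v + norm (q x) < real N" using reals_Archimedean2 by blast
  have N0: "real N > 0" using N norm_ge_zero[of v] norm_ge_zero[of "q x"] by linarith
  define ks where "ks = replicate N (v /\<^sub>R real N) @ replicate N (q (x /\<^sub>R real N))"
  have "norm v \<le> real N" "norm (q x) \<le> real N" using N norm_ge_zero[of v] norm_ge_zero[of "q x"] by linarith+
  then have "norm (v /\<^sub>R real N) \<le> 1" "norm (q (x /\<^sub>R real N)) \<le> 1"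
    using N0 by (simp_all add: field_simps)
  then have "\<forall>k\<in>set ks. norm k \<le> 1" by (auto simp: ks_def)
  moreover have "pr ks = x"
    unfolding ks_def pr_append pr_replicate_q using N0
    by (subst pr_replicate_ker) (simp_all add: v_def)
  ultimately show ?thesis by blast
qed

text \<open>The letters range over a ball of the ambient group and not over the lattice, since the
  contracting elements need not belong to the lattice. Concatenation of words then makes the
  property additive in \<open>v\<close>.\<close>

definition distorted :: "'e \<Rightarrow> bool" where
  "distorted v \<longleftrightarrow> q v = 0 \<and>
     (\<exists>k C. \<forall>m\<ge>1. \<exists>ks. (\<forall>x\<in>set ks. norm x \<le> k) \<and> real (length ks) \<le> C * (1 + ln m) \<and> pr ks = m *\<^sub>R v)"

lemma distorted_add:
  assumes "distorted v" "distorted w" shows "distorted (v + w)"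
proof -
  obtain k C k' C' where
    v: "q v = 0" "\<And>m. m \<ge> 1 \<Longrightarrow> \<exists>ks. (\<forall>x\<in>set ks. norm x \<le> k) \<and> real (length ks) \<le> C * (1 + ln m) \<and> pr ks = m *\<^sub>R v" and
    w: "q w = 0" "\<And>m. m \<ge> 1 \<Longrightarrow> \<exists>ks. (\<forall>x\<in>set ks. norm x \<le> k') \<and> real (length ks) \<le> C' * (1 + ln m) \<and> pr ks = m *\<^sub>R w"
    using assms unfolding distorted_def by metis
  have "\<exists>ks. (\<forall>x\<in>set ks. norm x \<le> max k k') \<and> real (length ks) \<le> (C + C') * (1 + ln m) \<and> pr ks = m *\<^sub>R (v + w)"
    if m: "m \<ge> 1" for m :: real
  proof -
    obtain ks where ks: "\<forall>x\<in>set ks. norm x \<le> k" "real (length ks) \<le> C * (1 + ln m)" "pr ks = m *\<^sub>R v"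
      using v(2)[OF m] by blast
    obtain ls where ls: "\<forall>x\<in>set ls. norm x \<le> k'" "real (length ls) \<le> C' * (1 + ln m)" "pr ls = m *\<^sub>R w"
      using w(2)[OF m] by blast
    show ?thesis
      by (rule exI[of _ "ks @ ls"]) (use ks ls v(1) in \<open>auto simp: algebra_simps\<close>)
  qed
  then show ?thesis using v(1) w(1) unfolding distorted_def by auto
qed

text \<open>
  If the powers of \<open>a = q x\<close> contract \<open>v\<close>, then \<open>m v\<close> is the conjugate by \<open>a\<^sup>-\<^sup>j\<close> of a bounded vector
  for some \<open>j\<close> of order \<open>ln m\<close>.
\<close>

lemma distorted_contract:
  assumes v: "q v = 0" and d: "0 < d" "d < 1" and c: "\<And>j::nat. norm (\<rho> (real j *\<^sub>R x) v) \<le> C * d ^ j"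
  shows "distorted v"
proof -
  have C: "C \<ge> 0" using c[of 0] by (metis mult.right_neutral norm_ge_zero order_trans power_0)
  define a where "a = q x"
  define k where "k = max C (norm a)"
  \<comment> \<open>The word below has \<open>2 * j + 1\<close> letters with
    \<open>j \<le> ln m / - ln d + 1\<close>; this gives the slope \<open>2 / (- ln d)\<close> and
    the offset 3.\<close>
  define B where "B = 2 / (- ln d) + 3"
  have ld: "- ln d > 0" using d by simp
  have "\<exists>ks. (\<forall>x\<in>set ks. norm x \<le> k) \<and> real (length ks) \<le> B * (1 + ln m) \<and> pr ks = m *\<^sub>R v"
    if m: "m \<ge> 1" for m :: real
  proof -
    \<comment> \<open>The least number of contractions for which \<open>m * d ^ j \<le> 1\<close>,
      so that the contracted multiple of \<open>v\<close> has norm at most \<open>C\<close>.\<close>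
    define j where "j = nat \<lceil>ln m / - ln d\<rceil>"
    have lm: "ln m \<ge> 0" using m by simp
    have j: "ln m / - ln d \<le> real j" "real j \<le> ln m / - ln d + 1"
      unfolding j_def using ld lm divide_nonneg_pos[OF lm ld] by linarith+
    have "ln m \<le> real j * - ln d" using j(1) pos_divide_le_eq[OF ld, of "ln m" "real j"] by blast
    then have "ln (m * d ^ j) \<le> 0" using m d by (simp add: ln_mult ln_realpow)
    then have "m * d ^ j \<le> 1" using m d by simp
    then have "C * (m * d ^ j) \<le> C" using C by (rule mult_left_le)
    moreover have "m * norm (\<rho> (real j *\<^sub>R x) v) \<le> m * (C * d ^ j)" using c m by (intro mult_left_mono) auto
    moreover have "norm (m *\<^sub>R \<rho> (real j *\<^sub>R x) v) = m * norm (\<rho> (real j *\<^sub>R x) v)"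
      using m by simp
    moreover have "m * (C * d ^ j) = C * (m * d ^ j)" by simp
    ultimately have w: "norm (m *\<^sub>R \<rho> (real j *\<^sub>R x) v) \<le> C" by linarith
    define ks where "ks = replicate j (q (- x)) @ [m *\<^sub>R \<rho> (real j *\<^sub>R x) v] @ replicate j (q x)"
    define t where "t = real j *\<^sub>R x"
    have e: "pr (replicate j (q (- x))) = - q t" "pr (replicate j (q x)) = q t"
      unfolding pr_replicate_q t_def by simp_all
    have r: "\<rho> (- q t) = \<rho> (- t)" by (rule rho_cong) simp
    have "pr ks = - q t \<star> (m *\<^sub>R \<rho> t v \<star> q t)"
      unfolding ks_def pr_append e pr_simps t_def[symmetric] by (simp add: mul_assoc)
    also have "m *\<^sub>R \<rho> t v \<star> q t = m *\<^sub>R \<rho> t v + q t" using v by (intro ker_mul) simp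
    also have "- q t \<star> \<dots> = - q t + \<rho> (- t) (m *\<^sub>R \<rho> t v + q t)" unfolding mul_def r ..
    also have "\<dots> = m *\<^sub>R v" by simp
    finally have "pr ks = m *\<^sub>R v" .
    moreover have "real (length ks) \<le> B * (1 + ln m)"
    proof -
      have "real (length ks) \<le> 2 * (ln m / - ln d) + 3" using j(2) by (simp add: ks_def)
      also have "\<dots> = 2 / (- ln d) * ln m + 3" by simp
      \<comment> \<open>The nonnegative terms added here complete the product
        \<open>B * (1 + ln m)\<close>.\<close>
      also have "\<dots> \<le> (2 / (- ln d) * ln m + 3) + (2 / (- ln d) + 3 * ln m)" 
      proof -
        have "0 \<le> 2 / (- ln d)" using ld by (intro divide_nonneg_pos) auto
        then show ?thesis using lm by linarith
      qed
      also have "\<dots> = B * (1 + ln m)" unfolding B_def by (simp add: algebra_simps add_divide_distrib)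
      finally show ?thesis .
    qed
    moreover have "\<forall>x\<in>set ks. norm x \<le> k" using w by (auto simp: ks_def k_def a_def)
    ultimately show ?thesis by blast
  qed
  then show ?thesis unfolding distorted_def using v by blast
qed

text \<open>Different directions may be contracted by different elements, as in Sol, where no single
  element contracts the whole plane. Hence an induction over the span: scaling changes only the
  constant \<open>C\<close>, and sums concatenate words.\<close>

lemma distorted_ker: assumes "q v = 0" shows "distorted v"
  using contract[OF assms]
proof (induction rule: span_induct_alt)
  case base
  show ?case by (rule distorted_contract[of 0 "1/2" 0 0]) auto
next
  case (step c x y)
  then obtain z C d where z: "q x = 0" "0 < d" "d < 1" "\<And>j::nat. norm (\<rho> (real j *\<^sub>R z) x) \<le> C * d ^ j" by blast
  have "distorted (c *\<^sub>R x)"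
  proof (rule distorted_contract[of _ d z "\<bar>c\<bar> * C"])
    fix j :: nat
    show "norm (\<rho> (real j *\<^sub>R z) (c *\<^sub>R x)) \<le> \<bar>c\<bar> * C * d ^ j"
      using mult_left_mono[OF z(4)[of j], of "\<bar>c\<bar>"] by (simp add: mult.assoc)
  qed (use z in auto)
  then show ?case using step distorted_add by blast
qed

end

section \<open>Lattices in the model group\<close>

text \<open>With \<open>B\<close> a maximal independent subset of \<open>A\<close>, rounding down
  the coordinates of \<open>a / k\<close> gives an element \<open>w\<close> of \<open>A\<close> for
  which \<open>a - k w\<close> is bounded independently of \<open>a\<close>. A bounded part of
  \<open>A\<close> is finite. That \<open>B\<close> generates \<open>A\<close> over the integers is
  neither claimed nor true in general.\<close>

lemma discrete_additive_mod_finite: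
  fixes A :: "'e::euclidean_space set"
  assumes zero: "0 \<in> A" and add: "\<And>x y. x \<in> A \<Longrightarrow> y \<in> A \<Longrightarrow> x + y \<in> A" and neg: "\<And>x. x \<in> A \<Longrightarrow> - x \<in> A"
    and fin: "\<And>r. finite (A \<inter> cball 0 r)" and k: "(k::nat) > 0"
  shows "\<exists>F. finite F \<and> F \<subseteq> A \<and> (\<forall>a\<in>A. \<exists>f\<in>F. \<exists>b\<in>A. a = real k *\<^sub>R b + f)"
proof -
  obtain B where B: "B \<subseteq> A" "independent B" "A \<subseteq> span B"
    using maximal_independent_subset[of A] by blast
  have finB: "finite B" using B(2) independent_imp_finite by blast
  have nat_scale: "real n *\<^sub>R x \<in> A" if "x \<in> A" for x n
    by (induction n) (use that zero add in \<open>auto simp: algebra_simps\<close>)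
  have int_scale: "of_int n *\<^sub>R x \<in> A" if "x \<in> A" for x n
  proof (cases "n \<ge> 0")
    case True
    then show ?thesis using nat_scale[OF that, of "nat n"] by simp
  next
    case False
    then have "of_int n *\<^sub>R x = - (real (nat (- n)) *\<^sub>R x)" by simp
    then show ?thesis using neg[OF nat_scale[OF that]] by metis
  qed
  have sum_in: "sum f B' \<in> A" if "finite B'" "\<And>b. b \<in> B' \<Longrightarrow> f b \<in> A" for f :: "'e \<Rightarrow> 'e" and B'
    using that by (induction B') (auto intro: zero add)
  define F where "F = A \<inter> cball 0 (\<Sum>b\<in>B. real k * norm b)"
  have "\<exists>f\<in>F. \<exists>b\<in>A. a = real k *\<^sub>R b + f" if a: "a \<in> A" for a
  proof -
    obtain u where u: "a = (\<Sum>b\<in>B. u b *\<^sub>R b)"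
      using a B(3) span_finite[OF finB] by auto
    define w where "w = (\<Sum>b\<in>B. of_int \<lfloor>u b / real k\<rfloor> *\<^sub>R b)"
    have w: "w \<in> A" unfolding w_def using B(1) int_scale by (intro sum_in finB) auto
    have e: "a - real k *\<^sub>R w = (\<Sum>b\<in>B. (u b - real k * of_int \<lfloor>u b / real k\<rfloor>) *\<^sub>R b)"
      unfolding u w_def by (simp add: scaleR_sum_right sum_subtractf algebra_simps)
    have "norm (a - real k *\<^sub>R w) \<le> (\<Sum>b\<in>B. real k * norm b)"
      unfolding e
    proof (rule sum_norm_le)
      fix b assume "b \<in> B"
      have "0 \<le> u b / real k - of_int \<lfloor>u b / real k\<rfloor>" "u b / real k - of_int \<lfloor>u b / real k\<rfloor> \<le> 1"
        by linarith+
      then have "0 \<le> real k * (u b / real k - of_int \<lfloor>u b / real k\<rfloor>)"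
        "real k * (u b / real k - of_int \<lfloor>u b / real k\<rfloor>) \<le> real k * 1"
        using k by (auto intro: mult_left_mono simp del: mult_1_right)
      moreover have "real k * (u b / real k - of_int \<lfloor>u b / real k\<rfloor>) = u b - real k * of_int \<lfloor>u b / real k\<rfloor>"
        using k by (simp add: right_diff_distrib)
      ultimately have "\<bar>u b - real k * of_int \<lfloor>u b / real k\<rfloor>\<bar> \<le> real k" by simp
      then show "norm ((u b - real k * of_int \<lfloor>u b / real k\<rfloor>) *\<^sub>R b) \<le> real k * norm b"
        by (simp add: mult_right_mono)
    qed
    moreover have "a - real k *\<^sub>R w \<in> A"
      using add[OF a neg[OF nat_scale[OF w, of k]]] by simp
    ultimately have "a - real k *\<^sub>R w \<in> F" by (simp add: F_def)
    then show ?thesis using w by (intro bexI[of _ "a - real k *\<^sub>R w"] bexI[of _ w]) auto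
  qed
  then show ?thesis using fin by (intro exI[of _ F]) (auto simp: F_def)
qed

locale model_lattice = model_group q \<rho> for q :: "'e::euclidean_space \<Rightarrow> 'e" and \<rho> +
  fixes \<Gamma> :: "'e set" and e R :: real
  assumes subgroup_\<Gamma>: "subgroup \<Gamma> MG"
    and e_pos: "e > 0" and discrete: "\<And>x. x \<in> \<Gamma> \<Longrightarrow> norm x < e \<Longrightarrow> x = 0"
    and cocompact: "\<And>x. \<exists>\<gamma>\<in>\<Gamma>. \<exists>b. norm b < R \<and> x = \<gamma> \<star> b"
begin

lemma zero_\<Gamma> [simp]: "0 \<in> \<Gamma>"
  using subgroup.one_closed[OF subgroup_\<Gamma>] by simp

lemma mul_\<Gamma>: "x \<in> \<Gamma> \<Longrightarrow> y \<in> \<Gamma> \<Longrightarrow> x \<star> y \<in> \<Gamma>"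
  using subgroup.m_closed[OF subgroup_\<Gamma>] by simp

lemma iv_\<Gamma>: "x \<in> \<Gamma> \<Longrightarrow> iv x \<in> \<Gamma>"
  using subgroup.m_inv_closed[OF subgroup_\<Gamma>] by simp

lemma R_pos: "R > 0"
  using cocompact[of 0] norm_ge_zero le_less_trans by blast

text \<open>Infinitely many lattice points in a ball accumulate somewhere. Two distinct ones
  \<open>a\<close>, \<open>b\<close> near the accumulation point would make
  \<open>iv a \<star> b\<close> a nonzero lattice element of norm below \<open>e\<close>, by
  continuity at \<open>(x, x)\<close>.\<close>

lemma finite_\<Gamma>_ball: "finite (\<Gamma> \<inter> cball 0 r)"
proof (rule ccontr)
  assume inf: "infinite (\<Gamma> \<inter> cball 0 r)"
  have "\<exists>x\<in>cball 0 r. x islimpt (\<Gamma> \<inter> cball 0 r)"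
    using compact_cball[of 0 r] inf unfolding compact_eq_Bolzano_Weierstrass by blast
  then obtain x where x: "x islimpt (\<Gamma> \<inter> cball 0 r)" by blast
  have "continuous_on UNIV (\<lambda>z. iv (fst z) \<star> snd z)" by (intro continuous_intros)
  then have "isCont (\<lambda>z. iv (fst z) \<star> snd z) (x, x)" by (simp add: continuous_on_eq_continuous_at)
  then obtain \<delta> where d: "\<delta> > 0" "\<And>z. dist z (x, x) < \<delta> \<Longrightarrow> norm (iv (fst z) \<star> snd z) < e"
    using e_pos unfolding continuous_at_eps_delta by (metis dist_norm diff_zero fst_conv snd_conv iv_mul(1))
  define X where "X = (\<Gamma> \<inter> cball 0 r) \<inter> ball x (\<delta> / 2)"
  have infX: "infinite X" unfolding X_def
    using x d(1) islimpt_eq_infinite_ball by (metis half_gt_zero)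
  obtain a where a: "a \<in> X" using infinite_imp_nonempty[OF infX] by blast
  have "infinite (X - {a})" using infX by simp
  from infinite_imp_nonempty[OF this] obtain b where b: "b \<in> X" "a \<noteq> b" by blast
  have ab: "a \<in> \<Gamma>" "b \<in> \<Gamma>" "a \<in> ball x (\<delta> / 2)" "b \<in> ball x (\<delta> / 2)" "a \<noteq> b"
    using a b by (auto simp: X_def)
  have "dist (a, b) (x, x) \<le> dist a x + dist b x"
    unfolding dist_Pair_Pair by (rule sqrt_sum_squares_le_sum) auto
  also have "\<dots> < \<delta>" using ab by (simp add: dist_commute)
  finally have "norm (iv a \<star> b) < e" using d(2)[of "(a, b)"] by simp
  then have "iv a \<star> b = 0" using discrete[OF mul_\<Gamma>[OF iv_\<Gamma>[OF ab(1)] ab(2)]] by blast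
  then show False using mul_eq_0_iff ab by blast
qed

text \<open>The Svarc-Milnor argument on words. The bounded remainder \<open>b\<close> times the
  next letter \<open>x\<close> is again a lattice element \<open>\<gamma>\<close> times a bounded
  remainder \<open>c\<close>; since \<open>\<gamma> = b \<star> x \<star> iv c\<close>, it lies in a
  ball whose radius does not depend on the word.\<close>

lemma word_approximation:
  "\<exists>F. finite F \<and> F \<subseteq> \<Gamma> \<and> (\<forall>ks. (\<forall>x\<in>set ks. norm x \<le> k) \<longrightarrow>
      (\<exists>ws b. set ws \<subseteq> F \<and> length ws = length ks \<and> norm b < R \<and> pr ks = pr ws \<star> b))"
proof -
  obtain r where r: "\<And>x y z. norm x \<le> max R k \<Longrightarrow> norm y \<le> max R k \<Longrightarrow> norm z \<le> max R k \<Longrightarrow> norm (x \<star> y \<star> iv z) \<le> r"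
    using bounded_mul_mul_iv by blast
  define F where "F = \<Gamma> \<inter> cball 0 r"
  have "\<exists>ws b. set ws \<subseteq> F \<and> length ws = length ks \<and> norm b < R \<and> pr ks = pr ws \<star> b"
    if "\<forall>x\<in>set ks. norm x \<le> k" for ks
    using that
  proof (induction ks rule: rev_induct)
    case Nil
    show ?case using R_pos by (intro exI[of _ "[]"] exI[of _ 0]) simp
  next
    case (snoc x ks)
    then obtain ws b where w: "set ws \<subseteq> F" "length ws = length ks" "norm b < R" "pr ks = pr ws \<star> b" by auto
    obtain \<gamma> c where c: "\<gamma> \<in> \<Gamma>" "norm c < R" "b \<star> x = \<gamma> \<star> c" using cocompact by blast
    have "\<gamma> = b \<star> x \<star> iv c" unfolding c(3) mul_assoc by simp
    then have "\<gamma> \<in> F" using r[of b x c] w c snoc.prems by (auto simp: F_def)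
    then show ?case
      by (intro exI[of _ "ws @ [\<gamma>]"] exI[of _ c]) (use w c in \<open>auto simp: mul_assoc\<close>)
  qed
  then show ?thesis using finite_\<Gamma>_ball by (intro exI[of _ F]) (auto simp: F_def)
qed

abbreviation "LG \<equiv> MG\<lparr>carrier := \<Gamma>\<rparr>"

sublocale LG: group LG
  using MG.subgroup_imp_group[OF subgroup_\<Gamma>] .

lemma LG_simps [simp]: "carrier LG = \<Gamma>" "\<one>\<^bsub>LG\<^esub> = 0" "x \<otimes>\<^bsub>LG\<^esub> y = x \<star> y"
  by (simp_all add: model_monoid_def mul_def)

lemma inv_LG [simp]: "x \<in> \<Gamma> \<Longrightarrow> inv\<^bsub>LG\<^esub> x = iv x"
  using MG.m_inv_consistent[OF subgroup_\<Gamma>] by simp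

lemma pr_in_generate: "set ws \<subseteq> S \<Longrightarrow> pr ws \<in> generate LG S"
proof (induction ws)
  case Nil
  show ?case using generate.one[of LG S] by simp
next
  case (Cons w ws)
  then show ?case using generate.eng[OF generate.incl[of w S LG], of "pr ws"] by simp
qed

lemma pr_\<Gamma>: "set ws \<subseteq> \<Gamma> \<Longrightarrow> pr ws \<in> \<Gamma>"
  by (induction ws) (auto intro: mul_\<Gamma>)

text \<open>For a word with value in \<open>\<Gamma>\<close> the remainder of the approximation is a
  quotient of lattice elements. So it suffices to add the finitely many lattice elements of norm at
  most \<open>R\<close> to the letters.\<close>

lemma ex_finite_generating_set: "\<exists>S. finite_generating_set LG S"
proof -
  obtain F where F: "finite F" "F \<subseteq> \<Gamma>" and
    w: "\<And>ks. (\<forall>x\<in>set ks. norm x \<le> 1) \<Longrightarrow> \<exists>ws b. set ws \<subseteq> F \<and> length ws = length ks \<and> norm b < R \<and> pr ks = pr ws \<star> b"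
    using word_approximation[of 1] by blast
  define S where "S = F \<union> (\<Gamma> \<inter> cball 0 R)"
  have "x \<in> generate LG S" if x: "x \<in> \<Gamma>" for x
  proof -
    obtain ks where ks: "\<forall>k\<in>set ks. norm k \<le> 1" "pr ks = x" using ex_pr_unit by blast
    obtain ws b where ws: "set ws \<subseteq> F" "norm b < R" "x = pr ws \<star> b" using w[OF ks(1)] ks(2) by blast
    have "pr ws \<in> \<Gamma>" using pr_\<Gamma>[of ws] ws F by auto
    from mul_\<Gamma>[OF iv_\<Gamma>[OF this] x] have "b \<in> \<Gamma>" using ws by simp
    then have "set (ws @ [b]) \<subseteq> S" using ws by (auto simp: S_def)
    from pr_in_generate[OF this] show ?thesis using ws by simp
  qed
  moreover have "generate LG S \<subseteq> \<Gamma>"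
    using LG.generate_incl[of S] F by (auto simp: S_def)
  ultimately have "finite_generating_set LG S"
    unfolding finite_generating_set_def using F finite_\<Gamma>_ball by (auto simp: S_def)
  then show ?thesis by blast
qed

text \<open>Carries lengths of ambient words over to the word metric of an arbitrary finite
  generating set: each approximating letter costs at most \<open>c\<close>, and so does the
  remainder, which accounts for the extra 1.\<close>

lemma word_length_pr_le:
  assumes S: "finite_generating_set LG S"
  shows "\<exists>c. \<forall>ks. (\<forall>x\<in>set ks. norm x \<le> k) \<longrightarrow> pr ks \<in> \<Gamma> \<longrightarrow> word_length LG S (pr ks) \<le> c * (length ks + 1)"
proof -
  have S': "S \<subseteq> carrier LG" "generate LG S = \<Gamma>" using S by (auto simp: finite_generating_set_def)
  obtain F where F: "finite F" "F \<subseteq> \<Gamma>" and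
    w: "\<And>ks. (\<forall>x\<in>set ks. norm x \<le> k) \<Longrightarrow> \<exists>ws b. set ws \<subseteq> F \<and> length ws = length ks \<and> norm b < R \<and> pr ks = pr ws \<star> b"
    using word_approximation[of k] by blast
  define c where "c = Max (word_length LG S ` (F \<union> (\<Gamma> \<inter> cball 0 R)))"
  have c: "word_length LG S x \<le> c" if "x \<in> F \<union> (\<Gamma> \<inter> cball 0 R)" for x
    unfolding c_def using F finite_\<Gamma>_ball that by (intro Max_ge) auto
  have pr: "word_length LG S (pr ws) \<le> c * length ws" if "set ws \<subseteq> F" for ws
    using that
  proof (induction ws)
    case Nil
    show ?case using LG.word_length_one by simp
  next
    case (Cons a ws)
    have "word_length LG S (a \<star> pr ws) \<le> word_length LG S a + word_length LG S (pr ws)"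
      using LG.word_length_mult[OF S'(1), of a "pr ws"] S' Cons F pr_\<Gamma>[of ws] by auto
    then show ?case using Cons c[of a] by simp
  qed
  have "word_length LG S (pr ks) \<le> c * (length ks + 1)" if ks: "\<forall>x\<in>set ks. norm x \<le> k" "pr ks \<in> \<Gamma>" for ks
  proof -
    obtain ws b where ws: "set ws \<subseteq> F" "length ws = length ks" "norm b < R" "pr ks = pr ws \<star> b" using w[OF ks(1)] by blast
    have p: "pr ws \<in> \<Gamma>" using pr_\<Gamma> ws F by auto
    from mul_\<Gamma>[OF iv_\<Gamma>[OF p] ks(2)] have b: "b \<in> \<Gamma>" using ws by simp
    have "word_length LG S (pr ks) \<le> word_length LG S (pr ws) + word_length LG S b"
      using LG.word_length_mult[OF S'(1), of "pr ws" b] S' ws p b by simp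
    also have "\<dots> \<le> c * length ws + c" using pr[OF ws(1)] c[of b] b ws(3) by (intro add_mono) auto
    finally show ?thesis using ws by simp
  qed
  then show ?thesis by blast
qed

text \<open>
  Otherwise \<open>\<Gamma>\<close> is abelian, so that by cocompactness every \<open>\<gamma> \<in> \<Gamma>\<close> has a bounded conjugacy class in
  the ambient group; this forces \<open>\<rho> \<gamma>\<close> to be trivial, hence \<open>\<gamma> = 0\<close>.
\<close>

lemma ex_nonzero_ker: "\<exists>x\<in>\<Gamma>. q x = 0 \<and> x \<noteq> 0"
proof (rule ccontr)
  assume "\<not> ?thesis"
  then have triv: "x = 0" if "x \<in> \<Gamma>" "q x = 0" for x using that by blast
  have comm: "\<gamma> \<star> \<gamma>' = \<gamma>' \<star> \<gamma>" if "\<gamma> \<in> \<Gamma>" "\<gamma>' \<in> \<Gamma>" for \<gamma> \<gamma>'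
  proof -
    \<comment> \<open>The map \<open>q\<close> is a homomorphism to an additive group, so it kills
      commutators.\<close>
    have "iv (\<gamma>' \<star> \<gamma>) \<star> (\<gamma> \<star> \<gamma>') = 0"
      using that by (intro triv[OF mul_\<Gamma>[OF iv_\<Gamma>]] mul_\<Gamma>) simp_all
    then show ?thesis using mul_eq_0_iff by metis
  qed
  have "\<gamma> = 0" if g: "\<gamma> \<in> \<Gamma>" for \<gamma>
  proof -
    obtain R' where "\<forall>x y z. norm x \<le> R \<longrightarrow> norm y \<le> R \<longrightarrow> norm z \<le> R \<longrightarrow> norm (x \<star> y \<star> iv z) \<le> R'"
      using bounded_mul_mul_iv[of R] by (elim exE)
    from this[rule_format, of 0 0] have R': "norm (iv b) \<le> R'" if "norm b < R" for b
      using that R_pos by simp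
    obtain r where r: "\<And>x y z. norm x \<le> max R' (max R (norm \<gamma>)) \<Longrightarrow> norm y \<le> max R' (max R (norm \<gamma>)) \<Longrightarrow> norm z \<le> max R' (max R (norm \<gamma>)) \<Longrightarrow> norm (x \<star> y \<star> iv z) \<le> r"
      using bounded_mul_mul_iv by blast
    \<comment> \<open>The lattice part of \<open>x\<close> commutes with \<open>\<gamma>\<close> and
      drops out, which leaves a conjugation by the bounded part \<open>b\<close>.\<close>
    have bd: "norm (iv x \<star> \<gamma> \<star> x) \<le> r" for x
    proof -
      obtain \<gamma>' b where b: "\<gamma>' \<in> \<Gamma>" "norm b < R" "x = \<gamma>' \<star> b" using cocompact by blast
      have "iv x \<star> \<gamma> \<star> x = iv b \<star> (iv \<gamma>' \<star> (\<gamma> \<star> \<gamma>')) \<star> b" by (simp add: b(3) iv_mul_rev mul_assoc)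
      also have "\<dots> = iv b \<star> \<gamma> \<star> b" using comm[OF g b(1)] by simp
      also have "\<dots> = iv b \<star> \<gamma> \<star> iv (iv b)" by simp
      finally have "iv x \<star> \<gamma> \<star> x = iv b \<star> \<gamma> \<star> iv (iv b)" .
      then show ?thesis using r[of "iv b" \<gamma> "iv b"] R'[OF b(2)] by simp
    qed
    \<comment> \<open>Conjugation by \<open>n w\<close> displaces \<open>\<gamma>\<close> by
      \<open>n\<close> times \<open>\<rho> \<gamma> w - w\<close>, which is unbounded unless the
      difference vanishes.\<close>
    have "\<rho> \<gamma> w = w" if w: "q w = 0" for w
    proof (rule ccontr)
      assume "\<rho> \<gamma> w \<noteq> w"
      define d where "d = \<rho> \<gamma> w - w"
      have d: "norm d > 0" using \<open>\<rho> \<gamma> w \<noteq> w\<close> by (simp add: d_def)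
      obtain n :: nat where n: "r + norm \<gamma> < real n * norm d" using reals_Archimedean3[OF d] by blast
      have iv: "iv (real n *\<^sub>R w) = - (real n *\<^sub>R w)" using w by (simp add: iv_def)
      have "iv (real n *\<^sub>R w) \<star> \<gamma> \<star> (real n *\<^sub>R w) = \<gamma> + real n *\<^sub>R d"
        unfolding iv mul_assoc using w by (subst ker_mul) (simp_all add: mul_def d_def algebra_simps)
      then have "norm (\<gamma> + real n *\<^sub>R d) \<le> r" using bd by metis
      moreover have "norm (real n *\<^sub>R d) \<le> norm (\<gamma> + real n *\<^sub>R d) + norm \<gamma>"
        using norm_triangle_ineq4[of "\<gamma> + real n *\<^sub>R d" \<gamma>] by simp
      ultimately show False using n by simp
    qed
    then have "q \<gamma> = 0" using faithful by blast
    then show ?thesis using triv g by blast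
  qed
  \<comment> \<open>If \<open>\<Gamma>\<close> were trivial, cocompactness would confine the whole
    space to a ball.\<close>
  then have "norm x < R" for x :: 'e using cocompact[of x] by (metis mul_0(2))
  moreover obtain b :: 'e where "b \<in> Basis" using nonempty_Basis by blast
  ultimately have "norm (R *\<^sub>R b) < R" by blast
  then show False using \<open>b \<in> Basis\<close> R_pos by simp
qed

text \<open>The subgroups separating elements of \<open>A = \<Gamma> \<inter> ker q\<close> are the
  multiples \<open>k A\<close>. They are normal because conjugation acts on \<open>A\<close> by the
  linear maps \<open>\<rho> x\<close>, and the nonzero elements of \<open>k A\<close> have norm at
  least \<open>k * e\<close>, which exceeds the norm of \<open>x\<close> for large
  \<open>k\<close>.\<close>

lemma residually_finite_LG: "residually_finite LG"
proof -
  obtain S where S: "finite S" "S \<subseteq> carrier LG" "generate LG S = carrier LG"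
    using ex_finite_generating_set unfolding finite_generating_set_def by blast
  define A where "A = {x \<in> \<Gamma>. q x = 0}"
  have add: "x + y \<in> A" "- x \<in> A" if "x \<in> A" "y \<in> A" for x y
    using that mul_\<Gamma>[of x y] iv_\<Gamma>[of x] by (auto simp: A_def iv_def)
  have fin: "finite (A \<inter> cball 0 r)" for r
    using finite_\<Gamma>_ball[of r] by (rule rev_finite_subset) (auto simp: A_def)
  have normal: "(\<lambda>a. real k *\<^sub>R a) ` A \<lhd> LG" for k :: nat
  proof (rule LG.normal_invI)
    have kA: "real k *\<^sub>R a \<in> A" if "a \<in> A" for a
      by (induction k) (use that in \<open>auto simp: algebra_simps intro: add\<close>, simp add: A_def)
    show "subgroup ((\<lambda>a. real k *\<^sub>R a) ` A) LG"
    proof (rule LG.subgroupI)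
      show "(\<lambda>a. real k *\<^sub>R a) ` A \<subseteq> carrier LG" using kA by (auto simp: A_def)
      show "(\<lambda>a. real k *\<^sub>R a) ` A \<noteq> {}" by (auto simp: A_def intro!: exI[of _ 0])
      show "inv\<^bsub>LG\<^esub> a \<in> (\<lambda>a. real k *\<^sub>R a) ` A" if "a \<in> (\<lambda>a. real k *\<^sub>R a) ` A" for a
      proof -
        obtain b where b: "b \<in> A" "a = real k *\<^sub>R b" using \<open>a \<in> _\<close> by blast
        then have "a \<in> \<Gamma>" "q a = 0" using kA[of b] by (auto simp: A_def)
        then have "inv\<^bsub>LG\<^esub> a = real k *\<^sub>R (- b)" using b by (simp add: iv_def)
        then show ?thesis using add(2) b by blast
      qed
      fix a b assume "a \<in> (\<lambda>a. real k *\<^sub>R a) ` A" "b \<in> (\<lambda>a. real k *\<^sub>R a) ` A"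
      then obtain x y where x: "x \<in> A" "y \<in> A" "a = real k *\<^sub>R x" "b = real k *\<^sub>R y" by blast
      then have "a \<otimes>\<^bsub>LG\<^esub> b = real k *\<^sub>R (x + y)" by (simp add: A_def algebra_simps)
      then show "a \<otimes>\<^bsub>LG\<^esub> b \<in> (\<lambda>a. real k *\<^sub>R a) ` A" using add x by blast
    qed
    fix x h assume x: "x \<in> carrier LG" and "h \<in> (\<lambda>a. real k *\<^sub>R a) ` A"
    then obtain a where a: "a \<in> A" "h = real k *\<^sub>R a" by blast
    have "x \<star> a \<star> iv x = \<rho> x a" using a by (intro conj_ker) (simp add: A_def)
    then have "\<rho> x a \<in> A" using x a mul_\<Gamma> iv_\<Gamma> by (auto simp: A_def) metis
    moreover have "x \<otimes>\<^bsub>LG\<^esub> h \<otimes>\<^bsub>LG\<^esub> inv\<^bsub>LG\<^esub> x = real k *\<^sub>R \<rho> x a"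
      using x a conj_ker[of h x] by (simp add: A_def)
    ultimately show "x \<otimes>\<^bsub>LG\<^esub> h \<otimes>\<^bsub>LG\<^esub> inv\<^bsub>LG\<^esub> x \<in> (\<lambda>a. real k *\<^sub>R a) ` A" by blast
  qed
  show ?thesis
  proof (rule LG.residually_finite_abelian_by_abelianI[OF S])
    show "A \<lhd> LG" using normal[of 1] by simp
    show "g \<otimes>\<^bsub>LG\<^esub> h \<otimes>\<^bsub>LG\<^esub> inv\<^bsub>LG\<^esub> g \<otimes>\<^bsub>LG\<^esub> inv\<^bsub>LG\<^esub> h \<in> A" if "g \<in> carrier LG" "h \<in> carrier LG" for g h
      using that by (auto simp: A_def intro!: mul_\<Gamma> iv_\<Gamma>)
    fix x assume x: "x \<in> A" "x \<noteq> \<one>\<^bsub>LG\<^esub>"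
    obtain k :: nat where k: "norm x < real k * e" using reals_Archimedean3[OF e_pos] by blast
    have k0: "k > 0" using k by (cases "k = 0") auto
    define K where "K = (\<lambda>a. real k *\<^sub>R a) ` A"
    obtain F where F: "finite F" "F \<subseteq> A" "\<And>a. a \<in> A \<Longrightarrow> \<exists>f\<in>F. \<exists>b\<in>A. a = real k *\<^sub>R b + f"
      using discrete_additive_mod_finite[of A k] add fin k0 by (auto simp: A_def)
    have "x \<notin> K"
    proof
      assume "x \<in> K"
      then obtain a where a: "a \<in> A" "x = real k *\<^sub>R a" by (auto simp: K_def)
      then have "real k * norm a < real k * e" using k by simp
      then have "norm a < e" using k0 by simp
      then have "a = 0" using discrete a by (auto simp: A_def)
      then show False using x a by simp
    qed
    moreover have "finite ((\<lambda>a. K #>\<^bsub>LG\<^esub> a) ` A)"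
    proof (rule finite_subset)
      have sub: "subgroup K LG" using normal normal_imp_subgroup unfolding K_def by blast
      show "(\<lambda>a. K #>\<^bsub>LG\<^esub> a) ` A \<subseteq> (\<lambda>a. K #>\<^bsub>LG\<^esub> a) ` F"
      proof
        fix c assume "c \<in> (\<lambda>a. K #>\<^bsub>LG\<^esub> a) ` A"
        then obtain a where a: "a \<in> A" "c = K #>\<^bsub>LG\<^esub> a" by blast
        then obtain f b where f: "f \<in> F" "b \<in> A" "a = real k *\<^sub>R b + f" using F(3) by blast
        then have "a \<in> K #>\<^bsub>LG\<^esub> f"
          by (auto simp: r_coset_def K_def A_def intro!: bexI[of _ b])
        then have "K #>\<^bsub>LG\<^esub> f = K #>\<^bsub>LG\<^esub> a"
          using LG.repr_independence[of a K f] sub f F(2) by (auto simp: A_def)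
        then show "c \<in> (\<lambda>a. K #>\<^bsub>LG\<^esub> a) ` F" using f a by blast
      qed
    qed (use F in simp)
    ultimately show "\<exists>K. K \<lhd> LG \<and> finite ((\<lambda>a. K #>\<^bsub>LG\<^esub> a) ` A) \<and> x \<notin> K"
      using normal K_def by blast
  qed
qed

lemma linear_le_RF:
  assumes S: "finite_generating_set LG S" shows "(\<lambda>n. n) \<preceq> RF LG S"
proof -
  obtain x where x: "x \<in> \<Gamma>" "q x = 0" "x \<noteq> 0" using ex_nonzero_ker by blast
  obtain k C where kC: "\<And>m. m \<ge> 1 \<Longrightarrow> \<exists>ks. (\<forall>x\<in>set ks. norm x \<le> k) \<and> real (length ks) \<le> C * (1 + ln m) \<and> pr ks = m *\<^sub>R x"
    using distorted_ker[OF x(2)] unfolding distorted_def by blast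
  obtain c where c: "\<And>ks. (\<forall>x\<in>set ks. norm x \<le> k) \<Longrightarrow> pr ks \<in> \<Gamma> \<Longrightarrow> word_length LG S (pr ks) \<le> c * (length ks + 1)"
    using word_length_pr_le[OF S] by blast
  have pow: "x [^]\<^bsub>LG\<^esub> m = real m *\<^sub>R x" for m :: nat
  proof (induction m)
    case (Suc m)
    then show ?case using x by (simp add: algebra_simps)
  qed simp
  show ?thesis
  proof (rule LG.linear_le_RF_if_exponentially_distorted[OF residually_finite_LG S])
    show "x \<in> carrier LG" using x by simp
    show "x [^]\<^bsub>LG\<^esub> m \<noteq> \<one>\<^bsub>LG\<^esub>" if "m \<ge> 1" for m :: nat using that x unfolding pow by simp
    fix m :: nat assume m: "m \<ge> 1"
    obtain ks where ks: "\<forall>x\<in>set ks. norm x \<le> k" "real (length ks) \<le> C * (1 + ln (real m))" "pr ks = real m *\<^sub>R x"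
      using kC[of "real m"] m by auto
    have "x [^]\<^bsub>LG\<^esub> m \<in> carrier LG" using x by (intro LG.nat_pow_closed) simp
    then have "word_length LG S (x [^]\<^bsub>LG\<^esub> m) \<le> c * (length ks + 1)" using c[OF ks(1)] ks(3) pow by simp
    then have "real (word_length LG S (x [^]\<^bsub>LG\<^esub> m)) \<le> real (c * (length ks + 1))"
      by (simp only: of_nat_le_iff)
    also have "\<dots> = real c * (real (length ks) + 1)" by (simp add: algebra_simps)
    also have "\<dots> \<le> real c * (C * (1 + ln (real m)) + (1 + ln (real m)))"
      using ks(2) m by (intro mult_left_mono add_mono) auto
    finally show "real (word_length LG S (x [^]\<^bsub>LG\<^esub> m)) \<le> real c * (C + 1) * (1 + ln (real m))"
      by (simp add: algebra_simps)
  qed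
qed

theorem RF_bounded_below: "RF_bounded_below_by LG (\<lambda>n. n)"
  unfolding RF_bounded_below_by_def
  using ex_finite_generating_set residually_finite_LG linear_le_RF by blast

end

context model_group begin

text \<open>Turns the topological notion of lattice into the two radii of
  \<open>model_lattice\<close>. Discreteness at the unit gives \<open>e\<close>; the images of the
  balls of integer radius form an increasing open cover of the coset space, so compactness leaves
  one ball that meets every coset.\<close>

theorem RF_bounded_below_cocompact_lattice:
  assumes G: "group G" and \<sigma>: "\<sigma> \<in> iso MG G" and homeo: "\<And>V. openin T (\<sigma> ` V) \<longleftrightarrow> open V"
    and lat: "cocompact_lattice G T \<Gamma>"
  shows "RF_bounded_below_by (G\<lparr>carrier := \<Gamma>\<rparr>) (\<lambda>n. n)"
proof -
  interpret G: group G by (rule G)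
  have sub: "subgroup \<Gamma> G" and disc: "subtopology T \<Gamma> = discrete_topology \<Gamma>"
    and comp: "compact_space (coset_topology G T \<Gamma>)"
    using lat by (auto simp: cocompact_lattice_def)
  interpret \<sigma>: group_hom MG G \<sigma>
    unfolding group_hom_def group_hom_axioms_def using \<sigma> G group_MG by (simp add: iso_def)
  have bij: "bij_betw \<sigma> UNIV (carrier G)" using \<sigma> by (simp add: iso_def)
  then have inj: "inj \<sigma>" and im: "range \<sigma> = carrier G" by (auto simp: bij_betw_def)
  have hom: "\<sigma> (x \<star> y) = \<sigma> x \<otimes>\<^bsub>G\<^esub> \<sigma> y" for x y using \<sigma>.hom_mult[of x y] by simp
  have one: "\<sigma> 0 = \<one>\<^bsub>G\<^esub>" using \<sigma>.hom_one by simp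
  have cl: "\<sigma> x \<in> carrier G" for x using im by blast
  define \<Gamma>' where "\<Gamma>' = \<sigma> -` \<Gamma>"
  have \<Gamma>: "\<Gamma> = \<sigma> ` \<Gamma>'" using subgroup.subset[OF sub] im by (auto simp: \<Gamma>'_def)
  have sub': "subgroup \<Gamma>' MG"
  proof (rule MG.subgroupI)
    show "\<Gamma>' \<noteq> {}" using subgroup.one_closed[OF sub] one by (auto simp: \<Gamma>'_def intro!: exI[of _ 0])
    show "inv\<^bsub>MG\<^esub> a \<in> \<Gamma>'" if "a \<in> \<Gamma>'" for a
      using \<sigma>.hom_inv[of a] subgroup.m_inv_closed[OF sub, of "\<sigma> a"] that by (simp add: \<Gamma>'_def)
    show "a \<otimes>\<^bsub>MG\<^esub> b \<in> \<Gamma>'" if "a \<in> \<Gamma>'" "b \<in> \<Gamma>'" for a b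
      using subgroup.m_closed[OF sub, of "\<sigma> a" "\<sigma> b"] that by (simp add: \<Gamma>'_def hom)
  qed simp
  have "openin (subtopology T \<Gamma>) {\<one>\<^bsub>G\<^esub>}"
    unfolding disc using subgroup.one_closed[OF sub] by simp
  then obtain U where U: "openin T U" "{\<one>\<^bsub>G\<^esub>} = U \<inter> \<Gamma>" by (auto simp: openin_subtopology)
  have "\<sigma> ` (\<sigma> -` U) = U \<inter> \<sigma> ` UNIV" by blast
  then have "open (\<sigma> -` U)" using homeo[of "\<sigma> -` U"] homeo[of UNIV] U(1) by auto
  moreover have "0 \<in> \<sigma> -` U" using U(2) one by auto
  ultimately obtain e where e: "e > 0" "ball 0 e \<subseteq> \<sigma> -` U" by (meson openE)
  have disc': "x = 0" if "x \<in> \<Gamma>'" "norm x < e" for x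
  proof -
    have "\<sigma> x \<in> U \<inter> \<Gamma>" using that e by (auto simp: \<Gamma>'_def)
    then have "\<sigma> x = \<sigma> 0" using U(2) one by auto
    then show ?thesis using inj by (simp add: inj_eq)
  qed
  define W where "W j = (\<lambda>x. \<Gamma> #>\<^bsub>G\<^esub> \<sigma> x) ` ball 0 (real j)" for j :: nat
  have W_mono: "W i \<subseteq> W j" if "i \<le> j" for i j using that by (auto simp: W_def)
  have openW: "openin (coset_topology G T \<Gamma>) (W j)" for j
    unfolding openin_coset_topology[OF G sub]
  proof
    show "W j \<subseteq> rcosets\<^bsub>G\<^esub> \<Gamma>" using cl by (fastforce simp: W_def RCOSETS_def)
    have "\<Union> (W j) = \<sigma> ` (\<Union>\<gamma>\<in>\<Gamma>'. (\<star>) \<gamma> ` ball 0 (real j))"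
      unfolding W_def r_coset_def \<Gamma> by (simp add: image_UN image_image hom) blast
    moreover have "open ((\<star>) \<gamma> ` ball 0 (real j))" for \<gamma>
    proof -
      have "(\<star>) \<gamma> ` ball 0 (real j) = (\<star>) (iv \<gamma>) -` ball 0 (real j)"
        by (auto simp: image_iff) (metis iv_mul_cancel(2) mem_ball_0)
      then show ?thesis by (simp only:) (intro open_vimage continuous_intros open_ball)
    qed
    ultimately show "openin T (\<Union> (W j))" using homeo by auto
  qed
  have top: "topspace (coset_topology G T \<Gamma>) \<subseteq> rcosets\<^bsub>G\<^esub> \<Gamma>"
    using openin_topspace[of "coset_topology G T \<Gamma>"] unfolding openin_coset_topology[OF G sub] by blast
  have cov: "rcosets\<^bsub>G\<^esub> \<Gamma> \<subseteq> (\<Union>j. W j)"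
  proof
    fix c assume "c \<in> rcosets\<^bsub>G\<^esub> \<Gamma>"
    then obtain y where y: "y \<in> carrier G" "c = \<Gamma> #>\<^bsub>G\<^esub> y" by (auto simp: RCOSETS_def)
    then obtain x where x: "c = \<Gamma> #>\<^bsub>G\<^esub> \<sigma> x" using im by (metis imageE)
    obtain j :: nat where "norm x < real j" using reals_Archimedean2 by blast
    then have "c \<in> W j" using x by (auto simp: W_def)
    then show "c \<in> (\<Union>j. W j)" by blast
  qed
  have "(\<forall>U\<in>range W. openin (coset_topology G T \<Gamma>) U) \<and> topspace (coset_topology G T \<Gamma>) \<subseteq> \<Union>(range W)"
    using openW top cov by auto
  then have "\<exists>\<F>. finite \<F> \<and> \<F> \<subseteq> range W \<and> topspace (coset_topology G T \<Gamma>) \<subseteq> \<Union>\<F>"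
    using comp unfolding compact_space_alt by (elim allE[of _ "range W"] impE)
  then obtain J where J: "finite J" "topspace (coset_topology G T \<Gamma>) \<subseteq> \<Union>(W ` J)"
    by (metis finite_subset_image)
  define N where "N = Max (insert 0 J)"
  have N: "j \<le> N" if "j \<in> J" for j using that J(1) by (simp add: N_def)
  have all: "W j \<subseteq> W N" for j
    
  proof -
    have "W j \<subseteq> \<Union>(W ` J)" using openin_subset[OF openW, of j] J(2) by (rule subset_trans)
    also have "\<dots> \<subseteq> W N" using W_mono N by blast
    finally show ?thesis .
  qed
  have coc: "\<exists>\<gamma>\<in>\<Gamma>'. \<exists>b. norm b < real N \<and> x = \<gamma> \<star> b" for x
  proof -
    have "\<Gamma> #>\<^bsub>G\<^esub> \<sigma> x \<in> W N" using cov all cl[of x] unfolding RCOSETS_def by blast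
    then obtain b where b: "norm b < real N" "\<Gamma> #>\<^bsub>G\<^esub> \<sigma> x = \<Gamma> #>\<^bsub>G\<^esub> \<sigma> b" by (auto simp: W_def)
    have "\<sigma> x \<in> \<Gamma> #>\<^bsub>G\<^esub> \<sigma> b" using G.rcos_self[OF cl sub, of x] b(2) by simp
    then obtain \<gamma> where "\<gamma> \<in> \<Gamma>'" "\<sigma> x = \<sigma> (\<gamma> \<star> b)" by (auto simp: r_coset_def \<Gamma> hom)
    then show ?thesis using b(1) inj by (metis injD)
  qed
  interpret L: model_lattice q \<rho> \<Gamma>' e "real N"
  proof (rule model_lattice.intro[OF model_group_axioms], rule model_lattice_axioms.intro)
    show "subgroup \<Gamma>' MG" by (rule sub')
    show "e > 0" by (rule e(1))
    show "x = 0" if "x \<in> \<Gamma>'" "norm x < e" for x using that by (rule disc')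
    show "\<exists>\<gamma>\<in>\<Gamma>'. \<exists>b. norm b < real N \<and> x = \<gamma> \<star> b" for x by (rule coc)
  qed
  have "\<sigma> \<in> iso (MG\<lparr>carrier := \<Gamma>'\<rparr>) (G\<lparr>carrier := \<Gamma>\<rparr>)"
    unfolding iso_def hom_def bij_betw_def using \<Gamma> inj by (auto simp: hom intro: inj_on_subset)
  then show ?thesis
    using RF_bounded_below_by_iso[OF L.LG.group_axioms G.subgroup_imp_group[OF sub] _ L.RF_bounded_below] by blast
qed

end


section \<open>Semidirect products with the real line\<close>

text \<open>The spanning eigenvectors carry all the axioms: additivity in \<open>s\<close> and
  continuity are checked on them, a nonzero weight \<open>l\<close> makes \<open>s = 0\<close> the
  only trivially acting parameter, and it makes a suitable \<open>s\<close> contract.\<close>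

lemma model_group_semidirect_line:
  fixes A :: "real \<Rightarrow> real^'d^'d"
  assumes sp: "span {v. \<exists>l. l \<noteq> 0 \<and> (\<forall>s. A s *v v = exp (l * s) *\<^sub>R v)} = UNIV" (is "span ?E = _")
  shows "model_group (\<lambda>(x, s). (0, s)) (\<lambda>(x, s) (y, t). (A s *v y, t))"
proof -
  have ext: "f v = g v" if "linear f" "linear g" "\<And>v. v \<in> ?E \<Longrightarrow> f v = g v" for f g :: "real^'d \<Rightarrow> real^'d" and v
    by (rule linear_eq_on_span[OF that(1,2), of ?E]) (use that(3) sp in auto)
  have A0: "A 0 *v v = v" for v
    by (rule ext) (auto simp: linear_ident)
  have Aadd: "A (s + t) *v v = A s *v (A t *v v)" for s t v
    by (rule ext[where v = v])
      (auto simp: ring_distribs exp_add matrix_vector_mult_scaleR mult.commute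
        intro!: linear_compose[unfolded o_def, of "(*v) (A t)" "(*v) (A s)"])
  have cont1: "continuous_on UNIV (\<lambda>s. A s *v v)" for v
  proof -
    have "v \<in> span ?E" using sp by simp
    then show ?thesis
    proof (induction rule: span_induct_alt)
      case (step c x y)
      then obtain l where l: "\<And>s. A s *v x = exp (l * s) *\<^sub>R x" by blast
      have e: "(\<lambda>s. A s *v (c *\<^sub>R x + y)) = (\<lambda>s. c *\<^sub>R (exp (l * s) *\<^sub>R x) + A s *v y)"
        by (simp add: matrix_vector_right_distrib matrix_vector_mult_scaleR l)
      show ?case unfolding e by (intro continuous_intros step.IH)
    qed simp
  qed
  have contract: "v \<in> span {v. \<exists>s C d. 0 < d \<and> d < 1 \<and> (\<forall>j::nat. norm (A (real j * s) *v v) \<le> C * d ^ j)}" for v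
  proof -
    have "?E \<subseteq> {v. \<exists>s C d. 0 < d \<and> d < 1 \<and> (\<forall>j::nat. norm (A (real j * s) *v v) \<le> C * d ^ j)}"
    proof
      fix v assume "v \<in> ?E"
      then obtain l where l: "l \<noteq> 0" "\<And>s. A s *v v = exp (l * s) *\<^sub>R v" by blast
      \<comment> \<open>At \<open>s = - (1 / l)\<close> the eigenvalue is \<open>exp (-1)\<close>,
        whatever the sign of \<open>l\<close>.\<close>
      have n: "norm (A (real j * - (1 / l)) *v v) \<le> norm v * exp (-1) ^ j" for j :: nat
        using l(1) by (simp add: l(2) mult.commute flip: exp_of_nat_mult)
      show "v \<in> {v. \<exists>s C d. 0 < d \<and> d < 1 \<and> (\<forall>j::nat. norm (A (real j * s) *v v) \<le> C * d ^ j)}"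
        unfolding mem_Collect_eq
        by (rule exI[of _ "- (1 / l)"], rule exI[of _ "norm v"], rule exI[of _ "exp (-1)"])
          (use n in auto)
    qed
    then show ?thesis using span_mono sp by blast
  qed
  define q where "q = (\<lambda>(x :: real^'d, s :: real). (0 :: real^'d, s))"
  define \<rho> where "\<rho> = (\<lambda>(x :: real^'d, s) (y, t :: real). (A s *v y, t))"
  have q: "q (x, s) = (0, s)" for x s by (simp add: q_def)
  have \<rho>: "\<rho> (x, s) (y, t) = (A s *v y, t)" for x s y t by (simp add: \<rho>_def)
  have "model_group q \<rho>"
  proof (rule model_group.intro)
    show "linear q" by (rule linearI) (auto simp: q_def)
    show "linear (\<rho> x)" for x
      by (rule linearI) (auto simp: \<rho>_def matrix_vector_right_distrib matrix_vector_mult_scaleR split: prod.splits)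
    show "continuous_on UNIV (\<lambda>z. \<rho> (fst z) (snd z))"
    proof -
      have ex: "A s *v y = (\<Sum>i\<in>UNIV. y $ i *\<^sub>R (A s *v axis i 1))" for s y
      proof -
        have "A s *v y = A s *v (\<Sum>i\<in>UNIV. y $ i *\<^sub>R axis i 1)"
          using basis_expansion[of y] by (simp add: scalar_mult_eq_scaleR)
        also have "\<dots> = (\<Sum>i\<in>UNIV. y $ i *\<^sub>R (A s *v axis i 1))"
          by (simp add: linear_sum[OF matrix_vector_mul_linear] matrix_vector_mult_scaleR)
        finally show ?thesis .
      qed
      have e: "(\<lambda>z. \<rho> (fst z) (snd z)) =
          (\<lambda>z. (\<Sum>i\<in>UNIV. fst (snd z) $ i *\<^sub>R (A (snd (fst z)) *v axis i 1), snd (snd z)))"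
      proof
        fix z :: "((real^'d) \<times> real) \<times> ((real^'d) \<times> real)"
        show "\<rho> (fst z) (snd z) = (\<Sum>i\<in>UNIV. fst (snd z) $ i *\<^sub>R (A (snd (fst z)) *v axis i 1), snd (snd z))"
          unfolding \<rho>_def case_prod_unfold ex[of "snd (fst z)" "fst (snd z)", symmetric] ..
      qed
      have c: "continuous_on UNIV (\<lambda>z :: ((real^'d) \<times> real) \<times> ((real^'d) \<times> real). A (snd (fst z)) *v v)" for v
        by (rule continuous_on_compose2[OF cont1[of v]]) (auto intro!: continuous_intros)
      show ?thesis unfolding e by (intro continuous_intros c)
    qed
    show "q x = 0" if "\<And>v. q v = 0 \<Longrightarrow> \<rho> x v = v" for x
    proof -
      obtain y s where x: "x = (y, s)" by (cases x)
      have A: "A s *v v = v" for v using that[of "(v, 0)"] unfolding x by (simp add: zero_prod_def q \<rho>)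
      \<comment> \<open>The space has positive dimension, so the spanning set contains a nonzero
        eigenvector on which the weight can be read off.\<close>
      have "\<not> ?E \<subseteq> {0}"
      proof
        assume "?E \<subseteq> {0}"
        then have "(UNIV :: (real^'d) set) \<subseteq> {0}" using span_mono[of ?E "{0}"] sp by simp
        moreover have "axis undefined 1 \<noteq> (0 :: real^'d)" by (simp add: axis_eq_0_iff)
        ultimately show False by blast
      qed
      then obtain v l where v: "v \<noteq> 0" "l \<noteq> 0" "A s *v v = exp (l * s) *\<^sub>R v" by blast
      then have "exp (l * s) *\<^sub>R v = 1 *\<^sub>R v" using A[of v] by simp
      then have "exp (l * s) = 1" using v(1) by (simp only: scaleR_cancel_right simp_thms)
      then have "s = 0" using v(2) by simp
      then show ?thesis by (simp add: x zero_prod_def q)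
    qed
    show "v \<in> span {v. q v = 0 \<and>
        (\<exists>x C d. 0 < d \<and> d < 1 \<and> (\<forall>j::nat. norm (\<rho> (real j *\<^sub>R x) v) \<le> C * d ^ j))}" (is "v \<in> span ?T")
      if qv: "q v = 0" for v
    proof -
      obtain y where v: "v = (y, 0)" using qv by (cases v) (simp add: zero_prod_def q)
      let ?S = "{v. \<exists>s C d. 0 < d \<and> d < 1 \<and> (\<forall>j::nat. norm (A (real j * s) *v v) \<le> C * d ^ j)}"
      have lin: "linear (\<lambda>y :: real^'d. (y, 0 :: real))" by (rule linearI) auto
      have "(\<lambda>y. (y, 0)) ` ?S \<subseteq> ?T"
      proof (rule image_subsetI)
        fix y assume "y \<in> ?S"
        then obtain s C d where d: "0 < d" "d < 1" "\<And>j::nat. norm (A (real j * s) *v y) \<le> C * d ^ j" by blast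
        have "norm (\<rho> (real j *\<^sub>R (0, s)) (y, 0)) \<le> C * d ^ j" for j :: nat
          using d(3) by (simp add: \<rho>)
        then have "\<exists>x C d. 0 < d \<and> d < 1 \<and> (\<forall>j::nat. norm (\<rho> (real j *\<^sub>R x) (y, 0)) \<le> C * d ^ j)"
          using d(1,2) by blast
        then show "(y, 0) \<in> ?T" by (simp add: q zero_prod_def)
      qed
      then have "span ((\<lambda>y. (y, 0)) ` ?S) \<subseteq> span ?T" by (rule span_mono)
      then show ?thesis using contract[of y] unfolding v linear_span_image[OF lin] by blast
    qed
  qed (auto simp: q_def \<rho>_def A0 Aadd zero_prod_def split: prod.splits)
  then show ?thesis by (simp only: q_def \<rho>_def)
qed

lemma model_monoid_semidirect_line:
  "model_monoid (\<lambda>(x, s) (y, t). (A s *v y, t)) = semidirect_line A"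
  by (auto simp: model_monoid_def semidirect_line_def fun_eq_iff zero_prod_def)

lemma RF_bounded_below_semidirect_line:
  fixes A :: "real \<Rightarrow> real^'d^'d"
  assumes "span {v. \<exists>l. l \<noteq> 0 \<and> (\<forall>s. A s *v v = exp (l * s) *\<^sub>R v)} = UNIV"
    and "cocompact_lattice (semidirect_line A) euclidean \<Gamma>"
  shows "RF_bounded_below_by (semidirect_line A\<lparr>carrier := \<Gamma>\<rparr>) (\<lambda>n. n)"
proof -
  interpret model_group "\<lambda>(x, s). (0, s)" "\<lambda>(x, s) (y, t). (A s *v y, t)"
    by (rule model_group_semidirect_line[OF assms(1)])
  have "(\<lambda>x. x) \<in> iso MG MG" by (simp add: iso_def hom_def bij_betw_def)
  from RF_bounded_below_cocompact_lattice[OF group_MG this _, of euclidean \<Gamma>]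
  show ?thesis using assms(2) by (simp add: model_monoid_semidirect_line)
qed

section \<open>Spanning sets of eigenvectors for Sol and for powers of positive definite
  matrices\<close>

lemma Sol_eigenvectors:
  "span {v. \<exists>l. l \<noteq> 0 \<and> (\<forall>s. (vector [vector [exp s, 0], vector [0, exp (- s)]] :: real^2^2) *v v = exp (l * s) *\<^sub>R v)} = UNIV"
    (is "span ?E = _")
proof -
  have m: "(vector [vector [exp s, 0], vector [0, exp (- s)]] :: real^2^2) *v v = vector [exp s * v $ 1, exp (- s) * v $ 2]" for s v
    by (simp add: vec_eq_iff forall_2 matrix_vector_mult_def sum_2)
  have a: "axis 1 1 \<in> ?E"
    unfolding m by (auto simp: vec_eq_iff forall_2 axis_def intro!: exI[of _ 1])
  have b: "axis 2 1 \<in> ?E"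
    unfolding m by (auto simp: vec_eq_iff forall_2 axis_def intro!: exI[of _ "-1"])
  have "x \<in> span ?E" for x
  proof -
    have "x = x $ 1 *\<^sub>R axis 1 1 + x $ 2 *\<^sub>R axis 2 1" by (simp add: vec_eq_iff forall_2 axis_def)
    also have "\<dots> \<in> span ?E" by (intro span_add span_scale span_base a b)
    finally show ?thesis .
  qed
  then show ?thesis by blast
qed

text \<open>A maximizer of the quadratic form on the unit sphere of the orthogonal complement is an eigenvector.\<close>

lemma symmetric_matrix_eigenvectors_span:
  fixes M :: "real^'d^'d"
  assumes sym: "transpose M = M"
  shows "span {v. \<exists>c. M *v v = c *\<^sub>R v} = UNIV" (is "span ?E = _")
proof (rule ccontr)
  assume "span ?E \<noteq> UNIV"
  then have "dim ?E \<noteq> DIM(real^'d)" using dim_eq_full[of ?E] by simp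
  then have "dim ?E < DIM(real^'d)" using dim_subset_UNIV[of ?E] by simp
  then obtain x where x: "x \<noteq> 0" "\<And>y. y \<in> span ?E \<Longrightarrow> orthogonal x y"
    using orthogonal_to_subspace_exists by blast
  define W where "W = {x. \<forall>y\<in>span ?E. x \<bullet> y = 0}"
  have dot: "u \<bullet> (M *v v) = (M *v u) \<bullet> v" for u v
    using dot_lmul_matrix[of u M v] transpose_matrix_vector[of M u] sym by simp
  have subW: "subspace W" unfolding W_def by (auto simp: subspace_def inner_left_distrib)
  have S_inv: "M *v y \<in> span ?E" if "y \<in> span ?E" for y
    using that
  proof (induction rule: span_induct_alt)
    case (step c v y)
    then obtain l where "M *v v = l *\<^sub>R v" by blast
    then have "M *v (c *\<^sub>R v + y) = (c * l) *\<^sub>R v + M *v y"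
      by (simp add: matrix_vector_right_distrib matrix_vector_mult_scaleR)
    then show ?case using step by (auto intro!: span_add span_scale intro: span_base)
  qed (simp add: span_zero)
  have W_inv: "M *v w \<in> W" if "w \<in> W" for w
    using that S_inv by (auto simp: W_def simp flip: dot)
  have ne: "W \<inter> sphere 0 1 \<noteq> {}"
  proof -
    have "x \<in> W" using x by (auto simp: W_def orthogonal_def)
    then have "x /\<^sub>R norm x \<in> W" using subW by (simp add: subspace_scale)
    then show ?thesis using x(1) by (auto intro!: exI[of _ "x /\<^sub>R norm x"])
  qed
  have "compact (W \<inter> sphere 0 1)" using closed_subspace[OF subW] by (intro closed_Int_compact) auto
  moreover have "continuous_on (W \<inter> sphere 0 1) (\<lambda>x. x \<bullet> (M *v x))"
    by (intro continuous_intros linear_continuous_on_compose[OF continuous_on_id]) simp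
  ultimately obtain u where u': "u \<in> W \<inter> sphere 0 1"
    and max': "\<forall>y\<in>W \<inter> sphere 0 1. y \<bullet> (M *v y) \<le> u \<bullet> (M *v u)"
    using continuous_attains_sup[of "W \<inter> sphere 0 1" "\<lambda>x. x \<bullet> (M *v x)"] ne by blast
  have u: "u \<in> W" "norm u = 1" using u' by auto
  have max: "y \<bullet> (M *v y) \<le> u \<bullet> (M *v u)" if "y \<in> W" "norm y = 1" for y
    using max' that by simp
  define c where "c = u \<bullet> (M *v u)"
  \<comment> \<open>By homogeneity the maximum on the unit sphere becomes \<open>g \<ge> 0\<close>
    on all of \<open>W\<close>, with equality at \<open>u\<close>.\<close>
  define g where "g y = c * (y \<bullet> y) - y \<bullet> (M *v y)" for y
  have g: "g y \<ge> 0" if y: "y \<in> W" for y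
  proof (cases "y = 0")
    case False
    have "y /\<^sub>R norm y \<in> W" using subW y by (simp add: subspace_scale)
    from max[OF this] have "(y /\<^sub>R norm y) \<bullet> (M *v (y /\<^sub>R norm y)) \<le> c" using False by (simp add: c_def)
    then have "(y \<bullet> (M *v y)) / (norm y)\<^sup>2 \<le> c"
      by (simp add: matrix_vector_mult_scaleR power2_eq_square divide_simps split: if_splits)
    then show ?thesis using False by (simp add: g_def divide_simps power2_norm_eq_inner split: if_splits)
  qed (simp add: g_def)
  \<comment> \<open>Half the gradient of \<open>g\<close> at its minimum \<open>u\<close>; it stays
    in \<open>W\<close>, so moving against it must not make \<open>g\<close> negative.\<close>
  define w where "w = c *\<^sub>R u - M *v u"
  have w: "w \<in> W" unfolding w_def using subW u W_inv by (simp add: subspace_diff subspace_scale)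
  have gu: "g u = 0" using u(2) by (simp add: g_def c_def power2_norm_eq_inner[symmetric])
  have gt: "g (u + t *\<^sub>R w) = 2 * t * (w \<bullet> w) + t\<^sup>2 * g w" for t
  proof -
    have "g (u + t *\<^sub>R w) = g u + 2 * t * (c * (u \<bullet> w) - w \<bullet> (M *v u)) + t\<^sup>2 * g w"
      unfolding g_def by (simp add: matrix_vector_right_distrib matrix_vector_mult_scaleR inner_add_left inner_add_right
          dot[of u w] inner_commute power2_eq_square algebra_simps)
    also have "c * (u \<bullet> w) - w \<bullet> (M *v u) = w \<bullet> w"
      by (simp add: w_def inner_diff_right inner_diff_left inner_commute algebra_simps)
    finally show ?thesis using gu by simp
  qed
  have "w \<bullet> w = 0"
  proof (rule ccontr)
    assume "w \<bullet> w \<noteq> 0"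
    then have ww: "w \<bullet> w > 0" by (simp add: inner_gt_zero_iff)
    \<comment> \<open>The minimizer of
      \<open>2 * t * (w \<bullet> w) + t\<^sup>2 * (g w + 1)\<close>; the added 1 keeps the
      denominator positive when \<open>g w = 0\<close>.\<close>
    define t where "t = - (w \<bullet> w) / (g w + 1)"
    have gw: "g w \<ge> 0" using g w by blast
    have "u + t *\<^sub>R w \<in> W" using subW u w by (simp add: subspace_add subspace_scale)
    then have "0 \<le> 2 * t * (w \<bullet> w) + t\<^sup>2 * g w" using g gt by metis
    also have "t\<^sup>2 * g w \<le> t\<^sup>2 * (g w + 1)" by (simp add: algebra_simps)
    also have "t\<^sup>2 * (g w + 1) = - t * (w \<bullet> w)" 
    proof -
      have "t * (g w + 1) = - (w \<bullet> w)" using gw by (simp add: t_def)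
      then show ?thesis by (simp add: power2_eq_square mult.assoc)
    qed
    finally have "0 \<le> t * (w \<bullet> w)" by (simp add: algebra_simps)
    moreover have "t < 0" using ww gw by (simp add: t_def)
    ultimately show False using ww by (simp add: zero_le_mult_iff)
  qed
  then have "M *v u = c *\<^sub>R u" by (simp add: w_def)
  then have "u \<in> span ?E" by (intro span_base) blast
  then have "u \<bullet> u = 0" using u by (auto simp: W_def)
  then show False using u by simp
qed

text \<open>Justifies the \<open>THE\<close> in \<open>mat_rpow\<close>. The map is defined on a
  basis of eigenvectors; by independence, an arbitrary eigenvector for \<open>c\<close> involves
  only basis vectors whose eigenvalue is \<open>c\<close> as well, so it is scaled
  correctly.\<close>

lemma ex1_linear_diagonal:
  fixes M :: "real^'d^'d"
  assumes sp: "span {v. \<exists>c. M *v v = c *\<^sub>R v} = UNIV" (is "span ?E = _")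
  shows "\<exists>!P. \<forall>c v. M *v v = c *\<^sub>R v \<longrightarrow> P *v v = f c *\<^sub>R (v :: real^'d)"
proof (rule ex_ex1I)
  obtain B where B: "B \<subseteq> ?E" "independent B" "?E \<subseteq> span B"
    using maximal_independent_subset[of ?E] by blast
  have finB: "finite B" using B(2) independent_imp_finite by blast
  have UB: "span B = UNIV" using span_mono[OF B(3)] sp by (simp add: span_span top.extremum_unique)
  have "\<forall>b\<in>B. \<exists>l. M *v b = l *\<^sub>R b" using B(1) by blast
  from bchoice[OF this] obtain l where l: "\<And>b. b \<in> B \<Longrightarrow> M *v b = l b *\<^sub>R b" by blast
  obtain p where p: "linear p" "\<And>b. b \<in> B \<Longrightarrow> p b = f (l b) *\<^sub>R b"
    using linear_independent_extend[OF B(2), of "\<lambda>b. f (l b) *\<^sub>R b"] by blast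
  have "matrix p *v v = f c *\<^sub>R v" if v: "M *v v = c *\<^sub>R v" for c v
  proof -
    obtain u where u: "v = (\<Sum>b\<in>B. u b *\<^sub>R b)" using UB span_finite[OF finB] by auto
    have "M *v v = (\<Sum>b\<in>B. (u b * l b) *\<^sub>R b)"
      unfolding u by (simp add: linear_sum[OF matrix_vector_mul_linear] matrix_vector_mult_scaleR l)
    then have "(\<Sum>b\<in>B. (u b * (l b - c)) *\<^sub>R b) = 0"
      using v by (simp add: u scaleR_sum_right algebra_simps sum_subtractf)
    then have z: "u b * (l b - c) = 0" if "b \<in> B" for b
      using independentD[OF B(2) finB order_refl, of "\<lambda>b. u b * (l b - c)"] that by simp
    have "p v = (\<Sum>b\<in>B. u b *\<^sub>R f (l b) *\<^sub>R b)"
      unfolding u by (simp add: linear_sum[OF p(1)] linear_scale[OF p(1)] p(2))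
    also have "\<dots> = (\<Sum>b\<in>B. u b *\<^sub>R f c *\<^sub>R b)"
      by (rule sum.cong) (use z in auto)
    also have "\<dots> = f c *\<^sub>R v" by (simp add: u scaleR_sum_right mult.commute)
    finally show ?thesis using fun_cong[OF matrix_vector_mul(2)[OF p(1)], of v] by simp
  qed
  then show "\<exists>P. \<forall>c v. M *v v = c *\<^sub>R v \<longrightarrow> P *v v = f c *\<^sub>R v" by blast
  fix P Q :: "real^'d^'d"
  assume P: "\<forall>c v. M *v v = c *\<^sub>R v \<longrightarrow> P *v v = f c *\<^sub>R v" and Q: "\<forall>c v. M *v v = c *\<^sub>R v \<longrightarrow> Q *v v = f c *\<^sub>R v"
  have e: "P *v x = Q *v x" if x: "x \<in> ?E" for x
  proof -
    obtain c where c: "M *v x = c *\<^sub>R x" using x by blast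
    show ?thesis using P[rule_format, OF c] Q[rule_format, OF c] by simp
  qed
  have "P *v v = Q *v v" for v
    by (rule linear_eq_on_span[of "(*v) P" "(*v) Q" ?E]) (use e sp in auto)
  then show "P = Q" using matrix_eq by blast
qed

text \<open>The weight of an eigenvector for \<open>c\<close> is \<open>ln c\<close>: defined since
  positive definiteness gives \<open>c > 0\<close>, and nonzero since
  \<open>c \<noteq> 1\<close>.\<close>

lemma mat_rpow_eigenvectors:
  fixes M :: "real^'d^'d"
  assumes pd: "positive_definite M" and ne: "\<forall>c. mat_eigenvalue M c \<longrightarrow> c \<noteq> 1"
  shows "span {v. \<exists>l. l \<noteq> 0 \<and> (\<forall>s. mat_rpow M s *v v = exp (l * s) *\<^sub>R v)} = UNIV" (is "span ?F = _")
proof -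
  have sp: "span {v. \<exists>c. M *v v = c *\<^sub>R v} = UNIV"
    using pd symmetric_matrix_eigenvectors_span unfolding positive_definite_def by blast
  have rp: "mat_rpow M t *v v = (c powr t) *\<^sub>R v" if "M *v v = c *\<^sub>R v" for c t v
    using theI'[OF ex1_linear_diagonal[OF sp, of "\<lambda>c. c powr t"]] that unfolding mat_rpow_def by blast
  have "{v. \<exists>c. M *v v = c *\<^sub>R v} \<subseteq> ?F"
  proof
    fix v assume "v \<in> {v. \<exists>c. M *v v = c *\<^sub>R v}"
    then obtain c where c: "M *v v = c *\<^sub>R v" by blast
    show "v \<in> ?F"
    proof (cases "v = 0")
      case True
      then show ?thesis by (auto intro!: exI[of _ 1])
    next
      case False
      have "v \<bullet> (M *v v) > 0" using pd False unfolding positive_definite_def by blast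
      then have "c * (v \<bullet> v) > 0" by (simp add: c)
      moreover have "v \<bullet> v > 0" using False by simp
      ultimately have "c > 0" by (rule zero_less_mult_pos2)
      moreover have "c \<noteq> 1" using ne c False unfolding mat_eigenvalue_def by blast
      ultimately show ?thesis using rp[OF c] by (auto simp: powr_def mult.commute intro!: exI[of _ "ln c"])
    qed
  qed
  then show ?thesis using span_mono sp by blast
qed


section \<open>Exponentials of endomorphisms\<close>

text \<open>A copy of the type of endomorphisms, made a Banach algebra so that the library exponential applies.\<close>

typedef (overloaded) 'a op = "UNIV :: ('a::euclidean_space \<Rightarrow>\<^sub>L 'a) set" by simp

setup_lifting type_definition_op

instantiation op :: (euclidean_space) real_normed_algebra_1
begin

lift_definition zero_op :: "'a op" is 0 .
lift_definition one_op :: "'a op" is id_blinfun .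
lift_definition plus_op :: "'a op \<Rightarrow> 'a op \<Rightarrow> 'a op" is "(+)" .
lift_definition minus_op :: "'a op \<Rightarrow> 'a op \<Rightarrow> 'a op" is "(-)" .
lift_definition uminus_op :: "'a op \<Rightarrow> 'a op" is uminus .
lift_definition times_op :: "'a op \<Rightarrow> 'a op \<Rightarrow> 'a op" is "(o\<^sub>L)" .
lift_definition scaleR_op :: "real \<Rightarrow> 'a op \<Rightarrow> 'a op" is "(*\<^sub>R)" .
lift_definition norm_op :: "'a op \<Rightarrow> real" is norm .
definition dist_op :: "'a op \<Rightarrow> 'a op \<Rightarrow> real" where "dist_op x y = norm (x - y)"
definition sgn_op :: "'a op \<Rightarrow> 'a op" where "sgn_op x = scaleR (inverse (norm x)) x"
definition uniformity_op :: "('a op \<times> 'a op) filter" where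
  "uniformity_op = (INF e\<in>{0<..}. principal {(x, y). dist x y < e})"
definition open_op :: "'a op set \<Rightarrow> bool" where
  "open_op U \<longleftrightarrow> (\<forall>x\<in>U. \<forall>\<^sub>F (x', y) in uniformity. x' = x \<longrightarrow> y \<in> U)"

instance
proof
  fix x y z :: "'a op" and a b :: real
  show "x + y + z = x + (y + z)" "x + y = y + x" "0 + x = x" "- x + x = 0" "x - y = x + - y"
    by (transfer; simp)+
  show "x * y * z = x * (y * z)" by transfer (rule blinfun_eqI, simp)
  show "(x + y) * z = x * z + y * z" "x * (y + z) = x * y + x * z"
    by (transfer; rule blinfun_eqI; simp add: blinfun.add_left blinfun.add_right)+
  show "1 * x = x" "x * 1 = x" by (transfer; rule blinfun_eqI; simp)+
  show "a *\<^sub>R (x + y) = a *\<^sub>R x + a *\<^sub>R y" "(a + b) *\<^sub>R x = a *\<^sub>R x + b *\<^sub>R x"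
    by (transfer; simp add: algebra_simps)+
  show "a *\<^sub>R b *\<^sub>R x = (a * b) *\<^sub>R x" "1 *\<^sub>R x = x" by (transfer; simp)+
  show "a *\<^sub>R x * y = a *\<^sub>R (x * y)" "x * a *\<^sub>R y = a *\<^sub>R (x * y)"
    by (transfer; rule blinfun_eqI; simp add: blinfun.scaleR_left blinfun.scaleR_right)+
  show "(0::'a op) \<noteq> 1"
  proof transfer
    show "(0 :: 'a \<Rightarrow>\<^sub>L 'a) \<noteq> id_blinfun"
      using norm_blinfun_id[where 'a='a] by (metis norm_zero zero_neq_one)
  qed
  show "norm (1::'a op) = 1" by transfer (rule norm_blinfun_id)
  show "(norm x = 0) = (x = 0)" by transfer simp
  show "norm (x + y) \<le> norm x + norm y" by transfer (rule norm_triangle_ineq)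
  show "norm (a *\<^sub>R x) = \<bar>a\<bar> * norm x" by transfer simp
  show "norm (x * y) \<le> norm x * norm y" by transfer (rule norm_blinfun_compose)
qed (simp_all add: dist_op_def sgn_op_def uniformity_op_def open_op_def)

end

instance op :: (euclidean_space) banach
proof
  fix X :: "nat \<Rightarrow> 'a op" assume X: "Cauchy X"
  have d: "dist x y = dist (Rep_op x) (Rep_op y)" for x y :: "'a op"
    unfolding dist_norm by transfer simp
  have "Cauchy (\<lambda>n. Rep_op (X n))" using X by (simp add: Cauchy_def d)
  then obtain l where l: "(\<lambda>n. Rep_op (X n)) \<longlonglongrightarrow> l" by (meson Cauchy_convergent_iff convergent_def)
  have "X \<longlonglongrightarrow> Abs_op l" using l by (simp add: lim_sequentially d Abs_op_inverse)
  then show "convergent X" by (auto simp: convergent_def)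
qed

lift_definition app :: "'a::euclidean_space op \<Rightarrow> 'a \<Rightarrow> 'a" is blinfun_apply .
lift_definition op_of :: "('a::euclidean_space \<Rightarrow> 'a) \<Rightarrow> 'a op" is Blinfun .

lemma app_op_of [simp]: "linear f \<Longrightarrow> app (op_of f) y = f y"
  by transfer (simp add: bounded_linear_Blinfun_apply linear_conv_bounded_linear)

lemma op_eqI: "(\<And>y. app S y = app T y) \<Longrightarrow> S = T"
  by transfer (rule blinfun_eqI)

lemma app_simps [simp]: "app (S * T) y = app S (app T y)" "app 1 y = y" "app 0 y = 0"
    "app (S + T) y = app S y + app T y" "app (S - T) y = app S y - app T y" "app (- S) y = - app S y"
    "app (c *\<^sub>R S) y = c *\<^sub>R app S y"
  by (transfer; simp add: blinfun.bilinear_simps)+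

lemma bounded_bilinear_app: "bounded_bilinear app"
proof
  fix a a' :: "'a op" and b b' :: 'a and r :: real
  show "app (a + a') b = app a b + app a' b" "app a (b + b') = app a b + app a b'"
    "app (r *\<^sub>R a) b = r *\<^sub>R app a b" "app a (r *\<^sub>R b) = r *\<^sub>R app a b"
    by (transfer; simp add: blinfun.bilinear_simps)+
  have "norm (app a b) \<le> norm a * norm b * 1" for a :: "'a op" and b
    by transfer (simp add: norm_blinfun)
  then show "\<exists>K. \<forall>(a::'a op) b. norm (app a b) \<le> norm a * norm b * K" by blast
qed

interpretation app: bounded_bilinear app by (rule bounded_bilinear_app)

lemma op_of_power: "linear f \<Longrightarrow> app (op_of f ^ n) y = (f ^^ n) y"
  by (induction n arbitrary: y) (simp_all add: power_commutes[symmetric] funpow_swap1)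

lemma exp_minus_one_bound:
  fixes x :: "'a::{real_normed_algebra_1, banach}"
  assumes "norm x \<le> 1" shows "norm (exp x - 1 - x) \<le> (norm x)\<^sup>2"
proof -
  have s: "summable (\<lambda>n. inverse (fact (n + 2)) * norm x ^ (n + 2))"
    using summable_ignore_initial_segment[OF summable_exp[of "norm x"], of 2] by simp
  have "exp x - 1 - x = (\<Sum>n. inverse (fact (n + 2)) *\<^sub>R (x ^ (n + 2)))"
    unfolding exp_first_two_terms[of x] by simp
  also have "norm \<dots> \<le> (\<Sum>n. inverse (fact (n + 2)) * norm x ^ (n + 2))"
  proof (rule norm_suminf_le[OF _ s])
    fix n
    have "norm (x ^ (n + 2)) \<le> norm x ^ (n + 2)" by (rule norm_power_ineq)
    then show "norm (inverse (fact (n + 2)) *\<^sub>R (x ^ (n + 2))) \<le> inverse (fact (n + 2)) * norm x ^ (n + 2)"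
      unfolding norm_scaleR by (simp add: mult_left_mono del: fact_Suc power_Suc add_2_eq_Suc')
  qed
  also have "\<dots> = exp (norm x) - 1 - norm x"
    unfolding exp_first_two_terms[of "norm x"] by simp
  also have "\<dots> \<le> (norm x)\<^sup>2" using exp_bound[of "norm x"] assms by simp
  finally show ?thesis .
qed

text \<open>Commutation gives \<open>exp (T y) = exp (T (y - x)) * exp (T x)\<close>, which reduces
  differentiability at \<open>x\<close> to the quadratic estimate of the exponential at 0.\<close>

lemma has_derivative_exp_commuting:
  fixes T :: "'a::real_normed_vector \<Rightarrow> 'b::{real_normed_algebra_1, banach}"
  assumes T: "bounded_linear T" and comm: "\<And>x y. T x * T y = T y * T x"
  shows "((\<lambda>x. exp (T x)) has_derivative (\<lambda>h. T h * exp (T x))) (at x)"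
  unfolding has_derivative_at_alt
proof (intro conjI allI impI)
  interpret T: bounded_linear T by (rule T)
  show "bounded_linear (\<lambda>h. T h * exp (T x))"
    by (rule bounded_linear_compose[OF bounded_linear_mult_left T])
  fix e :: real assume e: "e > 0"
  obtain K where K: "K > 0" "\<And>h. norm (T h) \<le> norm h * K" using T.pos_bounded by blast
  define E where "E = norm (exp (T x)) + 1"
  have E: "E > 0" by (simp add: E_def add_nonneg_pos)
  \<comment> \<open>The first bound puts \<open>T h\<close> into the unit ball, where the quadratic
    estimate holds; the second turns \<open>K\<^sup>2 * E * norm h\<close> into at most
    \<open>e\<close>.\<close>
  define d where "d = min (1 / K) (e / (K\<^sup>2 * E))"
  have "d > 0" using K E e by (simp add: d_def)
  moreover have "norm (exp (T y) - exp (T x) - T (y - x) * exp (T x)) \<le> e * norm (y - x)" if y: "norm (y - x) < d" for y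
  proof -
    define h where "h = y - x"
    have h: "norm h < 1 / K" "norm h < e / (K\<^sup>2 * E)" using y by (auto simp: d_def h_def)
    have "norm h * K < 1" using h(1) K by (simp add: pos_less_divide_eq)
    then have Th: "norm (T h) \<le> 1" using K(2)[of h] by simp
    have "T y = T h + T x" by (simp add: h_def T.diff)
    then have "exp (T y) = exp (T h) * exp (T x)" using exp_add_commuting[OF comm[of h x]] by simp
    then have "exp (T y) - exp (T x) - T h * exp (T x) = (exp (T h) - 1 - T h) * exp (T x)"
      by (simp add: left_diff_distrib)
    also have "norm \<dots> \<le> norm (exp (T h) - 1 - T h) * norm (exp (T x))" by (rule norm_mult_ineq)
    also have "\<dots> \<le> (norm h * K)\<^sup>2 * E"
      using exp_minus_one_bound[OF Th] K(2)[of h] power_mono[OF K(2)[of h], of 2] by (intro mult_mono) (auto simp: E_def)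
    also have "\<dots> = norm h * (K\<^sup>2 * E) * norm h" by (simp add: power2_eq_square mult_ac)
    also have "\<dots> \<le> e * norm h"
      using h(2) K E by (intro mult_right_mono) (auto simp: pos_less_divide_eq less_imp_le)
    finally show ?thesis by (simp add: h_def)
  qed
  ultimately show "\<exists>d>0. \<forall>y. norm (y - x) < d \<longrightarrow> norm (exp (T y) - exp (T x) - T (y - x) * exp (T x)) \<le> e * norm (y - x)"
    by blast
qed

lemma exp_commutes:
  fixes A B :: "'b::{real_normed_algebra_1, banach}"
  assumes "A * B = B * A" shows "exp A * B = B * exp A"
proof -
  have "exp A * B = (\<Sum>n. (A ^ n /\<^sub>R fact n) * B)"
    unfolding exp_def by (rule suminf_mult2[OF summable_exp_generic])
  also have "\<dots> = (\<Sum>n. B * (A ^ n /\<^sub>R fact n))"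
    using power_commuting_commutes[OF assms] by simp
  also have "\<dots> = B * exp A"
    unfolding exp_def by (rule suminf_mult[OF summable_exp_generic])
  finally show ?thesis .
qed

lemma app_exp_series: "app (exp A) y = (\<Sum>n. app (A ^ n) y /\<^sub>R fact n)" and
  summable_app_exp: "summable (\<lambda>n. app (A ^ n) y /\<^sub>R fact n)"
proof -
  have "bounded_linear (\<lambda>S. app S y)" by (rule app.bounded_linear_left)
  from bounded_linear.suminf[OF this summable_exp_generic[of A]] bounded_linear.summable[OF this summable_exp_generic[of A]]
  show "app (exp A) y = (\<Sum>n. app (A ^ n) y /\<^sub>R fact n)" "summable (\<lambda>n. app (A ^ n) y /\<^sub>R fact n)"
    by (simp_all add: exp_def)
qed

lemma app_exp_finite:
  assumes "app (A ^ k) y = 0"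
  shows "app (exp A) y = (\<Sum>n<k. app (A ^ n) y /\<^sub>R fact n)"
proof -
  have "app (A ^ n) y = 0" if "n \<ge> k" for n
  proof -
    have "A ^ n = A ^ (n - k) * A ^ k" using that by (simp flip: power_add)
    then show ?thesis using assms by (simp add: app.zero_right)
  qed
  then show ?thesis unfolding app_exp_series by (intro suminf_finite) auto
qed

lemma app_exp_kernel: "app A y = 0 \<Longrightarrow> app (exp A) y = y"
  using app_exp_finite[of A 1 y] by simp

lemma exp_diff_of_real:
  fixes A :: "'b::{real_normed_algebra_1, banach}"
  shows "exp A = exp c *\<^sub>R exp (A - c *\<^sub>R 1)"
proof -
  have "exp A = exp (of_real c + (A - c *\<^sub>R 1))" by (simp add: of_real_def)
  also have "\<dots> = exp (of_real c) * exp (A - c *\<^sub>R 1)"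
    by (rule exp_add_commuting) (simp add: algebra_simps of_real_def)
  also have "exp (of_real c :: 'b) = of_real (exp c)" by (rule exp_of_real)
  finally show ?thesis by (simp add: of_real_def)
qed

lemma app_exp_eigenvector:
  assumes "app A y = c *\<^sub>R y" shows "app (exp A) y = exp c *\<^sub>R y"
  using app_exp_kernel[of "A - c *\<^sub>R 1" y] assms by (subst exp_diff_of_real[of A c]) simp

lemma app_left_kernel_exp:
  fixes f :: "'a::euclidean_space \<Rightarrow> 'b::real_normed_vector"
  assumes "linear f" "\<And>y. f (app A y) = 0" shows "f (app (exp A) y) = f y"
proof -
  have bl: "bounded_linear f" using assms(1) by (simp add: linear_conv_bounded_linear)
  have z: "f (app (A ^ n) y) = 0" if n: "n > 0" for n
  proof -
    obtain k where "n = Suc k" using n by (cases n) auto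
    then show ?thesis using assms(2) by simp
  qed
  have "f (app (exp A) y) = (\<Sum>n. f (app (A ^ n) y /\<^sub>R fact n))"
    unfolding app_exp_series by (rule bounded_linear.suminf[OF bl summable_app_exp])
  also have "\<dots> = (\<Sum>n\<in>{0}. f (app (A ^ n) y /\<^sub>R fact n))"
    by (rule suminf_finite) (use z in \<open>auto simp: linear_scale[OF assms(1)]\<close>)
  also have "\<dots> = f y" by simp
  finally show ?thesis .
qed

lemma power_le_fact_mult_exp: "0 \<le> x \<Longrightarrow> x ^ n \<le> fact n * exp (x :: real)"
proof -
  assume x: "0 \<le> x"
  have "x ^ n /\<^sub>R fact n \<le> exp x"
    unfolding exp_def using sum_le_suminf[OF summable_exp_generic[of x], of "{n}"] x by simp
  then show ?thesis by (simp add: field_simps)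
qed

text \<open>With \<open>B = A - c\<close> nilpotent on \<open>v\<close>, the exponential of
  \<open>j A\<close> acts on \<open>v\<close> as \<open>exp (j c)\<close> times a polynomial in
  \<open>j\<close>. Half of the decay is spent on the polynomial, through
  \<open>(e j) ^ n \<le> fact n * exp (e j)\<close> for \<open>e = - c / 2\<close>; the rate
  \<open>exp (c / 2)\<close> remains.\<close>

lemma generalized_eigenvector_contracts:
  assumes k: "app ((A - c *\<^sub>R 1) ^ k) v = 0" and c: "c < 0"
  shows "\<exists>C. \<forall>j::nat. norm (app (exp (real j *\<^sub>R A)) v) \<le> C * exp (c / 2) ^ j"
proof -
  define B where "B = A - c *\<^sub>R 1"
  define e where "e = - c / 2"
  have e: "e > 0" using c by (simp add: e_def)
  define C where "C = (\<Sum>n<k. norm (app (B ^ n) v) / e ^ n)"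
  have "norm (app (exp (real j *\<^sub>R A)) v) \<le> C * exp (c / 2) ^ j" for j :: nat
  proof -
    have "app ((real j *\<^sub>R B) ^ k) v = 0" using k by (simp add: scaleR_power B_def)
    then have "app (exp (real j *\<^sub>R B)) v = (\<Sum>n<k. app ((real j *\<^sub>R B) ^ n) v /\<^sub>R fact n)"
      by (rule app_exp_finite)
    also have "norm \<dots> \<le> (\<Sum>n<k. norm (app (B ^ n) v) / e ^ n * exp (e * real j))"
    proof (rule sum_norm_le)
      fix n assume "n \<in> {..<k}"
      have "(e * real j) ^ n \<le> fact n * exp (e * real j)" using e by (intro power_le_fact_mult_exp) simp
      then have "real j ^ n / fact n \<le> exp (e * real j) / e ^ n"
        using e by (simp add: power_mult_distrib field_simps)
      from mult_right_mono[OF this, of "norm (app (B ^ n) v)"]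
      show "norm (app ((real j *\<^sub>R B) ^ n) v /\<^sub>R fact n) \<le> norm (app (B ^ n) v) / e ^ n * exp (e * real j)"
        by (simp add: scaleR_power field_simps)
    qed
    also have "\<dots> = C * exp (e * real j)" by (simp add: C_def sum_distrib_right)
    finally have *: "norm (app (exp (real j *\<^sub>R B)) v) \<le> C * exp (e * real j)" .
    have "exp (real j *\<^sub>R A) = exp (real j * c) *\<^sub>R exp (real j *\<^sub>R B)"
      by (subst exp_diff_of_real[of _ "real j * c"]) (simp add: B_def scaleR_diff_right)
    then have "norm (app (exp (real j *\<^sub>R A)) v) = exp (real j * c) * norm (app (exp (real j *\<^sub>R B)) v)" by simp
    also have "\<dots> \<le> exp (real j * c) * (C * exp (e * real j))" using * by (intro mult_left_mono) auto
    also have "\<dots> = C * (exp (real j * c) * exp (e * real j))" by simp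
    also have "exp (real j * c) * exp (e * real j) = exp (real j * (c / 2))" by (simp add: e_def field_simps flip: exp_add)
    also have "\<dots> = exp (c / 2) ^ j" by (rule exp_of_nat_mult)
    finally show ?thesis .
  qed
  then show ?thesis by blast
qed


section \<open>Nondegenerate split Lie algebras\<close>

text \<open>Adds the infinitesimal side. \<open>rho_der\<close> is the differential equation of the
  exponential of \<open>ad (q x)\<close>, stated along arbitrary curves so that operator
  exponentials need not appear afterwards. \<open>centralizer\<close> together with
  \<open>faithful\<close> expresses that the centre is trivial.\<close>

locale lie_model = model_group q \<rho> for q :: "'e::euclidean_space \<Rightarrow> 'e" and \<rho> +
  fixes br :: "'e \<Rightarrow> 'e \<Rightarrow> 'e"
  assumes br_linear: "linear (br x)" and br_linear_left: "linear (\<lambda>x. br x y)"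
    and br_anti: "br x y = - br y x"
    and q_br [simp]: "q (br x y) = 0" and br_q_q [simp]: "br (q x) (q y) = 0"
    and br_ker_ker: "q x = 0 \<Longrightarrow> q y = 0 \<Longrightarrow> br x y = 0"
    and centralizer: "q v = 0 \<Longrightarrow> (\<And>y. br v (q y) = 0) \<Longrightarrow> v = 0"
    and rho_der: "(\<tau> has_vector_derivative w) (at t within S) \<Longrightarrow>
      ((\<lambda>s. \<rho> (\<tau> s) v) has_vector_derivative br (q w) (\<rho> (\<tau> t) v)) (at t within S)"
    and rho_br: "\<rho> x (br v (q y)) = br (\<rho> x v) (q y)"

locale split_algebra =
  fixes br :: "'e::euclidean_space \<Rightarrow> 'e \<Rightarrow> 'e" and \<aa> :: "'e set"
  assumes lie: "lie_algebra br" and cartan: "cartan_subalgebra br \<aa>"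
    and split: "split_abelian_by_abelian br \<aa>" and nondeg: "nondegenerate_roots br \<aa>"
begin

abbreviation "\<nn> \<equiv> root_space_sum br \<aa>"

lemma br_linear: "linear (br x)" "linear (\<lambda>x. br x y)"
  using lie by (auto simp: lie_algebra_def)

lemmas br_simps = linear_add[OF br_linear(1)] linear_add[OF br_linear(2)] linear_scale[OF br_linear(1)]
  linear_scale[OF br_linear(2)] linear_0[OF br_linear(1)] linear_0[OF br_linear(2)]
  linear_diff[OF br_linear(1)] linear_diff[OF br_linear(2)] linear_neg[OF br_linear(1)] linear_neg[OF br_linear(2)]

lemma br_self: "br x x = 0" using lie by (auto simp: lie_algebra_def)

lemma br_anti: "br x y = - br y x"
proof -
  have "br (x + y) (x + y) = br x x + br x y + (br y x + br y y)"
    by (simp only: br_simps add_ac)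
  then show ?thesis by (simp add: br_self eq_neg_iff_add_eq_0)
qed

lemma jacobi: "br x (br y z) = br (br x y) z + br y (br x z)"
proof -
  have "br x (br y z) + br y (br z x) + br z (br x y) = 0" using lie by (auto simp: lie_algebra_def)
  moreover have "br y (br z x) = - br y (br x z)" using br_anti[of z x] by (simp add: br_simps)
  moreover have "br z (br x y) = - br (br x y) z" by (rule br_anti)
  ultimately show ?thesis by (simp add: algebra_simps)
qed

lemma sub_\<aa>: "subspace \<aa>" and sub_\<nn>: "subspace \<nn>"
  using split by (auto simp: split_abelian_by_abelian_def lie_subalgebra_def lie_ideal_def)

lemma br_\<aa>: "x \<in> \<aa> \<Longrightarrow> y \<in> \<aa> \<Longrightarrow> br x y = 0" and br_\<nn>: "x \<in> \<nn> \<Longrightarrow> y \<in> \<nn> \<Longrightarrow> br x y = 0"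
  using split by (auto simp: split_abelian_by_abelian_def lie_abelian_def)

lemma br_ideal: "y \<in> \<nn> \<Longrightarrow> br x y \<in> \<nn>"
  using split by (auto simp: split_abelian_by_abelian_def lie_ideal_def)

lemma int_0: "x \<in> \<aa> \<Longrightarrow> x \<in> \<nn> \<Longrightarrow> x = 0"
  using split unfolding split_abelian_by_abelian_def by blast

lemma decomp: "\<exists>y. y \<in> \<aa> \<and> x - y \<in> \<nn>"
proof -
  have "x \<in> {x + y | x y. x \<in> \<aa> \<and> y \<in> \<nn>}" using split unfolding split_abelian_by_abelian_def by simp
  then obtain a b where "x = a + b" "a \<in> \<aa>" "b \<in> \<nn>" by blast
  then show ?thesis by (intro exI[of _ a]) simp
qed

definition q :: "'e \<Rightarrow> 'e" where "q x = (SOME y. y \<in> \<aa> \<and> x - y \<in> \<nn>)"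

lemma q_\<aa>: "q x \<in> \<aa>" and q_\<nn>: "x - q x \<in> \<nn>"
  using someI_ex[OF decomp[of x]] by (auto simp: q_def)

lemma q_unique: "y \<in> \<aa> \<Longrightarrow> x - y \<in> \<nn> \<Longrightarrow> q x = y"
proof -
  assume y: "y \<in> \<aa>" "x - y \<in> \<nn>"
  have "q x - y \<in> \<aa>" using q_\<aa> y sub_\<aa> subspace_diff by blast
  moreover have "(x - y) - (x - q x) \<in> \<nn>" using q_\<nn> y sub_\<nn> subspace_diff by blast
  ultimately have "q x - y = 0" by (intro int_0) simp_all
  then show ?thesis by simp
qed

lemma q_linear: "linear q"
proof (rule linearI)
  fix x y c
  have "x + y - (q x + q y) = (x - q x) + (y - q y)" by simp
  also have "\<dots> \<in> \<nn>" using q_\<nn> sub_\<nn> subspace_add by blast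
  finally show "q (x + y) = q x + q y"
    using q_\<aa> sub_\<aa> subspace_add by (intro q_unique) blast
  have "c *\<^sub>R x - c *\<^sub>R q x = c *\<^sub>R (x - q x)" by (simp add: scaleR_diff_right)
  also have "\<dots> \<in> \<nn>" using q_\<nn> sub_\<nn> subspace_scale by blast
  finally show "q (c *\<^sub>R x) = c *\<^sub>R q x"
    using q_\<aa> sub_\<aa> subspace_scale by (intro q_unique) blast
qed

lemma q_on_\<aa>: "x \<in> \<aa> \<Longrightarrow> q x = x"
  using subspace_0[OF sub_\<nn>] by (intro q_unique) simp_all

lemma q_eq_0: "q x = 0 \<longleftrightarrow> x \<in> \<nn>"
  using q_\<nn>[of x] q_unique[of 0 x] subspace_0[OF sub_\<aa>] by auto

text \<open>Both summands are abelian, so only mixed brackets survive, and these lie in the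
  ideal.\<close>

lemma br_in_\<nn>: "br x y \<in> \<nn>"
proof -
  have e: "br x y = br (q x) (y - q y) + br (x - q x) (q y)"
    using br_\<aa>[OF q_\<aa>[of x] q_\<aa>[of y]] br_\<nn>[OF q_\<nn>[of x] q_\<nn>[of y]] by (simp add: br_simps algebra_simps)
  have "br (x - q x) (q y) = - br (q y) (x - q x)" by (rule br_anti)
  then have "br (x - q x) (q y) \<in> \<nn>" using br_ideal[OF q_\<nn>] sub_\<nn> subspace_neg by metis
  then show ?thesis unfolding e using br_ideal[OF q_\<nn>] sub_\<nn> subspace_add by blast
qed

definition adop :: "'e \<Rightarrow> 'e op" where "adop x = op_of (br (q x))"
definition \<rho> :: "'e \<Rightarrow> 'e \<Rightarrow> 'e" where "\<rho> x y = app (exp (adop x)) y"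

lemma app_adop [simp]: "app (adop x) y = br (q x) y"
  by (simp add: adop_def br_linear)

lemma adop_linear: "linear adop"
  by (rule linearI) (auto intro!: op_eqI simp: linear_add[OF q_linear] linear_scale[OF q_linear] br_simps)

lemma adop_bounded_linear: "bounded_linear adop"
  using adop_linear by (simp add: linear_conv_bounded_linear)

lemma adop_comm: "adop x * adop y = adop y * adop x"
proof (rule op_eqI)
  fix z
  show "app (adop x * adop y) z = app (adop y * adop x) z"
    using jacobi[of "q x" "q y" z] br_\<aa>[OF q_\<aa>[of x] q_\<aa>[of y]] by (simp add: br_simps)
qed

text \<open>Replaces root spaces in the complexification: for a root with real values,
  \<open>ad h - \<alpha> h\<close> acts separately on real and imaginary parts, so both parts of a
  root vector have this property.\<close>

definition real_root_vector :: "('e \<Rightarrow> complex) \<Rightarrow> 'e \<Rightarrow> bool" where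
  "real_root_vector \<alpha> x \<longleftrightarrow> (\<forall>h\<in>\<aa>. \<exists>k. ((\<lambda>x. br h x - Re (\<alpha> h) *\<^sub>R x) ^^ k) x = 0)"

lemma ad_minus_power:
  assumes "Im c = 0"
  shows "(ad_minus br h c ^^ k) (x, y) =
    (((\<lambda>x. br h x - Re c *\<^sub>R x) ^^ k) x, ((\<lambda>x. br h x - Re c *\<^sub>R x) ^^ k) y)"
  by (induction k) (simp_all add: ad_minus_def assms)

lemma Im_root: "\<alpha> \<in> lie_roots br \<aa> \<Longrightarrow> h \<in> \<aa> \<Longrightarrow> Im (\<alpha> h) = 0"
  using nondeg complex_is_Real_iff by (auto simp: nondegenerate_roots_def)

lemma root_space_iff:
  assumes "\<alpha> \<in> lie_roots br \<aa>"
  shows "(x, 0) \<in> root_space br \<aa> \<alpha> \<longleftrightarrow> real_root_vector \<alpha> x"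
proof -
  have z: "((\<lambda>x. br h x - Re (\<alpha> h) *\<^sub>R x) ^^ k) 0 = 0" for h k
    by (induction k) (simp_all add: br_simps)
  show ?thesis
    unfolding root_space_def real_root_vector_def
    using Im_root[OF assms] by (auto simp: ad_minus_power z zero_prod_def)
qed

lemma root_spaceD:
  assumes "\<alpha> \<in> lie_roots br \<aa>" "(x, y) \<in> root_space br \<aa> \<alpha>"
  shows "real_root_vector \<alpha> x" "real_root_vector \<alpha> y"
  using assms Im_root[OF assms(1)] unfolding root_space_def real_root_vector_def
  by (auto simp: ad_minus_power zero_prod_def)

lemma real_root_vector_\<nn>: "\<alpha> \<in> lie_roots br \<aa> \<Longrightarrow> real_root_vector \<alpha> x \<Longrightarrow> x \<in> \<nn>"
  unfolding root_space_sum_def using root_space_iff[of \<alpha> x] by (auto intro!: span_base)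

lemma \<nn>_span: "v \<in> \<nn> \<Longrightarrow> v \<in> span {x. \<exists>\<alpha>\<in>lie_roots br \<aa>. real_root_vector \<alpha> x}"
proof -
  assume "v \<in> \<nn>"
  then have "(v, 0) \<in> span (\<Union>\<alpha>\<in>lie_roots br \<aa>. root_space br \<aa> \<alpha>)" by (simp add: root_space_sum_def)
  then have "fst (v, 0) \<in> fst ` span (\<Union>\<alpha>\<in>lie_roots br \<aa>. root_space br \<aa> \<alpha>)"
    by (intro image_eqI[of _ fst "(v, 0)"]) auto
  also have "\<dots> = span (fst ` (\<Union>\<alpha>\<in>lie_roots br \<aa>. root_space br \<aa> \<alpha>))"
    by (rule linear_span_image[symmetric]) (simp add: linear_fst)
  also have "\<dots> \<subseteq> span {x. \<exists>\<alpha>\<in>lie_roots br \<aa>. real_root_vector \<alpha> x}"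
    by (rule span_mono) (use root_spaceD in force)
  finally show ?thesis by simp
qed

lemma op_power_root:
  assumes "h \<in> \<aa>"
  shows "app ((adop h - c *\<^sub>R 1) ^ k) x = ((\<lambda>x. br h x - c *\<^sub>R x) ^^ k) x"
proof -
  have "linear (\<lambda>x. br h x - c *\<^sub>R x)"
    by (rule linearI) (simp_all add: br_simps algebra_simps)
  moreover have "adop h - c *\<^sub>R 1 = op_of (\<lambda>x. br h x - c *\<^sub>R x)"
    using calculation by (intro op_eqI) (simp add: q_on_\<aa>[OF assms])
  ultimately show ?thesis by (simp add: op_of_power)
qed

text \<open>A nonzero real root is negative at \<open>h\<close> or at \<open>- h\<close>, and there
  \<open>v\<close> is a generalized eigenvector for a negative eigenvalue.\<close>

lemma root_contract:
  assumes \<alpha>: "\<alpha> \<in> lie_roots br \<aa>" and v: "real_root_vector \<alpha> v"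
  shows "\<exists>x C d. 0 < d \<and> d < 1 \<and> (\<forall>j::nat. norm (\<rho> (real j *\<^sub>R x) v) \<le> C * d ^ j)"
proof -
  obtain h where h: "h \<in> \<aa>" "\<alpha> h \<noteq> 0" using \<alpha> by (auto simp: lie_roots_def)
  have fn: "functional_on \<aa> \<alpha>" using \<alpha> by (simp add: lie_roots_def)
  have "Re (\<alpha> h) \<noteq> 0" using h Im_root[OF \<alpha> h(1)] by (simp add: complex_eq_iff)
  moreover have "\<alpha> (- h) = - \<alpha> h" using fn h unfolding functional_on_def by (metis scaleR_minus1_left)
  moreover have "- h \<in> \<aa>" using h sub_\<aa> subspace_neg by blast
  ultimately obtain g where g: "g \<in> \<aa>" "Re (\<alpha> g) < 0"
    using h by (cases "Re (\<alpha> h) < 0") (auto intro: that[of "- h"])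
  obtain k where "((\<lambda>x. br g x - Re (\<alpha> g) *\<^sub>R x) ^^ k) v = 0" using v g by (auto simp: real_root_vector_def)
  then have "app ((adop g - Re (\<alpha> g) *\<^sub>R 1) ^ k) v = 0" using op_power_root[OF g(1)] by simp
  from generalized_eigenvector_contracts[OF this g(2)]
  obtain C where "\<And>j::nat. norm (app (exp (real j *\<^sub>R adop g)) v) \<le> C * exp (Re (\<alpha> g) / 2) ^ j" by blast
  then have "\<forall>j::nat. norm (\<rho> (real j *\<^sub>R g) v) \<le> C * exp (Re (\<alpha> g) / 2) ^ j"
    by (simp add: \<rho>_def linear_scale[OF adop_linear])
  moreover have "0 < exp (Re (\<alpha> g) / 2)" "exp (Re (\<alpha> g) / 2) < 1" using g(2) by auto
  ultimately show ?thesis by blast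
qed

text \<open>If the exponential of \<open>ad t\<close> fixes every vector of the root spaces, each
  root vanishes at \<open>t = q x\<close>. As the roots span the dual space, no functional separates
  \<open>t\<close> from 0.\<close>

lemma faithful:
  assumes "\<And>v. q v = 0 \<Longrightarrow> \<rho> x v = v" shows "q x = 0"
proof -
  define t where "t = q x"
  have t: "t \<in> \<aa>" by (simp add: t_def q_\<aa>)
  have fixed: "app (exp (adop t)) v = v" if "v \<in> \<nn>" for v
  proof -
    have "adop t = adop x" by (rule op_eqI) (simp add: t_def q_on_\<aa>[OF q_\<aa>])
    then show ?thesis using assms[of v] that by (simp add: \<rho>_def q_eq_0)
  qed
  have root: "Re (\<alpha> t) = 0" if \<alpha>: "\<alpha> \<in> lie_roots br \<aa>" for \<alpha>
  proof -
    \<comment> \<open>The last nonzero iterate of \<open>B\<close> on a root vector is a genuine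
      eigenvector of \<open>ad t\<close> with eigenvalue \<open>Re (\<alpha> t)\<close>; the
      exponential scales it by exactly \<open>exp (Re (\<alpha> t))\<close>.\<close>
    define B where "B = (\<lambda>x. br t x - Re (\<alpha> t) *\<^sub>R x)"
    have "root_space br \<aa> \<alpha> \<noteq> {0}" using \<alpha> by (simp add: lie_roots_def)
    moreover have "0 \<in> root_space br \<aa> \<alpha>" by (auto simp: root_space_def intro!: exI[of _ 0])
    ultimately obtain a b where ab: "(a, b) \<in> root_space br \<aa> \<alpha>" "(a, b) \<noteq> 0" by auto
    then obtain w where w: "real_root_vector \<alpha> w" "w \<noteq> 0"
      using root_spaceD[OF \<alpha> ab(1)] by (auto simp: zero_prod_def)
    then have "\<exists>k. (B ^^ k) w = 0" using t by (auto simp: real_root_vector_def B_def)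
    then have l: "(B ^^ (LEAST k. (B ^^ k) w = 0)) w = 0" by (rule LeastI_ex)
    moreover obtain k where k: "(LEAST k. (B ^^ k) w = 0) = Suc k"
      using l w(2) by (cases "LEAST k. (B ^^ k) w = 0") auto
    ultimately have y0: "B ((B ^^ k) w) = 0" by simp
    have y: "(B ^^ k) w \<noteq> 0" using not_less_Least[of k "\<lambda>k. (B ^^ k) w = 0"] k by simp
    have "(B ^^ j) w \<in> \<nn>" for j
      using real_root_vector_\<nn>[OF \<alpha> w(1)]
      by (induction j) (auto simp: B_def intro!: subspace_diff[OF sub_\<nn>] subspace_scale[OF sub_\<nn>] br_ideal)
    moreover have "app (exp (adop t)) ((B ^^ k) w) = exp (Re (\<alpha> t)) *\<^sub>R (B ^^ k) w"
      by (rule app_exp_eigenvector) (use y0 in \<open>simp add: q_on_\<aa>[OF t] B_def\<close>)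
    ultimately have "exp (Re (\<alpha> t)) *\<^sub>R (B ^^ k) w = 1 *\<^sub>R (B ^^ k) w" using fixed by simp
    then have "exp (Re (\<alpha> t)) = 1" using y by (simp only: scaleR_cancel_right simp_thms)
    then show ?thesis by simp
  qed
  \<comment> \<open>The functional chosen to detect \<open>t\<close>: its value there is the squared
    norm of \<open>t\<close>.\<close>
  define f where "f = restrict (\<lambda>h. h \<bullet> t) \<aa>"
  have "functional_on \<aa> f"
    using sub_\<aa> by (auto simp: functional_on_def f_def inner_add_left subspace_add subspace_scale)
  then obtain R r where "finite R" "R \<subseteq> lie_roots br \<aa>" "\<forall>h\<in>\<aa>. f h = (\<Sum>\<alpha>\<in>R. r \<alpha> * Re (\<alpha> h))"
    using nondeg unfolding nondegenerate_roots_def by meson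
  then have "f t = 0" using t root by (auto intro!: sum.neutral)
  then show ?thesis using t by (simp add: f_def t_def)
qed

lemma rho_has_derivative:
  assumes "(\<tau> has_vector_derivative w) (at t within S)"
  shows "((\<lambda>s. \<rho> (\<tau> s) v) has_vector_derivative br (q w) (\<rho> (\<tau> t) v)) (at t within S)"
proof -
  have "((\<lambda>s. exp (adop (\<tau> s))) has_derivative (\<lambda>h. adop (h *\<^sub>R w) * exp (adop (\<tau> t)))) (at t within S)"
    using has_derivative_compose[OF assms[unfolded has_vector_derivative_def]
      has_derivative_exp_commuting[OF adop_bounded_linear adop_comm]] by simp
  from bounded_linear.has_derivative[OF app.bounded_linear_left this]
  show ?thesis
    by (simp add: has_vector_derivative_def \<rho>_def linear_scale[OF adop_linear])
qed

lemma rho_continuous: "continuous_on UNIV (\<lambda>z. \<rho> (fst z) (snd z))"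
proof -
  have "continuous_on UNIV (\<lambda>x. exp (adop x))"
    using has_derivative_continuous[OF has_derivative_exp_commuting[OF adop_bounded_linear adop_comm]]
    by (simp add: continuous_on_eq_continuous_at)
  then have "continuous_on UNIV (\<lambda>z. exp (adop (fst z)))"
    by (rule continuous_on_compose2) (auto intro!: continuous_intros)
  then show ?thesis unfolding \<rho>_def by (intro app.continuous_on continuous_on_snd continuous_on_id)
qed

lemma lie_model: "lie_model q \<rho> br"
proof (rule lie_model.intro)
  show "model_group q \<rho>"
  proof (rule model_group.intro)
    show "linear q" by (rule q_linear)
    show "q (q x) = q x" for x by (rule q_on_\<aa>[OF q_\<aa>])
    show "linear (\<rho> x)" for x unfolding \<rho>_def using app.bounded_linear_right bounded_linear.linear by blast
    show "\<rho> (q x) = \<rho> x" for x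
    proof -
      have "adop (q x) = adop x" by (rule op_eqI) (simp add: q_on_\<aa>[OF q_\<aa>])
      then show ?thesis by (simp add: \<rho>_def[abs_def])
    qed
    show "q (\<rho> x y) = q y" for x y
      unfolding \<rho>_def by (rule app_left_kernel_exp[OF q_linear]) (simp add: q_eq_0 br_in_\<nn>)
    show "\<rho> x (q y) = q y" for x y
      unfolding \<rho>_def by (rule app_exp_kernel) (simp add: br_\<aa> q_\<aa>)
    show "\<rho> (x + y) v = \<rho> x (\<rho> y v)" for x y v
      by (simp add: \<rho>_def linear_add[OF adop_linear] exp_add_commuting[OF adop_comm])
    show "\<rho> 0 v = v" for v by (simp add: \<rho>_def linear_0[OF adop_linear])
    show "continuous_on UNIV (\<lambda>z. \<rho> (fst z) (snd z))" by (rule rho_continuous)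
    show "q x = 0" if "\<And>v. q v = 0 \<Longrightarrow> \<rho> x v = v" for x using faithful that by blast
    show "v \<in> span {v. q v = 0 \<and> (\<exists>x C d. 0 < d \<and> d < 1 \<and> (\<forall>j::nat. norm (\<rho> (real j *\<^sub>R x) v) \<le> C * d ^ j))}"
      if "q v = 0" for v
    proof -
      have "{x. \<exists>\<alpha>\<in>lie_roots br \<aa>. real_root_vector \<alpha> x} \<subseteq>
          {v. q v = 0 \<and> (\<exists>x C d. 0 < d \<and> d < 1 \<and> (\<forall>j::nat. norm (\<rho> (real j *\<^sub>R x) v) \<le> C * d ^ j))}"
        using root_contract real_root_vector_\<nn> by (auto simp: q_eq_0)
      from span_mono[OF this] show ?thesis using \<nn>_span that by (auto simp: q_eq_0)
    qed
  qed
  show "lie_model_axioms q \<rho> br"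
  proof (rule lie_model_axioms.intro)
    show "linear (br x)" "linear (\<lambda>x. br x y)" for x y by (rule br_linear)+
    show "br x y = - br y x" for x y by (rule br_anti)
    show "q (br x y) = 0" for x y by (simp add: q_eq_0 br_in_\<nn>)
    show "br (q x) (q y) = 0" for x y by (simp add: br_\<aa> q_\<aa>)
    show "br x y = 0" if "q x = 0" "q y = 0" for x y using that by (simp add: q_eq_0 br_\<nn>)
    show "v = 0" if v: "q v = 0" "\<And>y. br v (q y) = 0" for v
    proof -
      \<comment> \<open>A vector centralizing the Cartan subalgebra normalizes it, hence lies in it,
        and it meets the sum of the root spaces only in 0.\<close>
      have "br v y = 0" if "y \<in> \<aa>" for y using v(2)[of y] q_on_\<aa>[OF that] by simp
      then have "v \<in> {x. \<forall>y\<in>\<aa>. br x y \<in> \<aa>}" using subspace_0[OF sub_\<aa>] by simp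
      then have "v \<in> \<aa>" using cartan unfolding cartan_subalgebra_def by blast
      then show ?thesis using v(1) int_0 by (simp add: q_eq_0)
    qed
    show "((\<lambda>s. \<rho> (\<tau> s) v) has_vector_derivative br (q w) (\<rho> (\<tau> t) v)) (at t within S)"
      if "(\<tau> has_vector_derivative w) (at t within S)" for \<tau> w t S v
      using rho_has_derivative[OF that] .
    show "\<rho> x (br v (q y)) = br (\<rho> x v) (q y)" for x v y
    proof -
      have "exp (adop x) * adop y = adop y * exp (adop x)" by (rule exp_commutes[OF adop_comm])
      then have "app (exp (adop x)) (app (adop y) v) = app (adop y) (app (exp (adop x)) v)"
        by (metis app_simps(1))
      then show ?thesis
        using br_anti[of v "q y"] br_anti[of "\<rho> x v" "q y"] by (simp add: \<rho>_def app.minus_right)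
    qed
  qed
qed

end

lemma nondegenerate_split_lie_algebra_model:
  assumes "nondegenerate_split_lie_algebra br"
  shows "\<exists>q \<rho>. lie_model q \<rho> br"
proof -
  obtain \<aa> where "split_algebra br \<aa>"
    using assms unfolding nondegenerate_split_lie_algebra_def solvable_lie_algebra_def split_algebra_def by blast
  then show ?thesis using split_algebra.lie_model by blast
qed


section \<open>The adjoint representation in a chart\<close>

lemma linear_eq_sum_Basis:
  fixes f :: "'a::euclidean_space \<Rightarrow> 'b::real_vector"
  assumes "linear f" shows "f x = (\<Sum>b\<in>Basis. (x \<bullet> b) *\<^sub>R f b)"
proof -
  have "f x = f (\<Sum>b\<in>Basis. (x \<bullet> b) *\<^sub>R b)" by (simp add: euclidean_representation)
  also have "\<dots> = (\<Sum>b\<in>Basis. (x \<bullet> b) *\<^sub>R f b)" by (simp add: linear_sum[OF assms] linear_scale[OF assms])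
  finally show ?thesis .
qed

text \<open>A product rule for linear maps whose differentiability is known only on each fixed
  vector; expanding in the finite basis makes this sufficient.\<close>

lemma has_derivative_apply_linear:
  fixes A :: "'a::real_normed_vector \<Rightarrow> 'e::euclidean_space \<Rightarrow> 'f::real_normed_vector"
  assumes lin: "\<And>y. y \<in> S \<Longrightarrow> linear (A y)" and x: "x \<in> S"
    and A: "\<And>k. ((\<lambda>y. A y k) has_derivative A' k) (at x within S)"
    and A'_lin: "\<And>h. linear (\<lambda>k. A' k h)"
    and f: "(f has_derivative f') (at x within S)"
  shows "((\<lambda>y. A y (f y)) has_derivative (\<lambda>h. A' (f x) h + A x (f' h))) (at x within S)"
proof -
  have "((\<lambda>y. \<Sum>b\<in>Basis. (f y \<bullet> b) *\<^sub>R A y b) has_derivative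
      (\<lambda>h. \<Sum>b\<in>Basis. (f x \<bullet> b) *\<^sub>R A' b h + (f' h \<bullet> b) *\<^sub>R A x b)) (at x within S)"
    by (intro has_derivative_sum has_derivative_scaleR A has_derivative_inner_left f)
  moreover have "(\<Sum>b\<in>Basis. (f x \<bullet> b) *\<^sub>R A' b h + (f' h \<bullet> b) *\<^sub>R A x b) = A' (f x) h + A x (f' h)" for h
    using linear_eq_sum_Basis[OF A'_lin[of h], of "f x"] linear_eq_sum_Basis[OF lin[OF x], of "f' h"]
    by (simp add: sum.distrib)
  ultimately have "((\<lambda>y. \<Sum>b\<in>Basis. (f y \<bullet> b) *\<^sub>R A y b) has_derivative
      (\<lambda>h. A' (f x) h + A x (f' h))) (at x within S)" by simp
  then show ?thesis
    by (rule has_derivative_transform[OF x, rotated]) (use linear_eq_sum_Basis[OF lin] in simp)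
qed

lemma linear_derivative_in_parameter:
  fixes A :: "'a::euclidean_space \<Rightarrow> 'e::real_normed_vector \<Rightarrow> 'f::real_normed_vector"
  assumes "open S" "x \<in> S" and lin: "\<And>y. y \<in> S \<Longrightarrow> linear (A y)"
    and A: "\<And>k. ((\<lambda>y. A y k) has_derivative A' k) (at x)"
  shows "linear (\<lambda>k. A' k h)"
proof (rule linearI)
  fix k l
  have "((\<lambda>y. A y k + A y l) has_derivative (\<lambda>h. A' k h + A' l h)) (at x)"
    by (intro has_derivative_add A)
  then have "((\<lambda>y. A y (k + l)) has_derivative (\<lambda>h. A' k h + A' l h)) (at x)"
    by (rule has_derivative_transform_within_open[OF _ assms(1,2)]) (simp add: linear_add[OF lin])
  then have "A' (k + l) = (\<lambda>h. A' k h + A' l h)" by (rule has_derivative_unique[OF A])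
  then show "A' (k + l) h = A' k h + A' l h" by simp
next
  fix c k
  have "((\<lambda>y. c *\<^sub>R A y k) has_derivative (\<lambda>h. c *\<^sub>R A' k h)) (at x)"
    by (intro has_derivative_scaleR_right A)
  then have "((\<lambda>y. A y (c *\<^sub>R k)) has_derivative (\<lambda>h. c *\<^sub>R A' k h)) (at x)"
    by (rule has_derivative_transform_within_open[OF _ assms(1,2)]) (simp add: linear_scale[OF lin])
  then have "A' (c *\<^sub>R k) = (\<lambda>h. c *\<^sub>R A' k h)" by (rule has_derivative_unique[OF A])
  then show "A' (c *\<^sub>R k) h = c *\<^sub>R A' k h" by simp
qed

text \<open>
  The second difference \<open>f (x + th + tk) - f (x + th) - f (x + tk) + f x\<close> is \<open>t\<^sup>2\<close> times the second
  derivative up to \<open>o(t\<^sup>2)\<close>; being symmetric in \<open>h\<close> and \<open>k\<close>, it forces the derivative to be so.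
\<close>

lemma second_difference_estimate:
  fixes F :: "'a::real_normed_vector \<Rightarrow> real"
  assumes "open S" "x \<in> S" and F: "\<And>y. y \<in> S \<Longrightarrow> (F has_derivative F' y) (at y)"
    and N: "((\<lambda>y. F' y h) has_derivative N) (at x)" and e: "e > 0"
  shows "\<exists>d>0. \<forall>t. 0 < t \<and> t < d \<longrightarrow>
    \<bar>F (x + t *\<^sub>R h + t *\<^sub>R k) - F (x + t *\<^sub>R h) - F (x + t *\<^sub>R k) + F x - t\<^sup>2 * N k\<bar> \<le> 2 * e * t\<^sup>2 * (norm h + norm k)"
proof -
  obtain r where r: "r > 0" "ball x r \<subseteq> S" using assms(1,2) openE by blast
  have linN: "linear N" using N has_derivative_linear by blast
  obtain d where d: "d > 0" "\<And>y. norm (y - x) < d \<Longrightarrow> \<bar>F' y h - F' x h - N (y - x)\<bar> \<le> e * norm (y - x)"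
    using N e unfolding has_derivative_at_alt by (metis real_norm_def)
  define M where "M = norm h + norm k + 1"
  have M: "M > 0" by (simp add: M_def add_nonneg_pos)
  define d' where "d' = min d r / M"
  have d': "d' > 0" using d r M by (simp add: d'_def)
  have "\<bar>F (x + t *\<^sub>R h + t *\<^sub>R k) - F (x + t *\<^sub>R h) - F (x + t *\<^sub>R k) + F x - t\<^sup>2 * N k\<bar> \<le> 2 * e * t\<^sup>2 * (norm h + norm k)"
    if t: "0 < t" "t < d'" for t
  proof -
    have tM: "t * M < min d r" using t(2) M by (simp add: d'_def pos_less_divide_eq)
    have small: "norm (s *\<^sub>R h + a *\<^sub>R k) \<le> t * (norm h + norm k)" if "0 \<le> s" "s \<le> t" "0 \<le> a" "a \<le> t" for s a
    proof -
      have "norm (s *\<^sub>R h + a *\<^sub>R k) \<le> s * norm h + a * norm k"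
        using norm_triangle_ineq[of "s *\<^sub>R h" "a *\<^sub>R k"] that by simp
      also have "\<dots> \<le> t * norm h + t * norm k" using that by (intro add_mono mult_right_mono) auto
      finally show ?thesis by (simp add: algebra_simps)
    qed
    have lt: "t * (norm h + norm k) < min d r"
    proof -
      have "t * (norm h + norm k) \<le> t * M" using t by (simp add: M_def)
      then show ?thesis using tM by simp
    qed
    have inS: "x + (s *\<^sub>R h + a *\<^sub>R k) \<in> S" if "0 \<le> s" "s \<le> t" "0 \<le> a" "a \<le> t" for s a
    proof -
      have "dist x (x + y) = norm y" for y :: 'a by (simp add: dist_norm)
      then have "dist x (x + (s *\<^sub>R h + a *\<^sub>R k)) < r" using small[OF that] lt by (simp only:)
      then show ?thesis using r by auto
    qed
    \<comment> \<open>The second difference is \<open>\<phi> t - \<phi> 0\<close>. One use of the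
      mean value theorem leaves first derivatives in direction \<open>h\<close> at two nearby
      points, which differ by about \<open>t * N k\<close>.\<close>
    define \<phi> where "\<phi> s = F (x + (s *\<^sub>R h + t *\<^sub>R k)) - F (x + (s *\<^sub>R h + 0 *\<^sub>R k))" for s
    have der: "(\<phi> has_real_derivative F' (x + (s *\<^sub>R h + t *\<^sub>R k)) h - F' (x + (s *\<^sub>R h + 0 *\<^sub>R k)) h) (at s)"
      if s: "0 \<le> s" "s \<le> t" for s
    proof -
      have *: "((\<lambda>s. F (x + (s *\<^sub>R h + a *\<^sub>R k))) has_real_derivative F' (x + (s *\<^sub>R h + a *\<^sub>R k)) h) (at s)"
        if a: "0 \<le> a" "a \<le> t" for a
      proof -
        have "((\<lambda>s. x + (s *\<^sub>R h + a *\<^sub>R k)) has_derivative (\<lambda>u. u *\<^sub>R h)) (at s)"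
          by (auto intro!: derivative_eq_intros)
        from has_derivative_compose[OF this F[OF inS[OF s a]]]
        have "((\<lambda>s. F (x + (s *\<^sub>R h + a *\<^sub>R k))) has_derivative (\<lambda>u. F' (x + (s *\<^sub>R h + a *\<^sub>R k)) (u *\<^sub>R h))) (at s)" .
        moreover have "linear (F' (x + (s *\<^sub>R h + a *\<^sub>R k)))" using F[OF inS[OF s a]] has_derivative_linear by blast
        ultimately show ?thesis by (simp add: has_field_derivative_def linear_scale mult_commute_abs)
      qed
      show ?thesis unfolding \<phi>_def by (rule DERIV_diff[OF * *]) (use t in auto)
    qed
    obtain s where s: "0 < s" "s < t" "\<phi> t - \<phi> 0 = (t - 0) * (F' (x + (s *\<^sub>R h + t *\<^sub>R k)) h - F' (x + (s *\<^sub>R h + 0 *\<^sub>R k)) h)"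
      using MVT2[OF t(1), of \<phi>, OF der] by auto
    have est: "\<bar>F' (x + (s *\<^sub>R h + a *\<^sub>R k)) h - F' x h - N (s *\<^sub>R h + a *\<^sub>R k)\<bar> \<le> e * (t * (norm h + norm k))"
      if "0 \<le> a" "a \<le> t" for a
    proof -
      have n: "norm (s *\<^sub>R h + a *\<^sub>R k) \<le> t * (norm h + norm k)" using s that by (intro small) auto
      then have "\<bar>F' (x + (s *\<^sub>R h + a *\<^sub>R k)) h - F' x h - N (s *\<^sub>R h + a *\<^sub>R k)\<bar> \<le> e * norm (s *\<^sub>R h + a *\<^sub>R k)"
        using d(2)[of "x + (s *\<^sub>R h + a *\<^sub>R k)"] lt by simp
      also have "\<dots> \<le> e * (t * (norm h + norm k))" using n e by (intro mult_left_mono) auto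
      finally show ?thesis .
    qed
    have "N (s *\<^sub>R h + t *\<^sub>R k) - N (s *\<^sub>R h + 0 *\<^sub>R k) = t * N k"
      by (simp add: linear_add[OF linN] linear_scale[OF linN])
    then have "\<bar>(F' (x + (s *\<^sub>R h + t *\<^sub>R k)) h - F' (x + (s *\<^sub>R h + 0 *\<^sub>R k)) h) - t * N k\<bar> \<le> 2 * (e * (t * (norm h + norm k)))"
      using est[of t] est[of 0] t by linarith
    then have "t * \<bar>(F' (x + (s *\<^sub>R h + t *\<^sub>R k)) h - F' (x + (s *\<^sub>R h + 0 *\<^sub>R k)) h) - t * N k\<bar> \<le> t * (2 * (e * (t * (norm h + norm k))))"
      using t by (intro mult_left_mono) auto
    moreover have "F (x + t *\<^sub>R h + t *\<^sub>R k) - F (x + t *\<^sub>R h) - F (x + t *\<^sub>R k) + F x - t\<^sup>2 * N k =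
        t * ((F' (x + (s *\<^sub>R h + t *\<^sub>R k)) h - F' (x + (s *\<^sub>R h + 0 *\<^sub>R k)) h) - t * N k)"
      using s(3) by (simp add: \<phi>_def power2_eq_square algebra_simps)
    ultimately show ?thesis using t by (simp add: abs_mult power2_eq_square mult_ac)
  qed
  then show ?thesis using d' by blast
qed

lemma symmetric_second_derivative_real:
  fixes F :: "'a::real_normed_vector \<Rightarrow> real"
  assumes S: "open S" "x \<in> S" and F: "\<And>y. y \<in> S \<Longrightarrow> (F has_derivative F' y) (at y)"
    and N: "\<And>h. ((\<lambda>y. F' y h) has_derivative N h) (at x)"
  shows "N h k = N k h"
proof -
  have "\<bar>N h k - N k h\<bar> \<le> e" if "e > 0" for e
  proof -
    define M where "M = norm h + norm k + 1"
    have M: "M > 0" by (simp add: M_def add_nonneg_pos)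
    \<comment> \<open>The estimates for both orders of \<open>h\<close> and \<open>k\<close>
      contribute \<open>2 * e'\<close> each, and \<open>M\<close> bounds the sum of the
      norms.\<close>
    define e' where "e' = e / (4 * M)"
    have e': "e' > 0" using that M by (simp add: e'_def)
    obtain d1 where d1: "d1 > 0" "\<And>t. 0 < t \<and> t < d1 \<Longrightarrow>
        \<bar>F (x + t *\<^sub>R h + t *\<^sub>R k) - F (x + t *\<^sub>R h) - F (x + t *\<^sub>R k) + F x - t\<^sup>2 * N h k\<bar> \<le> 2 * e' * t\<^sup>2 * (norm h + norm k)"
      using second_difference_estimate[OF S F N e', of h k] by auto
    obtain d2 where d2: "d2 > 0" "\<And>t. 0 < t \<and> t < d2 \<Longrightarrow>
        \<bar>F (x + t *\<^sub>R k + t *\<^sub>R h) - F (x + t *\<^sub>R k) - F (x + t *\<^sub>R h) + F x - t\<^sup>2 * N k h\<bar> \<le> 2 * e' * t\<^sup>2 * (norm k + norm h)"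
      using second_difference_estimate[OF S F N e', of k h] by auto
    define t where "t = min d1 d2 / 2"
    have t: "0 < t" "t < d1" "t < d2" using d1(1) d2(1) by (auto simp: t_def)
    have sw: "F (x + t *\<^sub>R k + t *\<^sub>R h) = F (x + t *\<^sub>R h + t *\<^sub>R k)" by (simp add: add_ac)
    have "\<bar>t\<^sup>2 * N h k - t\<^sup>2 * N k h\<bar> \<le> 4 * e' * t\<^sup>2 * (norm h + norm k)"
      using d1(2)[of t] d2(2)[of t] t unfolding sw by (simp add: add.commute[of "norm k"])
    moreover have "\<bar>t\<^sup>2 * N h k - t\<^sup>2 * N k h\<bar> = t\<^sup>2 * \<bar>N h k - N k h\<bar>"
      by (simp only: right_diff_distrib[symmetric] abs_mult) simp
    moreover have "4 * e' * t\<^sup>2 * (norm h + norm k) = t\<^sup>2 * (4 * e' * (norm h + norm k))" by simp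
    ultimately have "t\<^sup>2 * \<bar>N h k - N k h\<bar> \<le> t\<^sup>2 * (4 * e' * (norm h + norm k))" by linarith
    then have "\<bar>N h k - N k h\<bar> \<le> 4 * e' * (norm h + norm k)" using t by simp
    also have "\<dots> \<le> 4 * e' * M" using e' by (simp add: M_def)
    also have "\<dots> = e" using M by (simp add: e'_def)
    finally show ?thesis .
  qed
  then have "\<bar>N h k - N k h\<bar> \<le> 0" using field_le_epsilon[of "\<bar>N h k - N k h\<bar>" 0] by simp
  then show ?thesis by simp
qed

lemma symmetric_second_derivative:
  fixes f :: "'a::real_normed_vector \<Rightarrow> 'b::euclidean_space"
  assumes S: "open S" "x \<in> S" and f: "\<And>y. y \<in> S \<Longrightarrow> (f has_derivative f' y) (at y)"
    and N: "\<And>h. ((\<lambda>y. f' y h) has_derivative N h) (at x)"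
  shows "N h k = N k h"
proof (rule euclidean_eqI)
  fix b :: 'b
  show "N h k \<bullet> b = N k h \<bullet> b"
    by (rule symmetric_second_derivative_real[OF S, of "\<lambda>y. f y \<bullet> b" "\<lambda>y h. f' y h \<bullet> b" "\<lambda>h k. N h k \<bullet> b"])
      (intro has_derivative_inner_left f N; assumption)+
qed

lemma eventually_in_open_isCont:
  assumes "isCont f a" "open S" "f a \<in> S" shows "eventually (\<lambda>x. f x \<in> S) (nhds a)"
proof -
  have "(f \<longlongrightarrow> f a) (nhds a)"
    using assms(1) unfolding isCont_def tendsto_at_iff_tendsto_nhds .
  then show ?thesis using assms(2,3) by (rule topological_tendstoD)
qed

lemma has_derivative_eventually_eq:
  assumes "(f has_derivative f') (at x)" "eventually (\<lambda>y. f y = g y) (nhds x)"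
  shows "(g has_derivative f') (at x)"
proof -
  obtain S where "open S" "x \<in> S" "\<And>y. y \<in> S \<Longrightarrow> f y = g y"
    using assms(2) unfolding eventually_nhds by auto
  then show ?thesis using has_derivative_transform_within_open[OF assms(1)] by blast
qed

text \<open>The Lie group near its unit, in one chart. The bracket and the derivative of the adjoint
  representation involve at most second derivatives of the multiplication and first derivatives of
  the inversion.\<close>

locale lie_chart = group G for G :: "('g, 'b) monoid_scheme" (structure) +
  fixes U :: "'g set" and \<phi> :: "'g \<Rightarrow> 'e::euclidean_space"
  assumes inj: "inj_on \<phi> U" and one_U: "\<one> \<in> U" and U_carrier: "U \<subseteq> carrier G"
    and open_D: "open (\<phi> ` U)"
    and open_\<Omega>: "open {(u, v). u \<in> \<phi> ` U \<and> v \<in> \<phi> ` U \<and> inv_into U \<phi> u \<otimes> inv_into U \<phi> v \<in> U}"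
    and open_\<Omega>i: "open {u \<in> \<phi> ` U. inv (inv_into U \<phi> u) \<in> U}"
    and smooth_mult: "Ck_on 2 {(u, v). u \<in> \<phi> ` U \<and> v \<in> \<phi> ` U \<and> inv_into U \<phi> u \<otimes> inv_into U \<phi> v \<in> U}
      (\<lambda>(u, v). \<phi> (inv_into U \<phi> u \<otimes> inv_into U \<phi> v))"
    and smooth_inv: "Ck_on 1 {u \<in> \<phi> ` U. inv (inv_into U \<phi> u) \<in> U} (\<lambda>u. \<phi> (inv (inv_into U \<phi> u)))"
begin

text \<open>
  In the chart \<open>\<phi>\<close>, with inverse \<open>\<psi>\<close>: \<open>p\<close> is the unit, \<open>m\<close> and \<open>i\<close> are multiplication and inversion, \<open>M w\<close>
  is the differential of \<open>m\<close> at \<open>w\<close>, \<open>L u\<close> that of the left translation by \<open>u\<close> at the unit, \<open>\<Lambda> u\<close> its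
  inverse (the Maurer--Cartan form) and \<open>Ad u\<close> the adjoint representation.
\<close>

abbreviation "D \<equiv> \<phi> ` U"
abbreviation "\<psi> \<equiv> inv_into U \<phi>"
definition "p = \<phi> \<one>"
definition "\<Omega> = {(u, v). u \<in> D \<and> v \<in> D \<and> \<psi> u \<otimes> \<psi> v \<in> U}"
definition "\<Omega>i = {u \<in> D. inv (\<psi> u) \<in> U}"
definition "m = (\<lambda>(u, v). \<phi> (\<psi> u \<otimes> \<psi> v))"
definition "i u = \<phi> (inv (\<psi> u))"
definition "M w = frechet_derivative m (at w)"
definition "L u Y = M (u, p) (0, Y)"
definition "Ad u Y = M (u, i u) (L u Y, 0)"
definition "\<Lambda> u Z = M (i u, u) (0, Z)"

lemma \<psi>_\<phi> [simp]: "g \<in> U \<Longrightarrow> \<psi> (\<phi> g) = g" using inj by simp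
lemma \<phi>_\<psi> [simp]: "u \<in> D \<Longrightarrow> \<phi> (\<psi> u) = u" by (rule f_inv_into_f)
lemma \<psi>_U [simp]: "u \<in> D \<Longrightarrow> \<psi> u \<in> U" by (rule inv_into_into)
lemma \<psi>_carrier [simp]: "u \<in> D \<Longrightarrow> \<psi> u \<in> carrier G" using U_carrier \<psi>_U by blast
lemma \<psi>_p [simp]: "\<psi> p = \<one>" using one_U by (simp add: p_def)
lemma p_D [simp]: "p \<in> D" using one_U by (simp add: p_def)

lemma \<Omega>_iff: "(u, v) \<in> \<Omega> \<longleftrightarrow> u \<in> D \<and> v \<in> D \<and> \<psi> u \<otimes> \<psi> v \<in> U" by (simp add: \<Omega>_def)
lemma \<Omega>i_iff: "u \<in> \<Omega>i \<longleftrightarrow> u \<in> D \<and> inv (\<psi> u) \<in> U" by (simp add: \<Omega>i_def)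
lemma m_eq: "m (u, v) = \<phi> (\<psi> u \<otimes> \<psi> v)" by (simp add: m_def)
lemma opens [simp]: "open \<Omega>" "open \<Omega>i" using open_\<Omega> open_\<Omega>i by (auto simp: \<Omega>_def \<Omega>i_def)
lemma \<psi>_m [simp]: "(u, v) \<in> \<Omega> \<Longrightarrow> \<psi> (m (u, v)) = \<psi> u \<otimes> \<psi> v" by (simp add: \<Omega>_iff m_eq)
lemma m_D [simp]: "(u, v) \<in> \<Omega> \<Longrightarrow> m (u, v) \<in> D" by (auto simp: \<Omega>_iff m_eq)
lemma \<psi>_i [simp]: "u \<in> \<Omega>i \<Longrightarrow> \<psi> (i u) = inv (\<psi> u)" by (simp add: \<Omega>i_iff i_def)
lemma i_D [simp]: "u \<in> \<Omega>i \<Longrightarrow> i u \<in> D" by (simp add: \<Omega>i_iff i_def)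
lemma \<Omega>i_D: "u \<in> \<Omega>i \<Longrightarrow> u \<in> D" by (simp add: \<Omega>i_iff)
lemma p_\<Omega>i [simp]: "p \<in> \<Omega>i" using one_U by (simp add: \<Omega>i_iff)
lemma i_p [simp]: "i p = p" using one_U by (simp add: i_def p_def)
lemma \<Omega>_p [simp]: "u \<in> D \<Longrightarrow> (u, p) \<in> \<Omega>" "u \<in> D \<Longrightarrow> (p, u) \<in> \<Omega>" by (auto simp: \<Omega>_iff)
lemma m_p [simp]: "u \<in> D \<Longrightarrow> m (u, p) = u" "u \<in> D \<Longrightarrow> m (p, u) = u" by (simp_all add: m_eq)
lemma \<Omega>_i [simp]: "u \<in> \<Omega>i \<Longrightarrow> (u, i u) \<in> \<Omega>" "u \<in> \<Omega>i \<Longrightarrow> (i u, u) \<in> \<Omega>"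
  using \<Omega>i_D one_U by (simp_all add: \<Omega>_iff)
lemma m_i [simp]: "u \<in> \<Omega>i \<Longrightarrow> m (u, i u) = p" "u \<in> \<Omega>i \<Longrightarrow> m (i u, u) = p"
  using \<Omega>i_D by (simp_all add: m_eq p_def)

lemma m_smooth: "Ck_on 2 \<Omega> m"
  using smooth_mult by (simp only: \<Omega>_def m_def)

lemma i_smooth: "Ck_on 1 \<Omega>i i"
  using smooth_inv unfolding \<Omega>i_def i_def[abs_def] .

lemma m_der: "w \<in> \<Omega> \<Longrightarrow> (m has_derivative M w) (at w)"
  using m_smooth unfolding M_def frechet_derivative_works[symmetric] by (simp add: numeral_2_eq_2)

lemma M_diff: "w \<in> \<Omega> \<Longrightarrow> (\<lambda>w. M w k) differentiable (at w)"
  using m_smooth unfolding M_def by (cases k) (simp add: numeral_2_eq_2)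

lemma i_diff: "u \<in> \<Omega>i \<Longrightarrow> i differentiable (at u)"
  using i_smooth by simp

lemma linear_M: "w \<in> \<Omega> \<Longrightarrow> linear (M w)"
  using m_der has_derivative_linear by blast

lemma linear_L: "u \<in> D \<Longrightarrow> linear (L u)"
  unfolding L_def using linear_compose[OF _ linear_M[of "(u, p)"], of "\<lambda>Y. (0, Y)"]
  by (simp add: o_def linear_iff)

lemma linear_\<Lambda>: "u \<in> \<Omega>i \<Longrightarrow> linear (\<Lambda> u)"
  unfolding \<Lambda>_def using linear_compose[OF _ linear_M[of "(i u, u)"], of "\<lambda>Y. (0, Y)"]
  by (simp add: o_def linear_iff)

lemma linear_Ad: "u \<in> \<Omega>i \<Longrightarrow> linear (Ad u)"
  unfolding Ad_def
  using linear_compose[OF linear_compose[OF linear_L[of u]] linear_M[of "(u, i u)"], of "\<lambda>Y. (Y, 0)"] \<Omega>i_D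
  by (simp add: o_def linear_iff)

lemma der_m_right: "(u, v) \<in> \<Omega> \<Longrightarrow> ((\<lambda>v. m (u, v)) has_derivative (\<lambda>h. M (u, v) (0, h))) (at v)"
  by (rule has_derivative_compose[OF _ m_der, of "\<lambda>v. (u, v)"]) (auto intro!: derivative_eq_intros)

lemma der_m_left: "(u, v) \<in> \<Omega> \<Longrightarrow> ((\<lambda>u. m (u, v)) has_derivative (\<lambda>h. M (u, v) (h, 0))) (at u)"
  by (rule has_derivative_compose[OF _ m_der, of "\<lambda>u. (u, v)"]) (auto intro!: derivative_eq_intros)

lemma der_L: "u \<in> D \<Longrightarrow> ((\<lambda>v. m (u, v)) has_derivative L u) (at p)"
  unfolding L_def using der_m_right[of u p] by simp

lemma M_p_left: "u \<in> D \<Longrightarrow> M (u, p) (Y, 0) = Y"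
proof -
  assume u: "u \<in> D"
  have "((\<lambda>u. u) has_derivative (\<lambda>h. M (u, p) (h, 0))) (at u)"
    by (rule has_derivative_transform_within_open[OF der_m_left open_D u]) (use u in auto)
  from has_derivative_unique[OF this has_derivative_ident] show ?thesis by meson
qed

lemma L_p [simp]: "L p Y = Y"
proof -
  have "((\<lambda>u. u) has_derivative L p) (at p)"
    by (rule has_derivative_transform_within_open[OF der_L open_D]) auto
  from has_derivative_unique[OF this has_derivative_ident] show ?thesis by meson
qed

lemma \<Lambda>_p [simp]: "\<Lambda> p Z = Z"
  using L_p by (simp add: \<Lambda>_def L_def)

lemma Ad_p [simp]: "Ad p Y = Y"
  by (simp add: Ad_def M_p_left)

lemma isCont_m: "w \<in> \<Omega> \<Longrightarrow> isCont m w"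
  using m_der has_derivative_continuous by blast

lemma eventually_\<Omega>: "(u, v) \<in> \<Omega> \<Longrightarrow> isCont f a \<Longrightarrow> isCont g a \<Longrightarrow> f a = u \<Longrightarrow> g a = v \<Longrightarrow>
    eventually (\<lambda>x. (f x, g x) \<in> \<Omega>) (nhds a)"
proof -
  assume "(u, v) \<in> \<Omega>" "isCont f a" "isCont g a" "f a = u" "g a = v"
  then have "isCont (\<lambda>x. (f x, g x)) a" "(f a, g a) \<in> \<Omega>" by (auto intro!: continuous_intros)
  then show ?thesis
    using eventually_in_open_isCont[of a "\<lambda>x. (f x, g x)" \<Omega>] by simp
qed

text \<open>Differentiating the identity that left translation by \<open>i u\<close> undoes left
  translation by \<open>u\<close>, at \<open>v = p\<close>. All identities hold only near
  \<open>p\<close>, where the products stay in the chart.\<close>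

lemma \<Lambda>_L: "u \<in> \<Omega>i \<Longrightarrow> \<Lambda> u (L u X) = X"
proof -
  assume u: "u \<in> \<Omega>i"
  have uD: "u \<in> D" using u \<Omega>i_D by blast
  have "((\<lambda>v. m (i u, m (u, v))) has_derivative (\<lambda>h. M (i u, m (u, p)) (0, L u h))) (at p)"
    using has_derivative_compose[OF der_L[OF uD], of "\<lambda>v. m (i u, v)"] der_m_right[of "i u" u] u uD by simp
  moreover have "eventually (\<lambda>v. m (i u, m (u, v)) = v) (nhds p)"
  proof -
    have "eventually (\<lambda>v. (u, v) \<in> \<Omega>) (nhds p)"
      by (rule eventually_\<Omega>[of u p]) (use uD in \<open>auto intro!: continuous_intros\<close>)
    moreover have "eventually (\<lambda>v. (i u, m (u, v)) \<in> \<Omega>) (nhds p)"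
      by (rule eventually_\<Omega>[of "i u" u])
        (use u uD has_derivative_continuous[OF der_L[OF uD]] in \<open>auto intro!: continuous_intros\<close>)
    ultimately show ?thesis
    proof eventually_elim
      case (elim v)
      then have v: "v \<in> D" by (simp add: \<Omega>_iff)
      have "m (i u, m (u, v)) = \<phi> (inv (\<psi> u) \<otimes> (\<psi> u \<otimes> \<psi> v))" using elim u by (simp add: m_eq[of "i u"])
      also have "\<dots> = v" using uD v by (simp flip: m_assoc)
      finally show ?case .
    qed
  qed
  ultimately have "((\<lambda>v. v) has_derivative (\<lambda>h. M (i u, m (u, p)) (0, L u h))) (at p)"
    by (rule has_derivative_eventually_eq)
  from has_derivative_unique[OF this has_derivative_ident] show ?thesis
    unfolding \<Lambda>_def using uD by (auto dest: fun_cong)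
qed

lemma L_\<Lambda>: "u \<in> \<Omega>i \<Longrightarrow> L u (\<Lambda> u Z) = Z"
  using linear_inverse_left[OF linear_\<Lambda> linear_L, of u u] \<Lambda>_L \<Omega>i_D by (auto simp: fun_eq_iff)

definition "K g v = \<phi> (g \<otimes> \<psi> v \<otimes> inv g)"

lemma K_eventually:
  assumes u: "u \<in> \<Omega>i"
  shows "eventually (\<lambda>v. v \<in> D \<and> \<psi> u \<otimes> \<psi> v \<otimes> inv (\<psi> u) \<in> U \<and> K (\<psi> u) v = m (m (u, v), i u)) (nhds p)"
proof -
  have uD: "u \<in> D" using u \<Omega>i_D by blast
  have "eventually (\<lambda>v. (u, v) \<in> \<Omega>) (nhds p)"
    by (rule eventually_\<Omega>[of u p]) (use uD in \<open>auto intro!: continuous_intros\<close>)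
  moreover have "eventually (\<lambda>v. (m (u, v), i u) \<in> \<Omega>) (nhds p)"
    by (rule eventually_\<Omega>[of u "i u"])
      (use u uD has_derivative_continuous[OF der_L[OF uD]] in \<open>auto intro!: continuous_intros\<close>)
  ultimately show ?thesis
    by eventually_elim (use u uD in \<open>auto simp: K_def \<Omega>_iff m_eq\<close>)
qed

lemma K_der:
  assumes u: "u \<in> \<Omega>i"
  shows "(K (\<psi> u) has_derivative Ad u) (at p)"
proof -
  have uD: "u \<in> D" using u \<Omega>i_D by blast
  have "((\<lambda>v. m (m (u, v), i u)) has_derivative (\<lambda>h. M (m (u, p), i u) (L u h, 0))) (at p)"
    using has_derivative_compose[OF der_L[OF uD], of "\<lambda>v. m (v, i u)"] der_m_left[of u "i u"] u uD by simp
  then have "((\<lambda>v. m (m (u, v), i u)) has_derivative Ad u) (at p)"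
    using uD by (simp add: Ad_def[abs_def])
  then show ?thesis
    by (rule has_derivative_eventually_eq) (use K_eventually[OF u] in \<open>auto elim: eventually_mono\<close>)
qed

text \<open>Conjugation by a product is the composite of conjugations, all of which fix the unit;
  the chain rule there gives the claim.\<close>

lemma Ad_mult:
  assumes u: "u \<in> \<Omega>i" and w: "w \<in> \<Omega>i" and uw: "(u, w) \<in> \<Omega>" "m (u, w) \<in> \<Omega>i"
  shows "Ad (m (u, w)) Y = Ad u (Ad w Y)"
proof -
  have D: "u \<in> D" "w \<in> D" using u w \<Omega>i_D by auto
  have Kp: "K g p = p" if "g \<in> carrier G" for g using that by (simp add: K_def) (simp add: p_def)
  have "((\<lambda>v. K (\<psi> u) (K (\<psi> w) v)) has_derivative (\<lambda>h. Ad u (Ad w h))) (at p)"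
    using has_derivative_compose[OF K_der[OF w], of "K (\<psi> u)"] K_der[OF u] D by (simp add: Kp)
  moreover have "eventually (\<lambda>v. K (\<psi> u) (K (\<psi> w) v) = K (\<psi> (m (u, w))) v) (nhds p)"
    using K_eventually[OF w]
  proof eventually_elim
    case (elim v)
    then have "\<psi> w \<otimes> \<psi> v \<otimes> inv (\<psi> w) \<in> U" by blast
    then have "\<psi> (K (\<psi> w) v) = \<psi> w \<otimes> \<psi> v \<otimes> inv (\<psi> w)" by (simp add: K_def)
    then have "K (\<psi> u) (K (\<psi> w) v) = \<phi> (\<psi> u \<otimes> (\<psi> w \<otimes> \<psi> v \<otimes> inv (\<psi> w)) \<otimes> inv (\<psi> u))"
      by (simp only: K_def[of "\<psi> u"])
    also have "\<dots> = K (\<psi> u \<otimes> \<psi> w) v"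
      using elim D by (simp add: K_def inv_mult_group m_assoc)
    also have "\<psi> u \<otimes> \<psi> w = \<psi> (m (u, w))" using uw(1) by simp
    finally show ?case .
  qed
  ultimately have "(K (\<psi> (m (u, w))) has_derivative (\<lambda>h. Ad u (Ad w h))) (at p)"
    by (rule has_derivative_eventually_eq)
  from has_derivative_unique[OF K_der[OF uw(2)] this] show ?thesis by (auto dest: fun_cong)
qed

lemma der_L_param:
  assumes "u \<in> D" and N: "\<And>k. ((\<lambda>w. M w k) has_derivative N k) (at (u, p))"
  shows "((\<lambda>u. L u Y) has_derivative (\<lambda>h. N (0, Y) (h, 0))) (at u)"
  unfolding L_def
  by (rule has_derivative_compose[of "\<lambda>u. (u, p)" "\<lambda>h. (h, 0)" u UNIV "\<lambda>w. M w (0, Y)" "N (0, Y)"])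
    (auto intro!: derivative_eq_intros simp: N)

lemma der_Ad_expansion:
  assumes u: "u \<in> \<Omega>i" and i': "(i has_derivative i') (at u)"
    and N: "\<And>k. ((\<lambda>w. M w k) has_derivative N k) (at (u, i u))"
    and l': "((\<lambda>u. L u Y) has_derivative l') (at u)"
  shows "((\<lambda>u. Ad u Y) has_derivative (\<lambda>h. N (L u Y, 0) (h, i' h) + M (u, i u) (l' h, 0))) (at u)"
proof -
  have lin: "linear (\<lambda>k. M (y, i y) (k, 0))" if "y \<in> \<Omega>i" for y
    using linear_compose[OF _ linear_M[of "(y, i y)"], of "\<lambda>k. (k, 0)"] that by (simp add: o_def linear_iff)
  have A: "((\<lambda>y. M (y, i y) (k, 0)) has_derivative (\<lambda>h. N (k, 0) (h, i' h))) (at u)" for k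
    by (rule has_derivative_compose[of "\<lambda>y. (y, i y)" "\<lambda>h. (h, i' h)" u UNIV "\<lambda>w. M w (k, 0)" "N (k, 0)"])
      (auto intro!: has_derivative_Pair i' simp: N)
  have "linear (\<lambda>k. N (k, 0) (h, i' h))" for h
    by (rule linear_derivative_in_parameter[OF opens(2) u lin A])
  then have "((\<lambda>y. M (y, i y) (L y Y, 0)) has_derivative (\<lambda>h. N (L u Y, 0) (h, i' h) + M (u, i u) (l' h, 0))) (at u within \<Omega>i)"
    using lin A l' by (intro has_derivative_apply_linear[OF _ u]) (auto intro: has_derivative_at_withinI)
  then show ?thesis by (simp add: at_within_open[OF u] Ad_def[abs_def])
qed

lemma Ad_differentiable: "u \<in> \<Omega>i \<Longrightarrow> \<exists>a'. ((\<lambda>u. Ad u Y) has_derivative a') (at u)"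
proof -
  assume u: "u \<in> \<Omega>i"
  obtain i' where i': "(i has_derivative i') (at u)" using i_diff[OF u] by (auto simp: differentiable_def)
  have N: "((\<lambda>w. M w k) has_derivative frechet_derivative (\<lambda>w. M w k) (at w)) (at w)" if "w \<in> \<Omega>" for w k
    using M_diff[OF that] by (simp add: frechet_derivative_works)
  show ?thesis
    using der_Ad_expansion[OF u i' N der_L_param[OF \<Omega>i_D[OF u] N]] u \<Omega>i_D[OF u] by auto
qed

abbreviation "br \<equiv> lie_bracket G (U, \<phi>)"

text \<open>
  With \<open>N\<close> the second derivative of \<open>m\<close> at the unit, both sides equal \<open>N (0, Y) (X, 0) - N (0, X) (Y, 0)\<close>.
\<close>

lemma der_Ad_p: "((\<lambda>u. Ad u Y) has_derivative (\<lambda>X. br X Y)) (at p)"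
proof -
  define N where "N k = frechet_derivative (\<lambda>w. M w k) (at (p, p))" for k
  have N: "((\<lambda>w. M w k) has_derivative N k) (at (p, p))" for k
    using M_diff[of "(p, p)" k] by (simp add: frechet_derivative_works N_def)
  have linN: "linear (N k)" for k using N has_derivative_linear by blast
  have sym: "N h k = N k h" for h k
    by (rule symmetric_second_derivative[OF opens(1) _ m_der N]) auto
  obtain i' where i': "(i has_derivative i') (at p)" using i_diff[of p] by (auto simp: differentiable_def)
  \<comment> \<open>Differentiates \<open>m (u, i u) = p\<close>, where the differential of
    \<open>m\<close> at the unit is addition.\<close>
  have i'_eq: "i' h = - h" for h
  proof -
    have "((\<lambda>u. m (u, i u)) has_derivative (\<lambda>h. M (p, i p) (h, i' h))) (at p)"
      by (rule has_derivative_compose[OF _ m_der, of "\<lambda>u. (u, i u)"]) (auto intro!: derivative_eq_intros i')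
    then have "((\<lambda>u. p) has_derivative (\<lambda>h. M (p, i p) (h, i' h))) (at p)"
      by (rule has_derivative_transform_within_open[OF _ opens(2)]) auto
    from has_derivative_unique[OF this has_derivative_const] have "M (p, p) (h, i' h) = 0" by (auto dest: fun_cong)
    moreover have "M (p, p) (h, i' h) = M (p, p) (h, 0) + M (p, p) (0, i' h)"
      using linear_add[OF linear_M[of "(p, p)"], of "(h, 0)" "(0, i' h)"] by simp
    moreover have "M (p, p) (0, i' h) = i' h" using L_p[of "i' h"] by (simp only: L_def)
    ultimately show ?thesis by (simp add: M_p_left eq_neg_iff_add_eq_0 add.commute)
  qed
  have lY: "((\<lambda>u. L u Y) has_derivative (\<lambda>h. N (0, Y) (h, 0))) (at p)" for Y
    by (rule der_L_param[OF p_D N])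
  \<comment> \<open>Differentiates \<open>M (u, p) (Y, 0) = Y\<close> in \<open>u\<close>; with the
    symmetry of \<open>N\<close> only mixed second derivatives remain.\<close>
  have zero: "N (Y, 0) (h, 0) = 0" for h
  proof -
    have "((\<lambda>u. M (u, p) (Y, 0)) has_derivative (\<lambda>h. N (Y, 0) (h, 0))) (at p)"
      by (rule has_derivative_compose[of "\<lambda>u. (u, p)" "\<lambda>h. (h, 0)" p UNIV "\<lambda>w. M w (Y, 0)" "N (Y, 0)"])
        (auto intro!: derivative_eq_intros simp: N)
    then have "((\<lambda>u. Y) has_derivative (\<lambda>h. N (Y, 0) (h, 0))) (at p)"
      by (rule has_derivative_transform_within_open[OF _ open_D p_D]) (auto simp: M_p_left)
    from has_derivative_unique[OF this has_derivative_const] show ?thesis by (auto dest: fun_cong)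
  qed
  have "((\<lambda>u. Ad u Y) has_derivative (\<lambda>h. N (Y, 0) (h, - h) + N (0, Y) (h, 0))) (at p)"
    using der_Ad_expansion[OF p_\<Omega>i i', of N Y, OF _ lY] N by (simp add: i'_eq M_p_left)
  moreover have "N (Y, 0) (h, - h) = - N (0, h) (Y, 0)" for h
  proof -
    have "N (Y, 0) (h, - h) = N (Y, 0) (h, 0) - N (Y, 0) (0, h)"
      using linear_diff[OF linN[of "(Y, 0)"], of "(h, 0)" "(0, h)"] by simp
    then show ?thesis by (simp add: zero sym[of "(Y, 0)" "(0, h)"])
  qed
  moreover have "br X Y = N (0, Y) (X, 0) - N (0, X) (Y, 0)" for X
  proof -
    have lif: "left_invariant_field G (U, \<phi>) X u = L u X" if "u \<in> D" for X u
      using frechet_derivative_at[OF der_L[OF that]] by (simp add: left_invariant_field_def m_eq p_def)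
    have fd: "frechet_derivative (left_invariant_field G (U, \<phi>) X) (at p) = (\<lambda>h. N (0, X) (h, 0))" for X
      by (rule frechet_derivative_at[symmetric])
        (rule has_derivative_transform_within_open[OF lY open_D p_D], simp add: lif)
    show ?thesis
      unfolding lie_bracket_def vector_field_commutator_def
      by (simp add: p_def[symmetric] fd lif)
  qed
  ultimately show ?thesis by simp
qed

text \<open>Only the derivative at the unit has to be computed. The identity
  \<open>Ad (m (u, w)) Y = Ad u (Ad w Y)\<close> transports it to \<open>u\<close>, and
  \<open>\<Lambda> u\<close> inverts the differential \<open>L u\<close> of the translation.\<close>

lemma der_Ad:
  assumes u: "u \<in> \<Omega>i"
  shows "((\<lambda>u. Ad u Y) has_derivative (\<lambda>Z. Ad u (br (\<Lambda> u Z) Y))) (at u)"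
proof -
  have uD: "u \<in> D" using u \<Omega>i_D by blast
  obtain a' where a': "((\<lambda>u. Ad u Y) has_derivative a') (at u)" using Ad_differentiable[OF u] by blast
  have "((\<lambda>w. Ad (m (u, w)) Y) has_derivative (\<lambda>X. a' (L u X))) (at p)"
    using has_derivative_compose[OF der_L[OF uD], of "\<lambda>u. Ad u Y" a'] a' uD by simp
  moreover have "eventually (\<lambda>w. Ad (m (u, w)) Y = Ad u (Ad w Y)) (nhds p)"
  proof -
    have "eventually (\<lambda>w. w \<in> \<Omega>i) (nhds p)" by (rule eventually_nhds_in_open) auto
    moreover have "eventually (\<lambda>w. (u, w) \<in> \<Omega>) (nhds p)"
      by (rule eventually_\<Omega>[of u p]) (use uD in \<open>auto intro!: continuous_intros\<close>)
    moreover have "eventually (\<lambda>w. m (u, w) \<in> \<Omega>i) (nhds p)"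
      by (rule eventually_in_open_isCont[OF has_derivative_continuous[OF der_L[OF uD]]]) (use u uD in auto)
    ultimately show ?thesis by eventually_elim (rule Ad_mult[OF u])
  qed
  ultimately have "((\<lambda>w. Ad u (Ad w Y)) has_derivative (\<lambda>X. a' (L u X))) (at p)"
    by (rule has_derivative_eventually_eq)
  moreover have "((\<lambda>w. Ad u (Ad w Y)) has_derivative (\<lambda>X. Ad u (br X Y))) (at p)"
    by (rule has_derivative_compose[OF der_Ad_p linear_imp_has_derivative[OF linear_Ad[OF u]]])
  ultimately have "a' (L u X) = Ad u (br X Y)" for X using has_derivative_unique by (metis (no_types, lifting))
  then have "a' = (\<lambda>Z. Ad u (br (\<Lambda> u Z) Y))" using L_\<Lambda>[OF u] by metis
  then show ?thesis using a' by simp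
qed

lemma continuous_on_\<Lambda>: "continuous_on \<Omega>i (\<lambda>u. \<Lambda> u Z)"
  unfolding \<Lambda>_def
proof (rule continuous_on_compose2[of \<Omega> "\<lambda>w. M w (0, Z)"])
  show "continuous_on \<Omega> (\<lambda>w. M w (0, Z))"
    by (rule differentiable_imp_continuous_on) (auto simp: differentiable_on_def intro: differentiable_at_withinI M_diff)
  have "continuous_on \<Omega>i i"
    by (rule differentiable_imp_continuous_on) (auto simp: differentiable_on_def intro: differentiable_at_withinI i_diff)
  then show "continuous_on \<Omega>i (\<lambda>u. (i u, u))" by (intro continuous_intros)
qed auto

end


section \<open>Integration of the adjoint representation\<close>

text \<open>Continuity at each fixed vector becomes a bound in operator norm, because only the
  finitely many basis vectors have to be controlled; each receives the share
  \<open>e / DIM('e)\<close>.\<close>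

lemma linear_family_near_identity:
  fixes F :: "'w::metric_space \<Rightarrow> 'e::euclidean_space \<Rightarrow> 'e"
  assumes S: "open S" "w0 \<in> S" and lin: "\<And>w. w \<in> S \<Longrightarrow> linear (F w)" and id: "\<And>Z. F w0 Z = Z"
    and cont: "\<And>Z. isCont (\<lambda>w. F w Z) w0" and e: "e > 0"
  shows "\<exists>d>0. \<forall>w. dist w w0 < d \<longrightarrow> w \<in> S \<and> (\<forall>Z. norm (F w Z - Z) \<le> e * norm Z)"
proof -
  define e' where "e' = e / real DIM('e)"
  have e': "e' > 0" using e by (simp add: e'_def)
  have "eventually (\<lambda>w. F w b \<in> ball b e') (nhds w0)" for b
    by (rule eventually_in_open_isCont[OF cont]) (use e' in \<open>auto simp: id\<close>)
  then have "eventually (\<lambda>w. \<forall>b\<in>Basis. F w b \<in> ball b e') (nhds w0)"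
    by (intro eventually_ball_finite) auto
  moreover have "eventually (\<lambda>w. w \<in> S) (nhds w0)" using S by (rule eventually_nhds_in_open)
  ultimately have "eventually (\<lambda>w. w \<in> S \<and> (\<forall>b\<in>Basis. F w b \<in> ball b e')) (nhds w0)" by eventually_elim auto
  then obtain d where d: "d > 0" "\<And>w. dist w w0 < d \<Longrightarrow> w \<in> S \<and> (\<forall>b\<in>Basis. F w b \<in> ball b e')"
    unfolding eventually_nhds_metric by auto
  have "norm (F w Z - Z) \<le> e * norm Z" if w: "dist w w0 < d" for w Z
  proof -
    have "linear (\<lambda>Z. F w Z - Z)" using lin d(2)[OF w] by (intro linear_compose_sub linear_ident) auto
    from linear_eq_sum_Basis[OF this, of Z]
    have "norm (F w Z - Z) = norm (\<Sum>b\<in>Basis. (Z \<bullet> b) *\<^sub>R (F w b - b))" by simp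
    also have "\<dots> \<le> (\<Sum>b\<in>(Basis::'e set). norm Z * e')"
    proof (rule sum_norm_le)
      fix b :: 'e assume b: "b \<in> Basis"
      have "norm (F w b - b) \<le> e'" using d(2)[OF w] b by (auto simp: dist_norm norm_minus_commute less_imp_le)
      then show "norm ((Z \<bullet> b) *\<^sub>R (F w b - b)) \<le> norm Z * e'"
        using Basis_le_norm[OF b, of Z] e' by (auto intro!: mult_mono)
    qed
    also have "\<dots> = e * norm Z" by (simp add: e'_def)
    finally show ?thesis .
  qed
  then show ?thesis using d by blast
qed

section \<open>Solving the equation of the adjoint representation by integrals\<close>

context lie_model begin

text \<open>The adjoint representation of the model group.\<close>

definition AdH :: "'e \<Rightarrow> 'e \<Rightarrow> 'e" where "AdH x Y = \<rho> x Y + br (x - q x) (q Y)"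

lemmas br_simps = linear_add[OF br_linear] linear_add[OF br_linear_left] linear_scale[OF br_linear]
  linear_scale[OF br_linear_left] linear_0[OF br_linear] linear_0[OF br_linear_left]
  linear_diff[OF br_linear] linear_diff[OF br_linear_left] linear_neg[OF br_linear] linear_neg[OF br_linear_left]

lemma AdH_mul: "AdH (x \<star> y) Y = AdH x (AdH y Y)"
proof -
  have "AdH (x \<star> y) Y = \<rho> x (\<rho> y Y) + br (x - q x + \<rho> x (y - q y)) (q Y)"
    by (simp add: AdH_def rho_mul) (simp add: mul_def algebra_simps)
  also have "br (x - q x + \<rho> x (y - q y)) (q Y) = br (x - q x) (q Y) + \<rho> x (br (y - q y) (q Y))"
    unfolding rho_br by (simp add: br_simps)
  finally show ?thesis by (simp add: AdH_def)
qed

text \<open>Agreement on \<open>ker q\<close> forces \<open>q x = q y\<close> by faithfulness.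
  Agreement on \<open>range q\<close> then makes \<open>x - y\<close> an element of
  \<open>ker q\<close> centralized by \<open>range q\<close>, hence zero.\<close>

lemma AdH_inj: assumes "\<And>Y. AdH x Y = AdH y Y" shows "x = y"
proof -
  have "\<rho> (x - y) v = v" if "q v = 0" for v
  proof -
    have "\<rho> x v = \<rho> y v" using assms[of v] that by (simp add: AdH_def br_simps)
    then have "\<rho> (- y) (\<rho> x v) = v" by simp
    then show ?thesis by (simp flip: rho_add)
  qed
  then have "q (x - y) = 0" by (rule faithful)
  then have qe: "q x = q y" by simp
  have "br (x - y) (q Y) = 0" for Y
    using assms[of "q Y"] qe by (simp add: AdH_def br_simps)
  then have "x - y = 0" using \<open>q (x - y) = 0\<close> centralizer by blast
  then show ?thesis by simp
qed

text \<open>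
  Along \<open>t \<mapsto> p + t z\<close> the operators \<open>A\<close> satisfy \<open>P' = P (ad \<omega>)\<close>.  As the two summands of the Lie
  algebra are abelian, this equation is solved by the integrals \<open>\<tau>\<close> and \<open>X\<close>.
\<close>

lemma path_integration:
  fixes A \<Lambda> :: "'e \<Rightarrow> 'e \<Rightarrow> 'e"
  assumes linA: "\<And>u. u \<in> ball p r \<Longrightarrow> linear (A u)" and Ap: "\<And>Y. A p Y = Y"
    and lin\<Lambda>: "\<And>u. u \<in> ball p r \<Longrightarrow> linear (\<Lambda> u)"
    and cont\<Lambda>: "\<And>Z. continuous_on (ball p r) (\<lambda>u. \<Lambda> u Z)"
    and derA: "\<And>u Y. u \<in> ball p r \<Longrightarrow> ((\<lambda>u. A u Y) has_derivative (\<lambda>Z. A u (br (\<Lambda> u Z) Y))) (at u)"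
    and z: "norm z < r"
  defines "\<omega> \<equiv> \<lambda>t. \<Lambda> (p + t *\<^sub>R z) z"
  defines "\<tau> \<equiv> \<lambda>t. integral {0..t} (\<lambda>s. q (\<omega> s))"
  defines "X \<equiv> integral {0..1} (\<lambda>s. \<rho> (\<tau> s) (\<omega> s))"
  shows "continuous_on {0..1} (\<lambda>s. \<rho> (\<tau> s) (\<omega> s))" and "A (p + z) Y = AdH X Y"
proof -
  define c where "c t = p + t *\<^sub>R z" for t :: real
  have c: "c t \<in> ball p r" if "t \<in> {0..1}" for t
  proof -
    have "norm (t *\<^sub>R z) \<le> norm z" using that by (auto intro!: mult_left_le_one_le)
    then show ?thesis using z by (simp add: c_def dist_norm)
  qed
  have c_cont: "continuous_on S c" for S unfolding c_def by (intro continuous_intros)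
  have "c ` {0..1} \<subseteq> ball p r" using c by blast
  from continuous_on_compose2[OF cont\<Lambda>[of z] c_cont this]
  have \<omega>_cont: "continuous_on {0..1} \<omega>" by (simp only: \<omega>_def c_def)
  have q_cont: "continuous_on S (\<lambda>s. q (f s))" if "continuous_on S f" for S and f :: "real \<Rightarrow> 'e"
    using linear_continuous_on_compose[OF that q_linear] .
  have \<tau>_der: "(\<tau> has_vector_derivative q (\<omega> t)) (at t within {0..1})" if "t \<in> {0..1}" for t
    unfolding \<tau>_def by (rule integral_has_vector_derivative[OF q_cont[OF \<omega>_cont] that])
  then have \<tau>_cont: "continuous_on {0..1} \<tau>"
    by (meson continuous_on_eq_continuous_within has_vector_derivative_continuous)
  define g where "g s = \<rho> (\<tau> s) (\<omega> s)" for s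
  show g_cont: "continuous_on {0..1} (\<lambda>s. \<rho> (\<tau> s) (\<omega> s))"
    by (intro continuous_on_rho \<tau>_cont \<omega>_cont)
  define x where "x t = integral {0..t} g" for t
  have x_der: "(x has_vector_derivative g t) (at t within {0..1})" if "t \<in> {0..1}" for t
    unfolding x_def by (rule integral_has_vector_derivative[OF _ that]) (use g_cont in \<open>simp add: g_def\<close>)
  have qx: "q (x t) = \<tau> t" if "t \<in> {0..1}" for t
  proof -
    have "g integrable_on {0..t}"
      using that g_cont unfolding g_def by (intro integrable_continuous_real continuous_on_subset[OF g_cont]) auto
    from integral_linear[OF this, of q] show ?thesis
      using q_linear by (simp add: x_def \<tau>_def o_def g_def linear_conv_bounded_linear)
  qed
  have P_der: "((\<lambda>t. A (c t) (y t)) has_vector_derivative A (c t) (br (\<omega> t) (y t) + y')) (at t within {0..1})"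
    if t: "t \<in> {0..1}" and y: "(y has_vector_derivative y') (at t within {0..1})" for y y' t
  proof -
    have lA: "linear (A (c t))" by (rule linA[OF c[OF t]])
    have "(c has_derivative (\<lambda>h. h *\<^sub>R z)) (at t within {0..1})"
      unfolding c_def by (auto intro!: derivative_eq_intros)
    from has_derivative_compose[OF this derA[OF c[OF t]]]
    have d: "((\<lambda>t. A (c t) k) has_derivative (\<lambda>h. h *\<^sub>R A (c t) (br (\<omega> t) k))) (at t within {0..1})" for k
      using linear_scale[OF lin\<Lambda>[OF c[OF t]], of _ z] lA
      by (simp add: \<omega>_def c_def br_simps linear_scale)
    have "((\<lambda>t. A (c t) (y t)) has_derivative (\<lambda>h. h *\<^sub>R A (c t) (br (\<omega> t) (y t)) + A (c t) (h *\<^sub>R y'))) (at t within {0..1})"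
    proof (rule has_derivative_apply_linear[OF linA[OF c] t d _ y[unfolded has_vector_derivative_def]])
      show "linear (\<lambda>k. h *\<^sub>R A (c t) (br (\<omega> t) k))" for h
        by (rule linearI) (simp_all add: br_simps linear_add[OF lA] linear_scale[OF lA] scaleR_add_right)
    qed
    then show ?thesis
      by (simp add: has_vector_derivative_def linear_add[OF lA] linear_scale[OF lA] scaleR_add_right)
  qed
  have const: "f t = f 0" if "\<And>t. t \<in> {0..1} \<Longrightarrow> (f has_vector_derivative 0) (at t within {0..1})" "t \<in> {0..1}"
    for f :: "real \<Rightarrow> 'e" and t
    using has_vector_derivative_zero_constant[of "{0..1}" f] that by (metis atLeastAtMost_iff convex_real_interval(5) order_refl zero_le_one)
  have c0: "c 0 = p" and \<tau>0: "\<tau> 0 = 0" and x0: "x 0 = 0" by (simp_all add: c_def \<tau>_def x_def)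
  \<comment> \<open>On \<open>ker q\<close> only the part \<open>q (\<omega> t)\<close> acts, and
    its propagator is \<open>\<rho> (\<tau> t)\<close>. With \<open>v\<close> frozen at the final
    time, the derivative of \<open>A (c t) (\<rho> (- \<tau> t) v)\<close> is \<open>A (c t)\<close>
    of a bracket of two kernel elements, hence 0.\<close>
  have ker: "A (c t) Y = \<rho> (\<tau> t) Y" if t: "t \<in> {0..1}" and Y: "q Y = 0" for t Y
  proof -
    define v where "v = \<rho> (\<tau> t) Y"
    have v: "q v = 0" using Y by (simp add: v_def)
    have "A (c t) (\<rho> (- \<tau> t) v) = A (c 0) (\<rho> (- \<tau> 0) v)"
    proof (rule const[OF _ t])
      fix t :: real assume t: "t \<in> {0..1}"
      have "((\<lambda>s. - \<tau> s) has_vector_derivative - q (\<omega> t)) (at t within {0..1})"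
        by (intro has_vector_derivative_minus \<tau>_der t)
      from P_der[OF t rho_der[OF this]]
      have "((\<lambda>t. A (c t) (\<rho> (- \<tau> t) v)) has_vector_derivative
          A (c t) (br (\<omega> t) (\<rho> (- \<tau> t) v) + br (q (- q (\<omega> t))) (\<rho> (- \<tau> t) v))) (at t within {0..1})" .
      moreover have "br (\<omega> t) (\<rho> (- \<tau> t) v) + br (q (- q (\<omega> t))) (\<rho> (- \<tau> t) v) = br (\<omega> t - q (\<omega> t)) (\<rho> (- \<tau> t) v)"
        by (simp add: br_simps)
      moreover have "\<dots> = 0" by (rule br_ker_ker) (simp_all add: v)
      ultimately show "((\<lambda>t. A (c t) (\<rho> (- \<tau> t) v)) has_vector_derivative 0) (at t within {0..1})"
        by (simp add: linear_0[OF linA[OF c[OF t]]])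
    qed
    then show ?thesis by (simp add: c0 \<tau>0 Ap v_def)
  qed
  \<comment> \<open>On \<open>range q\<close> the derivative of \<open>A (c t) (q Y)\<close> is
    \<open>A (c t)\<close> of a bracket in \<open>ker q\<close>, where \<open>A (c t)\<close> is
    already known, so plain integration finishes.\<close>
  have "A (c 1) (q Y) - br (x 1 - q (x 1)) (q Y) = A (c 0) (q Y) - br (x 0 - q (x 0)) (q Y)"
  proof (rule const)
    fix t :: real assume t: "t \<in> {0..1}"
    have b: "bounded_linear (\<lambda>x. br (x - q x) (q Y))"
    proof -
      have "linear (\<lambda>x. br (x - q x) (q Y))" by (rule linearI) (simp_all add: br_simps algebra_simps)
      then show ?thesis by (simp add: linear_conv_bounded_linear)
    qed
    have "((\<lambda>t. A (c t) (q Y)) has_vector_derivative A (c t) (br (\<omega> t) (q Y) + 0)) (at t within {0..1})"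
      by (rule P_der[OF t]) simp
    moreover have "((\<lambda>t. br (x t - q (x t)) (q Y)) has_vector_derivative br (g t - q (g t)) (q Y)) (at t within {0..1})"
      by (rule bounded_linear.has_vector_derivative[OF b x_der[OF t]])
    ultimately have "((\<lambda>t. A (c t) (q Y) - br (x t - q (x t)) (q Y)) has_vector_derivative
        A (c t) (br (\<omega> t) (q Y) + 0) - br (g t - q (g t)) (q Y)) (at t within {0..1})"
      by (rule has_vector_derivative_diff)
    moreover have "A (c t) (br (\<omega> t) (q Y) + 0) = br (g t - q (g t)) (q Y)"
    proof -
      have "A (c t) (br (\<omega> t) (q Y)) = \<rho> (\<tau> t) (br (\<omega> t) (q Y))" by (rule ker[OF t]) simp
      also have "\<dots> = \<rho> (\<tau> t) (br (\<omega> t - q (\<omega> t)) (q Y))" by (simp add: br_simps)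
      also have "\<dots> = br (\<rho> (\<tau> t) (\<omega> t - q (\<omega> t))) (q Y)" by (rule rho_br)
      also have "\<dots> = br (g t - q (g t)) (q Y)" by (simp add: g_def)
      finally show ?thesis by simp
    qed
    ultimately show "((\<lambda>t. A (c t) (q Y) - br (x t - q (x t)) (q Y)) has_vector_derivative 0) (at t within {0..1})" by simp
  qed simp
  then have "A (c 1) (q Y) = q Y + br (x 1 - q (x 1)) (q Y)" by (simp add: c0 x0 Ap br_simps algebra_simps)
  moreover have "A (c 1) (Y - q Y) = \<rho> (\<tau> 1) (Y - q Y)" by (rule ker) simp_all
  moreover have "A (c 1) Y = A (c 1) (Y - q Y) + A (c 1) (q Y)"
    using linear_add[OF linA[OF c], of 1 "Y - q Y" "q Y"] by simp
  moreover have "\<rho> (\<tau> 1) = \<rho> (x 1)" using qx[of 1] by (metis atLeastAtMost_iff order_refl rho_q zero_le_one)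
  ultimately have "A (c 1) Y = \<rho> (x 1) Y + br (x 1 - q (x 1)) (q Y)" by simp
  moreover have "x 1 = X" by (simp add: x_def X_def g_def[abs_def])
  ultimately show "A (p + z) Y = AdH X Y" by (simp add: AdH_def c_def)
qed

text \<open>\<open>\<Phi>\<close> collects the integrals along the segments issuing from
  \<open>p\<close>. Near \<open>p\<close> the integrand is a nearly identical operator applied to
  \<open>z\<close>, so the integral is \<open>z\<close> up to \<open>o(z)\<close>; this gives the
  derivative at \<open>p\<close>, and only there.\<close>

lemma local_homomorphism:
  fixes A \<Lambda> :: "'e \<Rightarrow> 'e \<Rightarrow> 'e"
  assumes r: "r > 0" and linA: "\<And>u. u \<in> ball p r \<Longrightarrow> linear (A u)" and Ap: "\<And>Y. A p Y = Y"
    and lin\<Lambda>: "\<And>u. u \<in> ball p r \<Longrightarrow> linear (\<Lambda> u)" and \<Lambda>p: "\<And>Z. \<Lambda> p Z = Z"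
    and cont\<Lambda>: "\<And>Z. continuous_on (ball p r) (\<lambda>u. \<Lambda> u Z)"
    and derA: "\<And>u Y. u \<in> ball p r \<Longrightarrow> ((\<lambda>u. A u Y) has_derivative (\<lambda>Z. A u (br (\<Lambda> u Z) Y))) (at u)"
  shows "\<exists>\<Phi>. \<Phi> p = 0 \<and> (\<Phi> has_derivative (\<lambda>h. h)) (at p) \<and> (\<forall>u\<in>ball p r. \<forall>Y. A u Y = AdH (\<Phi> u) Y)"
proof -
  define \<omega> where "\<omega> z t = \<Lambda> (p + t *\<^sub>R z) z" for z and t :: real
  define \<tau> where "\<tau> z t = integral {0..t} (\<lambda>s. q (\<omega> z s))" for z t
  define g where "g z s = \<rho> (\<tau> z s) (\<omega> z s)" for z s
  define X where "X z = integral {0..1} (g z)" for z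
  have g_cont: "continuous_on {0..1} (g z)" and AX: "A (p + z) Y = AdH (X z) Y" if z: "norm z < r" for z Y
    using path_integration[of p r A \<Lambda> z, OF linA Ap lin\<Lambda> cont\<Lambda> derA z]
    by (simp_all add: \<omega>_def[abs_def] \<tau>_def[abs_def] g_def[abs_def] X_def[abs_def])
  have \<omega>_cont: "continuous_on {0..1} (\<omega> z)" if z: "norm z < r" for z
  proof -
    have "(\<lambda>t. p + t *\<^sub>R z) ` {0..1} \<subseteq> ball p r"
    proof clarify
      fix t :: real assume "t \<in> {0..1}"
      then have "norm (t *\<^sub>R z) \<le> norm z" by (auto intro!: mult_left_le_one_le)
      then show "p + t *\<^sub>R z \<in> ball p r" using z by (simp add: dist_norm)
    qed
    then show ?thesis unfolding \<omega>_def
      by (intro continuous_on_compose2[OF cont\<Lambda>[of z], of _ "\<lambda>t. p + t *\<^sub>R z"] continuous_intros) auto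
  qed
  obtain K where K: "K > 0" "\<And>x. norm (q x) \<le> norm x * K"
    using q_linear bounded_linear.pos_bounded linear_conv_bounded_linear by blast
  have est: "\<exists>d>0. \<forall>z. norm z < d \<longrightarrow> norm (X z - z) \<le> e * norm z" if e: "e > 0" for e
  proof -
    let ?S = "ball p r \<times> (UNIV :: 'e set)"
    have S: "open ?S" "(p, 0) \<in> ?S" using r by (auto intro: open_Times)
    have c\<Lambda>: "continuous_on ?S (\<lambda>w. \<Lambda> (fst w) Z)" for Z
      by (rule continuous_on_compose2[OF cont\<Lambda>]) (auto intro!: continuous_intros)
    obtain d1 where d1: "d1 > 0" "\<And>w. dist w (p, 0) < d1 \<Longrightarrow> w \<in> ?S \<and> (\<forall>Z. norm (\<rho> (snd w) (\<Lambda> (fst w) Z) - Z) \<le> e * norm Z)"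
    proof -
      have "isCont (\<lambda>w. \<rho> (snd w) (\<Lambda> (fst w) Z)) (p, 0)" for Z
        using continuous_on_rho[OF continuous_on_snd[OF continuous_on_id] c\<Lambda>[of Z]] S
        by (simp add: continuous_on_eq_continuous_at)
      moreover have "linear (\<lambda>Z. \<rho> (snd w) (\<Lambda> (fst w) Z))" if "w \<in> ?S" for w
        using linear_compose[OF lin\<Lambda> rho_linear] that by (auto simp: o_def)
      ultimately have "\<exists>d>0. \<forall>w. dist w (p, 0) < d \<longrightarrow>
          w \<in> ?S \<and> (\<forall>Z. norm (\<rho> (snd w) (\<Lambda> (fst w) Z) - Z) \<le> e * norm Z)"
        by (intro linear_family_near_identity[OF S, of "\<lambda>w Z. \<rho> (snd w) (\<Lambda> (fst w) Z)" e]) (auto simp: \<Lambda>p e)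
      then show ?thesis using that by blast
    qed
    obtain d2 where d2: "d2 > 0" "\<And>w. dist w p < d2 \<Longrightarrow> w \<in> ball p r \<and> (\<forall>Z. norm (\<Lambda> w Z - Z) \<le> 1 * norm Z)"
    proof -
      have "isCont (\<lambda>w. \<Lambda> w Z) p" for Z using cont\<Lambda>[of Z] r by (simp add: continuous_on_eq_continuous_at)
      then have "\<exists>d>0. \<forall>w. dist w p < d \<longrightarrow> w \<in> ball p r \<and> (\<forall>Z. norm (\<Lambda> w Z - Z) \<le> 1 * norm Z)"
        by (intro linear_family_near_identity[of "ball p r" p \<Lambda> 1]) (use lin\<Lambda> \<Lambda>p r in auto)
      then show ?thesis using that by blast
    qed
    \<comment> \<open>Since \<open>norm (\<omega> z t) \<le> 2 * norm z\<close> and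
      \<open>norm (\<tau> z t) \<le> 2 * norm z * K\<close>, this keeps the point
      \<open>(p + t *\<^sub>R z, \<tau> z t)\<close> within \<open>d1\<close> of
      \<open>(p, 0)\<close>.\<close>
    define d where "d = min (min d1 d2) r / (2 * (1 + 2 * K))"
    have d: "d > 0" using d1 d2 r K by (simp add: d_def)
    have "norm (X z - z) \<le> e * norm z" if z: "norm z < d" for z
    proof -
      have "norm z * (2 * (1 + 2 * K)) < min (min d1 d2) r" using z K by (simp add: d_def pos_less_divide_eq)
      then have "2 * norm z + 4 * (norm z * K) < d1" "2 * norm z + 4 * (norm z * K) < d2" "2 * norm z + 4 * (norm z * K) < r"
        by (auto simp: algebra_simps)
      moreover have nn: "0 \<le> norm z" "0 \<le> norm z * K" using K by auto
      ultimately have z2: "norm z + 2 * (norm z * K) \<le> d1 / 2" and z3: "norm z < d2" and z4: "norm z < r"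
        using d2(1) r by (linarith, linarith, linarith)
      have tz: "norm (t *\<^sub>R z) \<le> norm z" if "t \<in> {0..1}" for t
        using that by (auto intro!: mult_left_le_one_le)
      have \<omega>: "norm (\<omega> z t) \<le> 2 * norm z" if t: "t \<in> {0..1}" for t
      proof -
        have "norm (\<omega> z t - z) \<le> norm z"
          using d2(2)[of "p + t *\<^sub>R z"] tz[OF t] z3 by (simp add: \<omega>_def dist_norm)
        then show ?thesis using norm_triangle_ineq[of "\<omega> z t - z" z] by simp
      qed
      have \<tau>: "norm (\<tau> z t) \<le> 2 * norm z * K" if t: "t \<in> {0..1}" for t
      proof -
        have "norm (\<tau> z t) \<le> (2 * norm z * K) * (t - 0)"
          unfolding \<tau>_def
        proof (rule integral_bound)
          have "continuous_on {0..t} (\<omega> z)" by (rule continuous_on_subset[OF \<omega>_cont[OF z4]]) (use t in auto)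
          then show "continuous_on {0..t} (\<lambda>s. q (\<omega> z s))" by (rule linear_continuous_on_compose[OF _ q_linear])
          fix s assume "s \<in> {0..t}"
          then have "s \<in> {0..1}" using t by auto
          from \<omega>[OF this] show "norm (q (\<omega> z s)) \<le> 2 * norm z * K"
            using K(2)[of "\<omega> z s"] K(1) by (meson mult_right_mono less_imp_le order_trans)
        qed (use t in auto)
        also have "\<dots> \<le> 2 * norm z * K" using t K by (intro mult_right_le_one_le) auto
        finally show ?thesis .
      qed
      have gz: "norm (g z t - z) \<le> e * norm z" if t: "t \<in> {0..1}" for t
      proof -
        have "dist (p + t *\<^sub>R z, \<tau> z t) (p, 0) \<le> norm (t *\<^sub>R z) + norm (\<tau> z t)"
          unfolding dist_Pair_Pair by (rule order_trans[OF sqrt_sum_squares_le_sum]) (auto simp: dist_norm)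
        also have "\<dots> < d1" using tz[OF t] \<tau>[OF t] z2 d1(1) by (simp add: mult.assoc)
        finally show ?thesis using d1(2)[of "(p + t *\<^sub>R z, \<tau> z t)"] by (simp add: g_def \<omega>_def)
      qed
      have "X z - z = integral {0..1} (\<lambda>t. g z t - z)"
        using integral_diff[OF integrable_continuous_real[OF g_cont[OF z4]]
            integrable_continuous_real[OF continuous_on_const], of z] by (simp add: X_def)
      also have "norm \<dots> \<le> e * norm z * (1 - 0)"
        by (rule integral_bound) (use gz g_cont[OF z4] in \<open>auto intro!: continuous_intros\<close>)
      finally show ?thesis by simp
    qed
    then show ?thesis using d by blast
  qed
  define \<Phi> where "\<Phi> u = X (u - p)" for u
  have "g 0 = (\<lambda>t. 0)" using linear_0[OF lin\<Lambda>[of p]] r by (simp add: g_def[abs_def] \<omega>_def)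
  then have "\<Phi> p = 0" by (simp add: \<Phi>_def X_def)
  moreover have "(\<Phi> has_derivative (\<lambda>h. h)) (at p)"
    unfolding has_derivative_at_alt
  proof (intro conjI allI impI)
    show "bounded_linear (\<lambda>h. h)" by (rule bounded_linear_ident)
    fix e :: real assume "e > 0"
    from est[OF this] show "\<exists>d>0. \<forall>y. norm (y - p) < d \<longrightarrow> norm (\<Phi> y - \<Phi> p - (y - p)) \<le> e * norm (y - p)"
      unfolding \<open>\<Phi> p = 0\<close> by (auto simp: \<Phi>_def)
  qed
  moreover have "A u Y = AdH (\<Phi> u) Y" if "u \<in> ball p r" for u Y
    using AX[of "u - p" Y] that by (simp add: \<Phi>_def dist_norm norm_minus_commute)
  ultimately show ?thesis by blast
qed

end


section \<open>The isomorphism with the model group\<close>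

lemma eventually_nhds_Pair:
  fixes a :: "'a::metric_space" and b :: "'b::metric_space"
  assumes "eventually P (nhds (a, b))"
  shows "\<exists>d>0. \<forall>u w. dist u a < d \<longrightarrow> dist w b < d \<longrightarrow> P (u, w)"
proof -
  obtain d where d: "d > 0" "\<And>z. dist z (a, b) < d \<Longrightarrow> P z"
    using assms unfolding eventually_nhds_metric by auto
  have "P (u, w)" if "dist u a < d / 2" "dist w b < d / 2" for u w
  proof (rule d(2))
    have "dist (u, w) (a, b) \<le> dist u a + dist w b"
      unfolding dist_Pair_Pair by (rule sqrt_sum_squares_le_sum) auto
    also have "\<dots> < d" using that by simp
    finally show "dist (u, w) (a, b) < d" .
  qed
  then show ?thesis using d(1) by (intro exI[of _ "d / 2"]) auto
qed

text \<open>The derivative of \<open>\<Phi>\<close> is available at \<open>p\<close> alone, too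
  little for the inverse function theorem. Instead the homomorphism property transports injectivity
  and continuity from \<open>p\<close> to nearby points, and invariance of domain makes
  \<open>\<Phi>\<close> open. The required \<open>s\<close> is its local inverse followed by
  \<open>\<psi>\<close>.\<close>

lemma (in lie_chart) ex_local_inverse:
  assumes model: "lie_model q \<rho> br"
    and T_open: "\<forall>W. open W \<longrightarrow> W \<subseteq> D \<longrightarrow> openin T (\<psi> ` W)"
    and T_cont: "\<forall>V. openin T V \<longrightarrow> open {u \<in> D. \<psi> u \<in> V}"
  shows "\<exists>s \<epsilon>. \<epsilon> > 0 \<and> (\<forall>x\<in>ball 0 \<epsilon>. s x \<in> carrier G) \<and> inj_on s (ball 0 \<epsilon>) \<and>
    (\<forall>x\<in>ball 0 \<epsilon>. \<forall>y\<in>ball 0 \<epsilon>. x + \<rho> x y \<in> ball 0 \<epsilon> \<longrightarrow> s (x + \<rho> x y) = s x \<otimes> s y) \<and>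
    (\<forall>W. open W \<longrightarrow> W \<subseteq> ball 0 \<epsilon> \<longrightarrow> openin T (s ` W)) \<and>
    (\<forall>V. openin T V \<longrightarrow> open {x \<in> ball 0 \<epsilon>. s x \<in> V})"
proof -
  interpret lm: lie_model q \<rho> br by (rule model)
  obtain r where r: "r > 0" "ball p r \<subseteq> \<Omega>i" using openE[OF opens(2) p_\<Omega>i] by blast
  obtain \<Phi> where \<Phi>p: "\<Phi> p = 0" and \<Phi>_der: "(\<Phi> has_derivative (\<lambda>h. h)) (at p)"
    and Ad\<Phi>: "\<And>u Y. u \<in> ball p r \<Longrightarrow> Ad u Y = lm.AdH (\<Phi> u) Y"
    using lm.local_homomorphism[OF r(1), of p Ad \<Lambda>] r(2) linear_Ad linear_\<Lambda> der_Ad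
      continuous_on_subset[OF continuous_on_\<Lambda> r(2)] by (auto simp: subset_iff)
  have hom: "\<Phi> (m (u, w)) = lm.mul (\<Phi> u) (\<Phi> w)"
    if "u \<in> ball p r" "w \<in> ball p r" "(u, w) \<in> \<Omega>" "m (u, w) \<in> ball p r" for u w
  proof (rule lm.AdH_inj)
    fix Y
    show "lm.AdH (\<Phi> (m (u, w))) Y = lm.AdH (lm.mul (\<Phi> u) (\<Phi> w)) Y"
      using Ad_mult[OF subsetD[OF r(2) that(1)] subsetD[OF r(2) that(2)] that(3) subsetD[OF r(2) that(4)]]
      by (simp only: lm.AdH_mul Ad\<Phi>[OF that(1)] Ad\<Phi>[OF that(2)] Ad\<Phi>[OF that(4)])
  qed
  obtain d0 where d0: "d0 > 0" "\<And>y. norm (y - p) < d0 \<Longrightarrow> norm (\<Phi> y - \<Phi> p - (y - p)) \<le> (1/2) * norm (y - p)"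
    using \<Phi>_der unfolding has_derivative_at_alt by (metis half_gt_zero zero_less_one)
  define r0 where "r0 = min r d0"
  have r0: "r0 > 0" "ball p r0 \<subseteq> ball p r" using r d0 by (auto simp: r0_def)
  \<comment> \<open>The derivative is the identity, so \<open>\<Phi> y\<close> differs from
    \<open>y - p\<close> by at most half its norm and cannot vanish elsewhere.\<close>
  have \<Phi>0: "y = p" if "y \<in> ball p r0" "\<Phi> y = 0" for y
  proof -
    have "norm (y - p) < d0" using that by (simp add: r0_def dist_norm norm_minus_commute)
    from d0(2)[OF this] show ?thesis using that \<Phi>p by (simp add: norm_minus_commute)
  qed
  have isCont_i: "isCont i p" using i_diff[OF p_\<Omega>i] differentiable_imp_continuous_within by blast
  have isCont_m_comp: "isCont (\<lambda>z. m (f z, snd z)) (p, p)" if "isCont f (p, p)" "f (p, p) = p" for f :: "'e \<times> 'e \<Rightarrow> 'e"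
  proof (rule isCont_o2[where f = "\<lambda>z. (f z, snd z)" and g = m])
    show "isCont (\<lambda>z. (f z, snd z)) (p, p)" by (intro continuous_intros that)
    show "isCont m (f (p, p), snd (p, p))" using isCont_m[of "(p, p)"] that by simp
  qed
  have near: "\<exists>d>0. \<forall>u w. dist u p < d \<longrightarrow> dist w p < d \<longrightarrow> (f (u, w), w) \<in> \<Omega> \<and> m (f (u, w), w) \<in> ball p R"
    if f: "isCont f (p, p)" "f (p, p) = p" and R: "R > 0" for f :: "'e \<times> 'e \<Rightarrow> 'e" and R
  proof (rule eventually_nhds_Pair[of "\<lambda>z. (f z, snd z) \<in> \<Omega> \<and> m (f z, snd z) \<in> ball p R" p p, simplified fst_conv snd_conv])
    have "eventually (\<lambda>z. (f z, snd z) \<in> \<Omega>) (nhds (p, p))"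
      by (rule eventually_\<Omega>[of p p]) (use f in \<open>auto intro!: continuous_intros\<close>)
    moreover have "eventually (\<lambda>z. m (f z, snd z) \<in> ball p R) (nhds (p, p))"
      by (rule eventually_in_open_isCont[OF isCont_m_comp[OF f]]) (use f R in auto)
    ultimately show "eventually (\<lambda>z. (f z, snd z) \<in> \<Omega> \<and> m (f z, snd z) \<in> ball p R) (nhds (p, p))"
      by eventually_elim simp
  qed
  have "isCont (\<lambda>z. i (fst z)) (p, p)"
    by (rule isCont_o2[where f = fst and g = i]) (use isCont_i in \<open>auto intro!: continuous_intros\<close>)
  from near[OF this _ r0(1)] obtain d1 where d1: "d1 > 0"
    "\<And>u w. dist u p < d1 \<Longrightarrow> dist w p < d1 \<Longrightarrow> (i u, w) \<in> \<Omega> \<and> m (i u, w) \<in> ball p r0" by auto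
  \<comment> \<open>Small enough that quotients \<open>m (i u, w)\<close> of two points stay in the
    ball where \<open>\<Phi>\<close> has no further zero.\<close>
  define r1 where "r1 = min r0 d1"
  define B1 where "B1 = ball p r1"
  have r1: "r1 > 0" "B1 \<subseteq> ball p r0" "open B1" "p \<in> B1" using r0 d1 by (auto simp: r1_def B1_def)
  have B1_i: "B1 \<subseteq> \<Omega>i" "B1 \<subseteq> D" "B1 \<subseteq> ball p r" using r1 r0 r \<Omega>i_D by blast+
  have div: "(i u, w) \<in> \<Omega>" "m (i u, w) \<in> ball p r0" "\<Phi> w = lm.mul (\<Phi> u) (\<Phi> (m (i u, w)))" "m (u, m (i u, w)) = w"
    if uw: "u \<in> B1" "w \<in> B1" for u w
  proof -
    have u: "u \<in> \<Omega>i" "u \<in> D" "w \<in> D" using uw B1_i by auto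
    show iuw: "(i u, w) \<in> \<Omega>" and y: "m (i u, w) \<in> ball p r0"
      using d1(2)[of u w] uw by (auto simp: B1_def r1_def dist_commute)
    have e: "\<psi> u \<otimes> \<psi> (m (i u, w)) = \<psi> w"
      using iuw u by (simp flip: m_assoc)
    have "m (i u, w) \<in> D" using iuw by simp
    then have \<Omega>: "(u, m (i u, w)) \<in> \<Omega>" using e u by (simp add: \<Omega>_iff)
    show w: "m (u, m (i u, w)) = w" using e u by (simp add: m_eq[of u])
    show "\<Phi> w = lm.mul (\<Phi> u) (\<Phi> (m (i u, w)))"
      using hom[OF _ _ \<Omega>] uw y w r0(2) B1_i by (auto simp: subset_iff)
  qed
  have inj\<Phi>: "inj_on \<Phi> B1"
  proof (rule inj_onI)
    fix u w assume uw: "u \<in> B1" "w \<in> B1" "\<Phi> u = \<Phi> w"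
    have "lm.mul (lm.iv (\<Phi> u)) (\<Phi> w) = \<Phi> (m (i u, w))"
      by (subst div(3)[OF uw(1,2)]) simp
    then have "\<Phi> (m (i u, w)) = 0" using uw(3) by simp
    then have "m (i u, w) = p" using \<Phi>0 div(2)[OF uw(1,2)] by blast
    then show "u = w" using div(4)[OF uw(1,2)] uw(1) B1_i by (auto simp: subset_iff)
  qed
  have cont\<Phi>: "continuous_on B1 \<Phi>"
    unfolding continuous_on_eq_continuous_at[OF r1(3)]
  proof
    fix u assume u: "u \<in> B1"
    then have u': "u \<in> \<Omega>i" using B1_i by blast
    have "isCont (\<lambda>w. m (i u, w)) u"
      using has_derivative_continuous[OF der_m_right[of "i u" u]] u' by simp
    moreover have "isCont \<Phi> (m (i u, u))" using has_derivative_continuous[OF \<Phi>_der] u' by simp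
    ultimately have "isCont (\<lambda>w. \<Phi> (m (i u, w))) u" by (rule isCont_o2)
    moreover have "isCont (lm.mul (\<Phi> u)) x" for x
    proof -
      have "continuous_on UNIV (lm.mul (\<Phi> u))" by (intro lm.continuous_on_mul continuous_on_const continuous_on_id)
      then show ?thesis by (simp add: continuous_on_eq_continuous_at)
    qed
    ultimately have "isCont (\<lambda>w. lm.mul (\<Phi> u) (\<Phi> (m (i u, w)))) u" by (rule isCont_o2)
    moreover have "eventually (\<lambda>w. lm.mul (\<Phi> u) (\<Phi> (m (i u, w))) = \<Phi> w) (nhds u)"
      using eventually_nhds_in_open[OF r1(3) u] by eventually_elim (simp add: div(3)[OF u])
    ultimately show "isCont \<Phi> u" using isCont_cong[of "\<lambda>w. lm.mul (\<Phi> u) (\<Phi> (m (i u, w)))" \<Phi> u] by simp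
  qed
  have open\<Phi>: "open (\<Phi> ` W)" if "open W" "W \<subseteq> B1" for W
    using invariance_of_domain[OF continuous_on_subset[OF cont\<Phi> that(2)] that(1) inj_on_subset[OF inj\<Phi> that(2)]] .
  from near[of fst r1] r1(1) obtain d3 where d3: "d3 > 0"
    "\<And>u w. dist u p < d3 \<Longrightarrow> dist w p < d3 \<Longrightarrow> (u, w) \<in> \<Omega> \<and> m (u, w) \<in> B1"
    by (auto simp: B1_def)
  \<comment> \<open>Small enough that products of two points stay in \<open>B1\<close>, where
    \<open>F\<close> inverts \<open>\<Phi>\<close>.\<close>
  define B3 where "B3 = ball p (min r1 d3)"
  have B3: "open B3" "p \<in> B3" "B3 \<subseteq> B1" using r1 d3 by (auto simp: B3_def B1_def)
  have "0 \<in> \<Phi> ` B3" using B3(2) \<Phi>p by (metis imageI)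
  with open\<Phi>[OF B3(1,3)] obtain \<epsilon> where \<epsilon>: "\<epsilon> > 0" "ball 0 \<epsilon> \<subseteq> \<Phi> ` B3" using openE by blast
  define F where "F = inv_into B1 \<Phi>"
  have F\<Phi>: "F (\<Phi> u) = u" if "u \<in> B1" for u unfolding F_def using inj\<Phi> that by simp
  have F: "F x \<in> B3" "\<Phi> (F x) = x" if x: "x \<in> ball 0 \<epsilon>" for x
  proof -
    obtain u where "u \<in> B3" "x = \<Phi> u" using \<epsilon>(2) x by blast
    then show "F x \<in> B3" "\<Phi> (F x) = x" using F\<Phi> B3(3) by auto
  qed
  define s where "s x = \<psi> (F x)" for x
  have FD: "F x \<in> D" if "x \<in> ball 0 \<epsilon>" for x using F(1)[OF that] B3(3) B1_i by blast
  have "s x \<in> carrier G" if "x \<in> ball 0 \<epsilon>" for x using FD[OF that] by (simp add: s_def)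
  moreover have "inj_on s (ball 0 \<epsilon>)"
  proof (rule inj_onI)
    fix x y assume xy: "x \<in> ball 0 \<epsilon>" "y \<in> ball 0 \<epsilon>" "s x = s y"
    then have "\<phi> (\<psi> (F x)) = \<phi> (\<psi> (F y))" by (simp add: s_def)
    then have "F x = F y" using FD xy by simp
    then show "x = y" using F(2) xy by metis
  qed
  moreover have "s (x + \<rho> x y) = s x \<otimes> s y" if xy: "x \<in> ball 0 \<epsilon>" "y \<in> ball 0 \<epsilon>" "x + \<rho> x y \<in> ball 0 \<epsilon>" for x y
  proof -
    have m: "(F x, F y) \<in> \<Omega>" "m (F x, F y) \<in> B1"
      using d3(2)[of "F x" "F y"] F(1)[OF xy(1)] F(1)[OF xy(2)] by (auto simp: B3_def dist_commute)
    have "\<Phi> (m (F x, F y)) = lm.mul x y"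
      using hom[OF _ _ m(1)] m(2) F[OF xy(1)] F[OF xy(2)] B3(3) B1_i(3) by (auto simp: subset_iff)
    then have "F (x + \<rho> x y) = m (F x, F y)" using F\<Phi>[OF m(2)] by (simp add: lm.mul_def)
    then show ?thesis using m(1) by (simp add: s_def)
  qed
  moreover have "openin T (s ` W)" if W: "open W" "W \<subseteq> ball 0 \<epsilon>" for W
  proof -
    have "s ` W = \<psi> ` (B1 \<inter> \<Phi> -` W)"
    proof (intro equalityI subsetI)
      fix g assume "g \<in> s ` W"
      then obtain x where x: "x \<in> W" "g = \<psi> (F x)" by (auto simp: s_def)
      then have x0: "x \<in> ball 0 \<epsilon>" using W(2) by blast
      have "F x \<in> B1 \<inter> \<Phi> -` W" using F[OF x0] x(1) B3(3) by auto
      then show "g \<in> \<psi> ` (B1 \<inter> \<Phi> -` W)" using x(2) by blast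
    next
      fix g assume "g \<in> \<psi> ` (B1 \<inter> \<Phi> -` W)"
      then obtain u where u: "u \<in> B1" "\<Phi> u \<in> W" "g = \<psi> u" by blast
      then have "g = s (\<Phi> u)" using F\<Phi> by (simp add: s_def)
      then show "g \<in> s ` W" using u by blast
    qed
    moreover have "open (B1 \<inter> \<Phi> -` W)" by (rule continuous_open_preimage[OF cont\<Phi> r1(3) W(1)])
    ultimately show ?thesis using T_open[rule_format, of "B1 \<inter> \<Phi> -` W"] B1_i by auto
  qed
  moreover have "open {x \<in> ball 0 \<epsilon>. s x \<in> V}" if V: "openin T V" for V
  proof -
    have "{x \<in> ball 0 \<epsilon>. s x \<in> V} = ball 0 \<epsilon> \<inter> \<Phi> ` (B1 \<inter> {u \<in> D. \<psi> u \<in> V})"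
    proof (intro equalityI subsetI)
      fix x assume "x \<in> {x \<in> ball 0 \<epsilon>. s x \<in> V}"
      then have x: "x \<in> ball 0 \<epsilon>" "\<psi> (F x) \<in> V" by (auto simp: s_def)
      then have "F x \<in> B1 \<inter> {u \<in> D. \<psi> u \<in> V}" using F[OF x(1)] FD[OF x(1)] B3(3) by blast
      then show "x \<in> ball 0 \<epsilon> \<inter> \<Phi> ` (B1 \<inter> {u \<in> D. \<psi> u \<in> V})" using F(2)[OF x(1)] x(1) by force
    qed (use F\<Phi> in \<open>auto simp: s_def\<close>)
    moreover have "open (\<Phi> ` (B1 \<inter> {u \<in> D. \<psi> u \<in> V}))"
      by (intro open\<Phi> open_Int r1(3) T_cont[rule_format] V) auto
    ultimately show ?thesis by (simp add: open_Int)
  qed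
  ultimately show ?thesis using \<epsilon>(1) by (intro exI[of _ s] exI[of _ \<epsilon>]) blast
qed

section \<open>Extending the local isomorphism to the whole model group\<close>

lemma norm_divideR_less: "n > 0 \<Longrightarrow> norm v < real n * d \<Longrightarrow> norm (v /\<^sub>R real n) < d"
proof -
  assume "n > 0" "norm v < real n * d"
  then have "norm v / real n < d" by (simp add: pos_divide_less_eq mult.commute)
  then show ?thesis by (simp add: divide_inverse mult.commute)
qed

context group begin

lemma intertwine_pow:
  assumes "x \<in> carrier G" "y \<in> carrier G" "z \<in> carrier G" "x \<otimes> y = z \<otimes> x"
  shows "x \<otimes> y [^] (n::nat) = z [^] n \<otimes> x"
proof (induction n)
  case (Suc n)
  have "x \<otimes> y [^] Suc n = (x \<otimes> y [^] n) \<otimes> y" using assms by (simp add: m_assoc)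
  also have "\<dots> = z [^] n \<otimes> (x \<otimes> y)" using assms by (simp add: Suc m_assoc)
  also have "\<dots> = z [^] Suc n \<otimes> x" using assms by (simp add: m_assoc)
  finally show ?case .
qed (use assms in simp)

text \<open>
  A vector space is simply connected, so a local homomorphism extends; concretely by
  \<open>v \<mapsto> s(v/k)\<^sup>k\<close> for any \<open>k\<close> that makes \<open>v/k\<close> small.
\<close>

lemma extend_local_additive:
  fixes s :: "'e::real_normed_vector \<Rightarrow> 'a"
  assumes V: "subspace V" and e: "\<epsilon> > 0"
    and cl: "\<And>v. v \<in> V \<Longrightarrow> norm v < \<epsilon> \<Longrightarrow> s v \<in> carrier G"
    and add: "\<And>v w. v \<in> V \<Longrightarrow> w \<in> V \<Longrightarrow> norm v < \<epsilon> \<Longrightarrow> norm w < \<epsilon> \<Longrightarrow> norm (v + w) < \<epsilon> \<Longrightarrow>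
      s (v + w) = s v \<otimes> s w"
  shows "\<exists>f. (\<forall>v\<in>V. f v \<in> carrier G) \<and> (\<forall>v\<in>V. \<forall>w\<in>V. f (v + w) = f v \<otimes> f w) \<and>
    (\<forall>v\<in>V. norm v < \<epsilon> \<longrightarrow> f v = s v)"
proof -
  have s0: "s 0 = \<one>"
  proof -
    have "s 0 \<otimes> s 0 = s 0" using add[of 0 0] e subspace_0[OF V] by simp
    then show ?thesis using cl[of 0] e subspace_0[OF V] r_cancel_one' by (metis norm_zero l_cancel_one)
  qed
  have mult: "s (real j *\<^sub>R v) = s v [^] j" if v: "v \<in> V" and n: "norm (real j *\<^sub>R v) < \<epsilon>" for j :: nat and v
    using n
  proof (induction j)
    case (Suc j)
    have "real j * norm v \<le> real (Suc j) * norm v" by (intro mult_right_mono) auto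
    then have j: "norm (real j *\<^sub>R v) < \<epsilon>" using Suc.prems by simp
    have "1 * norm v \<le> real (Suc j) * norm v" by (intro mult_right_mono) auto
    then have v1: "norm v < \<epsilon>" using Suc.prems by simp
    have "s (real j *\<^sub>R v + v) = s (real j *\<^sub>R v) \<otimes> s v"
      using Suc.prems j v1 v subspace_scale[OF V] by (intro add) (auto simp: algebra_simps)
    then show ?case using Suc.IH[OF j] by (simp add: algebra_simps)
  qed (simp add: s0)
  define k where "k v = nat \<lceil>norm v / \<epsilon>\<rceil> + 1" for v :: 'e
  have k: "norm (v /\<^sub>R real (k v)) < \<epsilon>" "k v > 0" for v
  proof -
    have "norm v / \<epsilon> < real (k v)" unfolding k_def by linarith
    then have "norm v < real (k v) * \<epsilon>" using e by (simp add: pos_divide_less_eq)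
    then show "norm (v /\<^sub>R real (k v)) < \<epsilon>" by (intro norm_divideR_less) (simp_all add: k_def)
  qed (simp add: k_def)
  define f where "f v = s (v /\<^sub>R real (k v)) [^] k v" for v
  have f: "f v = s (v /\<^sub>R real n) [^] n" if v: "v \<in> V" and n: "n > 0" "norm (v /\<^sub>R real n) < \<epsilon>" for v n
  proof -
    \<comment> \<open>A common refinement of the subdivisions into \<open>n\<close> and
      \<open>k v\<close> parts shows that the value does not depend on the subdivision.\<close>
    define w where "w = v /\<^sub>R real (n * k v)"
    have w: "w \<in> V" unfolding w_def using v subspace_scale[OF V] by blast
    have a: "v /\<^sub>R real n = real (k v) *\<^sub>R w" "v /\<^sub>R real (k v) = real n *\<^sub>R w"
      using n k[of v] by (auto simp: w_def)
    have "norm w \<le> norm (v /\<^sub>R real n)" unfolding a using k(2)[of v] by (simp add: mult_le_cancel_right1)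
    then have sw: "s w \<in> carrier G" using n w by (intro cl) auto
    have "s (v /\<^sub>R real n) [^] n = (s w [^] k v) [^] n" using mult[OF w, of "k v"] n a by simp
    also have "\<dots> = (s w [^] n) [^] k v" using sw by (simp add: nat_pow_pow mult.commute)
    also have "\<dots> = f v" unfolding f_def using mult[OF w, of n] k[of v] a by simp
    finally show ?thesis by simp
  qed
  have "f v \<in> carrier G" if "v \<in> V" for v
    unfolding f_def using k[of v] that subspace_scale[OF V] cl by simp
  moreover have "f (v + w) = f v \<otimes> f w" if vw: "v \<in> V" "w \<in> V" for v w
  proof -
    define n where "n = k v + k w + k (v + w)"
    have big: "norm (u /\<^sub>R real n) < \<epsilon>" if "k u \<le> n" for u
    proof -
      have "norm (u /\<^sub>R real n) \<le> norm (u /\<^sub>R real (k u))"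
        using that k(2)[of u] by (auto intro!: mult_right_mono le_imp_inverse_le)
      then show ?thesis using k(1)[of u] by simp
    qed
    have n: "n > 0" using k(2)[of v] by (simp add: n_def)
    have b: "norm (v /\<^sub>R real n) < \<epsilon>" "norm (w /\<^sub>R real n) < \<epsilon>" "norm ((v + w) /\<^sub>R real n) < \<epsilon>"
      by (rule big, simp add: n_def)+
    have V': "v /\<^sub>R real n \<in> V" "w /\<^sub>R real n \<in> V" "v + w \<in> V"
      using vw subspace_scale[OF V] subspace_add[OF V] by auto
    have c: "s (v /\<^sub>R real n) \<in> carrier G" "s (w /\<^sub>R real n) \<in> carrier G" using cl V' b by auto
    have e1: "s ((v + w) /\<^sub>R real n) = s (v /\<^sub>R real n) \<otimes> s (w /\<^sub>R real n)"
      using add[OF V'(1,2) b(1,2)] b(3) by (simp add: scaleR_add_right)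
    have e2: "s ((v + w) /\<^sub>R real n) = s (w /\<^sub>R real n) \<otimes> s (v /\<^sub>R real n)"
      using add[OF V'(2,1) b(2,1)] b(3) by (simp add: scaleR_add_right add.commute)
    have "f (v + w) = (s (v /\<^sub>R real n) \<otimes> s (w /\<^sub>R real n)) [^] n"
      using f[OF V'(3) n b(3)] e1 by simp
    also have "\<dots> = s (v /\<^sub>R real n) [^] n \<otimes> s (w /\<^sub>R real n) [^] n"
      using e1 e2 c by (intro pow_mult_distrib) auto
    finally show ?thesis using f[OF vw(1) n b(1)] f[OF vw(2) n b(2)] by simp
  qed
  moreover have "f v = s v" if "v \<in> V" "norm v < \<epsilon>" for v
    using f[OF that(1), of 1] that cl by simp
  ultimately show ?thesis by blast
qed

end

locale local_model_iso = lie_model q \<rho> br + G: group G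
  for q :: "'e::euclidean_space \<Rightarrow> 'e" and \<rho> br and G :: "('g, 'b) monoid_scheme" +
  fixes T :: "'g topology" and s :: "'e \<Rightarrow> 'g" and \<epsilon> :: real
  assumes e_pos: "\<epsilon> > 0" and s_closed: "\<And>x. norm x < \<epsilon> \<Longrightarrow> s x \<in> carrier G"
    and s_inj: "inj_on s (ball 0 \<epsilon>)"
    and s_mul: "\<And>x y. norm x < \<epsilon> \<Longrightarrow> norm y < \<epsilon> \<Longrightarrow> norm (x \<star> y) < \<epsilon> \<Longrightarrow> s (x \<star> y) = s x \<otimes>\<^bsub>G\<^esub> s y"
    and s_open: "\<And>W. open W \<Longrightarrow> W \<subseteq> ball 0 \<epsilon> \<Longrightarrow> openin T (s ` W)"
    and s_cont: "\<And>V. openin T V \<Longrightarrow> open {x \<in> ball 0 \<epsilon>. s x \<in> V}"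
    and T_carrier: "topspace T = carrier G" and T_connected: "connected_space T"
    and T_translate: "\<And>g V. g \<in> carrier G \<Longrightarrow> openin T V \<Longrightarrow> openin T ((\<lambda>h. g \<otimes>\<^bsub>G\<^esub> h) ` V)"
begin

lemma mul_range: "q t = t \<Longrightarrow> q u = u \<Longrightarrow> t \<star> u = t + u"
  using rho_fix[of t u] by (simp add: mul_def)

definition "fn = (SOME f. (\<forall>v\<in>{v. q v = 0}. f v \<in> carrier G) \<and>
  (\<forall>v\<in>{v. q v = 0}. \<forall>w\<in>{v. q v = 0}. f (v + w) = f v \<otimes>\<^bsub>G\<^esub> f w) \<and> (\<forall>v\<in>{v. q v = 0}. norm v < \<epsilon> \<longrightarrow> f v = s v))"

definition "fa = (SOME f. (\<forall>v\<in>{v. q v = v}. f v \<in> carrier G) \<and>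
  (\<forall>v\<in>{v. q v = v}. \<forall>w\<in>{v. q v = v}. f (v + w) = f v \<otimes>\<^bsub>G\<^esub> f w) \<and> (\<forall>v\<in>{v. q v = v}. norm v < \<epsilon> \<longrightarrow> f v = s v))"

lemma fn: "q v = 0 \<Longrightarrow> fn v \<in> carrier G" "q v = 0 \<Longrightarrow> q w = 0 \<Longrightarrow> fn (v + w) = fn v \<otimes>\<^bsub>G\<^esub> fn w"
  "q v = 0 \<Longrightarrow> norm v < \<epsilon> \<Longrightarrow> fn v = s v"
proof -
  have "subspace {v. q v = 0}" by (auto simp: subspace_def)
  moreover have "s (v + w) = s v \<otimes>\<^bsub>G\<^esub> s w"
    if "v \<in> {v. q v = 0}" "w \<in> {v. q v = 0}" "norm v < \<epsilon>" "norm w < \<epsilon>" "norm (v + w) < \<epsilon>" for v w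
    using s_mul[of v w] that by simp
  ultimately have "\<exists>f. (\<forall>v\<in>{v. q v = 0}. f v \<in> carrier G) \<and>
    (\<forall>v\<in>{v. q v = 0}. \<forall>w\<in>{v. q v = 0}. f (v + w) = f v \<otimes>\<^bsub>G\<^esub> f w) \<and> (\<forall>v\<in>{v. q v = 0}. norm v < \<epsilon> \<longrightarrow> f v = s v)"
    by (intro G.extend_local_additive e_pos s_closed)
  from someI_ex[OF this, folded fn_def]
  show "q v = 0 \<Longrightarrow> fn v \<in> carrier G" "q v = 0 \<Longrightarrow> q w = 0 \<Longrightarrow> fn (v + w) = fn v \<otimes>\<^bsub>G\<^esub> fn w"
    "q v = 0 \<Longrightarrow> norm v < \<epsilon> \<Longrightarrow> fn v = s v" by auto
qed

lemma fa: "q v = v \<Longrightarrow> fa v \<in> carrier G" "q v = v \<Longrightarrow> q w = w \<Longrightarrow> fa (v + w) = fa v \<otimes>\<^bsub>G\<^esub> fa w"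
  "q v = v \<Longrightarrow> norm v < \<epsilon> \<Longrightarrow> fa v = s v"
proof -
  have "subspace {v. q v = v}" by (auto simp: subspace_def)
  moreover have "s (v + w) = s v \<otimes>\<^bsub>G\<^esub> s w"
    if "v \<in> {v. q v = v}" "w \<in> {v. q v = v}" "norm v < \<epsilon>" "norm w < \<epsilon>" "norm (v + w) < \<epsilon>" for v w
    using s_mul[of v w] that mul_range[of v w] by simp
  ultimately have "\<exists>f. (\<forall>v\<in>{v. q v = v}. f v \<in> carrier G) \<and>
    (\<forall>v\<in>{v. q v = v}. \<forall>w\<in>{v. q v = v}. f (v + w) = f v \<otimes>\<^bsub>G\<^esub> f w) \<and> (\<forall>v\<in>{v. q v = v}. norm v < \<epsilon> \<longrightarrow> f v = s v)"
    by (intro G.extend_local_additive e_pos s_closed)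
  from someI_ex[OF this, folded fa_def]
  show "q v = v \<Longrightarrow> fa v \<in> carrier G" "q v = v \<Longrightarrow> q w = w \<Longrightarrow> fa (v + w) = fa v \<otimes>\<^bsub>G\<^esub> fa w"
    "q v = v \<Longrightarrow> norm v < \<epsilon> \<Longrightarrow> fa v = s v" by auto
qed

lemma s_0: "s 0 = \<one>\<^bsub>G\<^esub>"
proof -
  have "s 0 \<otimes>\<^bsub>G\<^esub> s 0 = s 0" using s_mul[of 0 0] e_pos by simp
  then show ?thesis using s_closed[of 0] e_pos G.l_cancel_one[of "s 0" "s 0"] by simp
qed

lemma fn_0: "fn 0 = \<one>\<^bsub>G\<^esub>" and fa_0: "fa 0 = \<one>\<^bsub>G\<^esub>"
  using fn(3)[of 0] fa(3)[of 0] s_0 e_pos by simp_all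

lemma fn_pow: assumes v: "q v = 0" shows "fn (real n *\<^sub>R v) = fn v [^]\<^bsub>G\<^esub> n"
proof (induction n)
  case (Suc n)
  have "real (Suc n) *\<^sub>R v = real n *\<^sub>R v + v" by (simp add: algebra_simps)
  then show ?case using Suc v by (simp only: fn(2)[of "real n *\<^sub>R v" v] q_simps scaleR_zero_right G.nat_pow_Suc)
qed (simp add: fn_0)

lemma near_zero: "\<exists>d>0. \<forall>x y. norm x < d \<longrightarrow> norm y < d \<longrightarrow> norm (\<rho> x y) < \<epsilon> \<and> norm (x \<star> y) < \<epsilon>"
proof -
  have "continuous_on UNIV (\<lambda>z. \<rho> (fst z) (snd z))" "continuous_on UNIV (\<lambda>z. fst z \<star> snd z)"
    by (intro continuous_intros)+
  then have c: "isCont (\<lambda>z. \<rho> (fst z) (snd z)) (0, 0)" "isCont (\<lambda>z. fst z \<star> snd z) (0, 0)"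
    by (auto simp: continuous_on_eq_continuous_at)
  have "eventually (\<lambda>z. \<rho> (fst z) (snd z) \<in> ball 0 \<epsilon>) (nhds (0, 0))"
    by (rule eventually_in_open_isCont[OF c(1)]) (use e_pos in auto)
  moreover have "eventually (\<lambda>z. fst z \<star> snd z \<in> ball 0 \<epsilon>) (nhds (0, 0))"
    by (rule eventually_in_open_isCont[OF c(2)]) (use e_pos in auto)
  ultimately have "eventually (\<lambda>z. \<rho> (fst z) (snd z) \<in> ball 0 \<epsilon> \<and> fst z \<star> snd z \<in> ball 0 \<epsilon>) (nhds (0, 0))"
    by eventually_elim simp
  from eventually_nhds_Pair[OF this] show ?thesis by simp
qed

lemma ex_small: "d > 0 \<Longrightarrow> \<exists>n>0. norm (v /\<^sub>R real n) < d"
proof -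
  assume d: "d > 0"
  obtain n :: nat where n: "norm v < real n * d" using reals_Archimedean3[OF d] by blast
  then have "n > 0" using norm_ge_zero[of v] by (cases "n = 0") auto
  then show ?thesis using norm_divideR_less n by blast
qed

text \<open>For small \<open>t\<close> and \<open>v\<close> this is multiplicativity of
  \<open>s\<close>. Powers of a small fraction of \<open>v\<close> extend it to all
  \<open>v\<close>, and induction along multiples of a small fraction of \<open>t\<close> to all
  \<open>t\<close>.\<close>

lemma intertwine: 
  assumes t: "q t = t" and v: "q v = 0"
  shows "fa t \<otimes>\<^bsub>G\<^esub> fn v = fn (\<rho> t v) \<otimes>\<^bsub>G\<^esub> fa t"
proof -
  obtain d' where d': "d' > 0" "\<And>x y. norm x < d' \<Longrightarrow> norm y < d' \<Longrightarrow> norm (\<rho> x y) < \<epsilon> \<and> norm (x \<star> y) < \<epsilon>"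
    using near_zero by blast
  define d where "d = min d' \<epsilon>"
  have d: "d > 0" using d' e_pos by (simp add: d_def)
  have 1: "fa t \<otimes>\<^bsub>G\<^esub> fn v = fn (\<rho> t v) \<otimes>\<^bsub>G\<^esub> fa t"
    if t: "q t = t" and v: "q v = 0" and s: "norm t < d" "norm v < d" for t v
  proof -
    have n: "norm (\<rho> t v) < \<epsilon>" "norm (t \<star> v) < \<epsilon>" "norm t < \<epsilon>" "norm v < \<epsilon>"
      using d'(2)[of t v] s by (auto simp: d_def)
    have e: "t \<star> v = \<rho> t v \<star> t" using v by (simp add: mul_def add.commute)
    have "s t \<otimes>\<^bsub>G\<^esub> s v = s (\<rho> t v) \<otimes>\<^bsub>G\<^esub> s t"
      using s_mul[OF n(3,4,2)] s_mul[OF n(1,3)] n(2) unfolding e by simp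
    then show ?thesis using fn(3) fa(3) n t v by simp
  qed
  have 2: "fa t \<otimes>\<^bsub>G\<^esub> fn v = fn (\<rho> t v) \<otimes>\<^bsub>G\<^esub> fa t"
    if t: "q t = t" and v: "q v = 0" and s: "norm t < d" for t v
  proof -
    obtain n :: nat where n: "n > 0" "norm (v /\<^sub>R real n) < d" using ex_small[OF d] by blast
    define w where "w = v /\<^sub>R real n"
    have w: "q w = 0" "v = real n *\<^sub>R w" using v n by (auto simp: w_def)
    have "fa t \<otimes>\<^bsub>G\<^esub> fn w [^]\<^bsub>G\<^esub> n = fn (\<rho> t w) [^]\<^bsub>G\<^esub> n \<otimes>\<^bsub>G\<^esub> fa t"
    proof (rule G.intertwine_pow)
      show "fa t \<in> carrier G" by (rule fa(1)[OF t])
      show "fn w \<in> carrier G" by (rule fn(1)[OF w(1)])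
      show "fn (\<rho> t w) \<in> carrier G" by (rule fn(1)) (simp add: w(1))
      show "fa t \<otimes>\<^bsub>G\<^esub> fn w = fn (\<rho> t w) \<otimes>\<^bsub>G\<^esub> fa t"
        by (rule 1[OF t w(1) s]) (use n(2) in \<open>simp only: w_def\<close>)
    qed
    then show ?thesis unfolding w(2) rho_simps(5) using w(1) by (simp only: fn_pow q_rho)
  qed
  obtain n :: nat where n: "n > 0" "norm (t /\<^sub>R real n) < d" using ex_small[OF d] by blast
  define u where "u = t /\<^sub>R real n"
  have u: "q u = u" "t = real n *\<^sub>R u" "norm u < d" using t n by (auto simp: u_def)
  have "fa (real j *\<^sub>R u) \<otimes>\<^bsub>G\<^esub> fn v = fn (\<rho> (real j *\<^sub>R u) v) \<otimes>\<^bsub>G\<^esub> fa (real j *\<^sub>R u)" for j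
  proof (induction j)
    case 0
    show ?case using fn(1)[OF v] by (simp add: fa_0)
  next
    case (Suc j)
    have qj: "q (real j *\<^sub>R u) = real j *\<^sub>R u" using u by simp
    have c: "fa u \<in> carrier G" "fa (real j *\<^sub>R u) \<in> carrier G" "fn v \<in> carrier G" "fn (\<rho> (real j *\<^sub>R u) v) \<in> carrier G"
      "fn (\<rho> u (\<rho> (real j *\<^sub>R u) v)) \<in> carrier G"
      using u qj v fn(1) fa(1) by auto
    have S: "real (Suc j) *\<^sub>R u = u + real j *\<^sub>R u" by (simp add: algebra_simps)
    have "fa (real (Suc j) *\<^sub>R u) \<otimes>\<^bsub>G\<^esub> fn v = fa u \<otimes>\<^bsub>G\<^esub> (fa (real j *\<^sub>R u) \<otimes>\<^bsub>G\<^esub> fn v)"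
      unfolding S fa(2)[OF u(1) qj] using c by (simp add: G.m_assoc)
    also have "\<dots> = (fa u \<otimes>\<^bsub>G\<^esub> fn (\<rho> (real j *\<^sub>R u) v)) \<otimes>\<^bsub>G\<^esub> fa (real j *\<^sub>R u)"
      unfolding Suc using c by (simp add: G.m_assoc)
    also have "fa u \<otimes>\<^bsub>G\<^esub> fn (\<rho> (real j *\<^sub>R u) v) = fn (\<rho> u (\<rho> (real j *\<^sub>R u) v)) \<otimes>\<^bsub>G\<^esub> fa u"
      by (rule 2[OF u(1) _ u(3)]) (use v in simp)
    also have "\<dots> \<otimes>\<^bsub>G\<^esub> fa (real j *\<^sub>R u) = fn (\<rho> (real (Suc j) *\<^sub>R u) v) \<otimes>\<^bsub>G\<^esub> fa (real (Suc j) *\<^sub>R u)"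
      unfolding S fa(2)[OF u(1) qj] rho_add using c by (simp add: G.m_assoc)
    finally show ?case .
  qed
  from this[of n] show ?thesis using u(2) by simp
qed

text \<open>Follows the factorization \<open>x = (x - q x) \<star> q x\<close>; on each factor the
  product is addition, so the extensions \<open>fn\<close> and \<open>fa\<close> apply.\<close>

definition "\<sigma> x = fn (x - q x) \<otimes>\<^bsub>G\<^esub> fa (q x)"

lemma \<sigma>_closed: "\<sigma> x \<in> carrier G"
  by (simp add: \<sigma>_def fn(1) fa(1))

lemma \<sigma>_mul: "\<sigma> (x \<star> y) = \<sigma> x \<otimes>\<^bsub>G\<^esub> \<sigma> y"
proof -
  have k: "x \<star> y - q (x \<star> y) = (x - q x) + \<rho> (q x) (y - q y)"
    by (simp add: rho_q) (simp add: mul_def)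
  have c: "fn (x - q x) \<in> carrier G" "fn (y - q y) \<in> carrier G" "fn (\<rho> (q x) (y - q y)) \<in> carrier G"
    "fa (q x) \<in> carrier G" "fa (q y) \<in> carrier G"
    by (auto intro!: fn(1) fa(1))
  have "\<sigma> (x \<star> y) = fn (x - q x) \<otimes>\<^bsub>G\<^esub> fn (\<rho> (q x) (y - q y)) \<otimes>\<^bsub>G\<^esub> (fa (q x) \<otimes>\<^bsub>G\<^esub> fa (q y))"
    unfolding \<sigma>_def k by (subst fn(2)) (simp_all add: fa(2))
  also have "\<dots> = fn (x - q x) \<otimes>\<^bsub>G\<^esub> (fn (\<rho> (q x) (y - q y)) \<otimes>\<^bsub>G\<^esub> fa (q x)) \<otimes>\<^bsub>G\<^esub> fa (q y)"
    using c by (simp add: G.m_assoc)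
  also have "fn (\<rho> (q x) (y - q y)) \<otimes>\<^bsub>G\<^esub> fa (q x) = fa (q x) \<otimes>\<^bsub>G\<^esub> fn (y - q y)"
    by (rule intertwine[symmetric]) simp_all
  finally show ?thesis unfolding \<sigma>_def using c by (simp add: G.m_assoc)
qed

lemma \<sigma>_0: "\<sigma> 0 = \<one>\<^bsub>G\<^esub>"
  by (simp add: \<sigma>_def fn_0 fa_0)

lemma \<sigma>_iv: "\<sigma> (iv x) = inv\<^bsub>G\<^esub> \<sigma> x"
  using G.inv_equality[of "\<sigma> (iv x)" "\<sigma> x"] \<sigma>_mul[of "iv x" x] by (simp add: \<sigma>_0 \<sigma>_closed)

lemma \<sigma>_local: "\<exists>d>0. d \<le> \<epsilon> \<and> (\<forall>x. norm x < d \<longrightarrow> \<sigma> x = s x)"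
proof -
  have "continuous_on UNIV q" using q_linear linear_conv_bounded_linear linear_continuous_on by blast
  then have c: "isCont q 0" "isCont (\<lambda>x. x - q x) 0" by (auto simp: continuous_on_eq_continuous_at intro!: continuous_intros)
  have "eventually (\<lambda>x. q x \<in> ball 0 \<epsilon>) (nhds 0)"
    by (rule eventually_in_open_isCont[OF c(1)]) (use e_pos in auto)
  moreover have "eventually (\<lambda>x. x - q x \<in> ball 0 \<epsilon>) (nhds 0)"
    by (rule eventually_in_open_isCont[OF c(2)]) (use e_pos in auto)
  ultimately have "eventually (\<lambda>x. q x \<in> ball 0 \<epsilon> \<and> x - q x \<in> ball 0 \<epsilon>) (nhds 0)" by eventually_elim simp
  then obtain d where d: "d > 0" "\<And>x. norm x < d \<Longrightarrow> norm (q x) < \<epsilon> \<and> norm (x - q x) < \<epsilon>"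
    unfolding eventually_nhds_metric by auto
  have "\<sigma> x = s x" if "norm x < min d \<epsilon>" for x
  proof -
    have n: "norm (q x) < \<epsilon>" "norm (x - q x) < \<epsilon>" "norm x < \<epsilon>" using d(2)[of x] that by auto
    have "s ((x - q x) \<star> q x) = s (x - q x) \<otimes>\<^bsub>G\<^esub> s (q x)"
      by (rule s_mul) (use n in simp_all)
    then show ?thesis using n by (simp add: \<sigma>_def fn(3) fa(3))
  qed
  then show ?thesis using d(1) e_pos by (intro exI[of _ "min d \<epsilon>"]) auto
qed

definition "\<delta> = (SOME d. d > 0 \<and> d \<le> \<epsilon> \<and> (\<forall>x. norm x < d \<longrightarrow> \<sigma> x = s x))"

lemma \<delta>: "\<delta> > 0" "\<delta> \<le> \<epsilon>" "norm x < \<delta> \<Longrightarrow> \<sigma> x = s x"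
  using someI_ex[OF \<sigma>_local, folded \<delta>_def] by auto

lemma open_translate: "open W \<Longrightarrow> open ((\<star>) x ` W)"
proof -
  assume W: "open W"
  have "(\<star>) x ` W = (\<star>) (iv x) -` W"
  proof (intro equalityI subsetI)
    fix y assume "y \<in> (\<star>) (iv x) -` W"
    then have "y = x \<star> (iv x \<star> y)" "iv x \<star> y \<in> W" by simp_all
    then show "y \<in> (\<star>) x ` W" by blast
  qed auto
  moreover have "open ((\<star>) (iv x) -` W)" by (intro open_vimage W continuous_intros)
  ultimately show ?thesis by simp
qed

text \<open>Near the unit \<open>\<sigma>\<close> agrees with the open map \<open>s\<close>; left
  translations on both sides carry openness to every point.\<close>

lemma \<sigma>_open: "openin T (\<sigma> ` W)" if "open W"
proof (subst openin_subopen, intro ballI)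
  fix g assume "g \<in> \<sigma> ` W"
  then obtain x where x: "x \<in> W" "g = \<sigma> x" by blast
  define W' where "W' = (\<star>) (iv x) ` W \<inter> ball 0 \<delta>"
  have W': "open W'" "W' \<subseteq> ball 0 \<epsilon>" using open_translate[OF that] \<delta>(2) by (auto simp: W'_def)
  have "\<sigma> ` W' = s ` W'" using \<delta>(3) by (intro image_cong) (auto simp: W'_def)
  then have o: "openin T ((\<lambda>h. g \<otimes>\<^bsub>G\<^esub> h) ` \<sigma> ` W')"
    using T_translate[OF \<sigma>_closed[of x] s_open[OF W']] x by simp
  have "0 \<in> W'" using x \<delta>(1) by (auto simp: W'_def intro!: image_eqI[of _ _ x])
  then have "g \<in> (\<lambda>h. g \<otimes>\<^bsub>G\<^esub> h) ` \<sigma> ` W'" using \<sigma>_0 \<sigma>_closed[of x] x by (force intro!: image_eqI[of _ _ "\<sigma> 0"])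
  moreover have "(\<lambda>h. g \<otimes>\<^bsub>G\<^esub> h) ` \<sigma> ` W' \<subseteq> \<sigma> ` W"
    unfolding x(2) by (auto simp: W'_def simp flip: \<sigma>_mul)
  ultimately show "\<exists>U. openin T U \<and> g \<in> U \<and> U \<subseteq> \<sigma> ` W" using o by blast
qed

lemma \<sigma>_cont: "open (\<sigma> -` V)" if V: "openin T V"
proof (subst open_subopen, intro ballI)
  fix x assume x: "x \<in> \<sigma> -` V"
  define V' where "V' = (\<lambda>h. inv\<^bsub>G\<^esub> \<sigma> x \<otimes>\<^bsub>G\<^esub> h) ` V"
  have V': "openin T V'" unfolding V'_def using \<sigma>_closed by (intro T_translate V) simp
  define W where "W = ball 0 \<delta> \<inter> {y \<in> ball 0 \<epsilon>. s y \<in> V'}"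
  have W: "open W" unfolding W_def by (intro open_Int open_ball s_cont V')
  have "\<one>\<^bsub>G\<^esub> \<in> V'" unfolding V'_def using x \<sigma>_closed[of x] by (auto intro!: image_eqI[of _ _ "\<sigma> x"])
  then have "0 \<in> W" using \<delta>(1) e_pos by (simp add: W_def s_0)
  then have "x \<in> (\<star>) x ` W" by (intro image_eqI[of _ _ 0]) simp_all
  moreover have "(\<star>) x ` W \<subseteq> \<sigma> -` V"
  proof clarify
    fix y assume "y \<in> W"
    then have "\<sigma> y \<in> V'" using \<delta>(3) by (auto simp: W_def)
    then obtain h where h: "h \<in> V" "\<sigma> y = inv\<^bsub>G\<^esub> \<sigma> x \<otimes>\<^bsub>G\<^esub> h" by (auto simp: V'_def)
    have hc: "h \<in> carrier G" using h(1) openin_subset[OF V] T_carrier by blast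
    have "\<sigma> (x \<star> y) = h" unfolding \<sigma>_mul h(2) using hc \<sigma>_closed[of x] by (simp flip: G.m_assoc)
    then show "x \<star> y \<in> \<sigma> -` V" using h(1) by simp
  qed
  ultimately show "\<exists>W. open W \<and> x \<in> W \<and> W \<subseteq> \<sigma> -` V" using open_translate[OF W] by blast
qed

text \<open>The range is an open subgroup, and so are its cosets open; hence it is also closed, and
  connectedness leaves only the whole group.\<close>

lemma \<sigma>_surj: "range \<sigma> = carrier G"
proof -
  have o: "openin T (range \<sigma>)" by (rule \<sigma>_open) simp
  have c: "openin T (topspace T - range \<sigma>)"
  proof (subst openin_subopen, intro ballI)
    fix g assume g: "g \<in> topspace T - range \<sigma>"
    then have gc: "g \<in> carrier G" using T_carrier by simp
    have "g \<in> (\<lambda>h. g \<otimes>\<^bsub>G\<^esub> h) ` range \<sigma>" using gc \<sigma>_0 by (force intro!: image_eqI[of _ _ "\<sigma> 0"])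
    moreover have "(\<lambda>h. g \<otimes>\<^bsub>G\<^esub> h) ` range \<sigma> \<subseteq> topspace T - range \<sigma>"
    proof clarify
      fix x
      show "g \<otimes>\<^bsub>G\<^esub> \<sigma> x \<in> topspace T - range \<sigma>"
      proof
        show "g \<otimes>\<^bsub>G\<^esub> \<sigma> x \<in> topspace T" using gc \<sigma>_closed T_carrier by simp
        show "g \<otimes>\<^bsub>G\<^esub> \<sigma> x \<notin> range \<sigma>"
        proof
          assume "g \<otimes>\<^bsub>G\<^esub> \<sigma> x \<in> range \<sigma>"
          then obtain y where "g \<otimes>\<^bsub>G\<^esub> \<sigma> x = \<sigma> y" by blast
          then have "g = \<sigma> y \<otimes>\<^bsub>G\<^esub> inv\<^bsub>G\<^esub> \<sigma> x" using gc \<sigma>_closed by (metis G.inv_solve_right)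
          then have "g = \<sigma> (y \<star> iv x)" by (simp add: \<sigma>_mul \<sigma>_iv)
          then show False using g by blast
        qed
      qed
    qed
    ultimately show "\<exists>U. openin T U \<and> g \<in> U \<and> U \<subseteq> topspace T - range \<sigma>" using T_translate[OF gc o] by blast
  qed
  have "range \<sigma> \<subseteq> topspace T" using \<sigma>_closed T_carrier by auto
  then have "closedin T (range \<sigma>)" using c by (simp add: closedin_def)
  then have "range \<sigma> = {} \<or> range \<sigma> = topspace T"
    using T_connected o unfolding connected_space_clopen_in by blast
  then show ?thesis using T_carrier by auto
qed

text \<open>The kernel is discrete and normal in a connected group, hence central; but the centre is trivial.\<close>

lemma \<sigma>_kernel: assumes d: "\<sigma> d = \<one>\<^bsub>G\<^esub>" shows "d = 0"
proof -
  have small: "x = 0" if "\<sigma> x = \<one>\<^bsub>G\<^esub>" "norm x < \<delta>" for x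
  proof -
    have "s x = s 0" using \<delta>(3)[OF that(2)] that(1) s_0 by simp
    then show ?thesis using s_inj that(2) \<delta>(1,2) e_pos by (auto dest!: inj_onD)
  qed
  \<comment> \<open>The commutator of a small \<open>x\<close> with \<open>d\<close> lies in the
    kernel and is small, hence trivial. Fractions of arbitrary vectors supply enough small
    \<open>x\<close>.\<close>
  have "continuous_on UNIV (\<lambda>x. x \<star> d \<star> iv x \<star> iv d)" by (intro continuous_intros)
  then have "isCont (\<lambda>x. x \<star> d \<star> iv x \<star> iv d) 0" by (simp add: continuous_on_eq_continuous_at)
  then have "eventually (\<lambda>x. x \<star> d \<star> iv x \<star> iv d \<in> ball 0 \<delta>) (nhds 0)"
    by (rule eventually_in_open_isCont) (use \<delta>(1) in \<open>auto simp: iv_def[of 0]\<close>)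
  then obtain r where r: "r > 0" "\<And>x. norm x < r \<Longrightarrow> norm (x \<star> d \<star> iv x \<star> iv d) < \<delta>"
    unfolding eventually_nhds_metric by auto
  have comm: "x \<star> d = d \<star> x" if "norm x < r" for x
  proof -
    have "\<sigma> (x \<star> d \<star> iv x \<star> iv d) = \<one>\<^bsub>G\<^esub>" using d \<sigma>_closed[of x] by (simp add: \<sigma>_mul \<sigma>_iv)
    from small[OF this r(2)[OF that]] have "x \<star> d \<star> iv (d \<star> x) = 0" by (simp add: iv_mul_rev mul_assoc)
    then have "iv (iv (x \<star> d)) \<star> iv (d \<star> x) = 0" by simp
    then have "iv (x \<star> d) = iv (d \<star> x)" by (simp only: mul_eq_0_iff)
    then show ?thesis using iv_iv by metis
  qed
  have "\<rho> d v = v" if v: "q v = 0" for v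
  proof -
    obtain n :: nat where n: "n > 0" "norm (v /\<^sub>R real n) < r" using ex_small[OF r(1)] by blast
    have "(v /\<^sub>R real n) \<star> d = d \<star> (v /\<^sub>R real n)" by (rule comm[OF n(2)])
    moreover have "(v /\<^sub>R real n) \<star> d = v /\<^sub>R real n + d" by (rule ker_mul) (simp add: v)
    ultimately have "v /\<^sub>R real n = (\<rho> d v) /\<^sub>R real n" by (auto simp: mul_def)
    then show ?thesis using n(1) by simp
  qed
  then have qd: "q d = 0" by (rule faithful)
  have "br d (q t) = 0" for t
  proof -
    obtain n :: nat where n: "n > 0" "norm (q t /\<^sub>R real n) < r" using ex_small[OF r(1)] by blast
    define u where "u = q t /\<^sub>R real n"
    have u: "q u = u" "norm u < r" using n by (auto simp: u_def)
    \<comment> \<open>Commutation along a whole segment makes the curve constant, so its derivative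
      at 0, which is \<open>br u d\<close>, vanishes.\<close>
    have \<rho>u: "\<rho> (a *\<^sub>R u) d = d" if "a \<in> {0..1}" for a
    proof -
      have "norm (a *\<^sub>R u) \<le> norm u" using that by (auto intro!: mult_left_le_one_le)
      then have "a *\<^sub>R u \<star> d = d \<star> a *\<^sub>R u" using u(2) by (intro comm) simp
      moreover have "d \<star> a *\<^sub>R u = d + a *\<^sub>R u" by (rule ker_mul[OF qd])
      ultimately have "a *\<^sub>R u + \<rho> (a *\<^sub>R u) d = d + a *\<^sub>R u" by (simp only: mul_def)
      then show ?thesis by (simp only: add.commute[of d] add_left_cancel)
    qed
    have "((\<lambda>a. a *\<^sub>R u) has_vector_derivative u) (at 0 within {0..1})"
      by (auto intro!: derivative_eq_intros)
    from rho_der[OF this, of d]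
    have 1: "((\<lambda>a. \<rho> (a *\<^sub>R u) d) has_vector_derivative br u d) (at 0 within {0..1})" by (simp add: u)
    have 2: "((\<lambda>a. \<rho> (a *\<^sub>R u) d) has_vector_derivative 0) (at 0 within {0..1})"
      by (rule has_vector_derivative_transform[of _ _ _ "\<lambda>_. d"]) (use \<rho>u in auto)
    have "br u d = 0"
      using vector_derivative_unique_within_closed_interval[OF _ _ 1[folded cbox_interval] 2[folded cbox_interval]] by auto
    then have "br d u = 0" using br_anti[of d u] by simp
    then have "inverse (real n) *\<^sub>R br d (q t) = 0" by (simp add: u_def linear_scale[OF br_linear])
    then show ?thesis using n(1) by simp
  qed
  then show ?thesis using centralizer[OF qd] by blast
qed

lemma \<sigma>_iso: "\<sigma> \<in> iso MG G"
proof -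
  have "inj \<sigma>"
  proof (rule injI)
    fix x y assume "\<sigma> x = \<sigma> y"
    then have "\<sigma> (iv x \<star> y) = \<one>\<^bsub>G\<^esub>" using \<sigma>_closed[of y] by (simp add: \<sigma>_mul \<sigma>_iv)
    then show "x = y" using \<sigma>_kernel mul_eq_0_iff by blast
  qed
  then show ?thesis by (auto simp: iso_def hom_def bij_betw_def \<sigma>_closed \<sigma>_mul \<sigma>_surj)
qed

lemma \<sigma>_homeo: "openin T (\<sigma> ` V) \<longleftrightarrow> open V"
proof
  assume "openin T (\<sigma> ` V)"
  then have "open (\<sigma> -` \<sigma> ` V)" by (rule \<sigma>_cont)
  moreover have "inj \<sigma>" using \<sigma>_iso by (auto simp: iso_def bij_betw_def)
  ultimately show "open V" by (simp add: inj_vimage_image_eq)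
qed (rule \<sigma>_open)

end


section \<open>Lattices in Lie groups\<close>

lemma chart_on_inv_open:
  assumes "chart_on T (U, \<phi>)" "openin T V"
  shows "open {u \<in> \<phi> ` U. inv_into U \<phi> u \<in> V}"
proof -
  have U: "openin T U" and D: "open (\<phi> ` U)"
    and h: "homeomorphic_map (subtopology T U) (top_of_set (\<phi> ` U)) \<phi>"
    using assms(1) by (auto simp: chart_on_def)
  have inj: "inj_on \<phi> U"
    using homeomorphic_imp_injective_map[OF h] openin_subset[OF U] by (simp add: Int_absorb1)
  have "openin (subtopology T U) (U \<inter> V)" using assms(2) U by (simp add: openin_open_subtopology openin_Int)
  then have "openin (top_of_set (\<phi> ` U)) (\<phi> ` (U \<inter> V))"
    using homeomorphic_imp_open_map[OF h] by (simp add: open_map_def)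
  then have "open (\<phi> ` (U \<inter> V))" using D by (simp add: openin_open_eq)
  moreover have "\<phi> ` (U \<inter> V) = {u \<in> \<phi> ` U. inv_into U \<phi> u \<in> V}"
    using inj by auto
  ultimately show ?thesis by simp
qed

lemma chart_on_inv_image_open:
  assumes "chart_on T (U, \<phi>)" "open W" "W \<subseteq> \<phi> ` U"
  shows "openin T (inv_into U \<phi> ` W)"
proof -
  have U: "openin T U" and D: "open (\<phi> ` U)"
    and h: "homeomorphic_map (subtopology T U) (top_of_set (\<phi> ` U)) \<phi>"
    using assms(1) by (auto simp: chart_on_def)
  have inj: "inj_on \<phi> U"
    using homeomorphic_imp_injective_map[OF h] openin_subset[OF U] by (simp add: Int_absorb1)
  have "openin (top_of_set (\<phi> ` U)) W" using assms(2,3) D by (simp add: openin_open_eq)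
  from openin_continuous_map_preimage[OF homeomorphic_imp_continuous_map[OF h] this]
  have "openin T {g \<in> U. \<phi> g \<in> W}"
    using U openin_subset[OF U] by (simp add: openin_open_subtopology Int_absorb1)
  moreover have "{g \<in> U. \<phi> g \<in> W} = inv_into U \<phi> ` W"
  proof (intro equalityI subsetI)
    fix g assume "g \<in> {g \<in> U. \<phi> g \<in> W}"
    then show "g \<in> inv_into U \<phi> ` W" using inj by (intro image_eqI[of _ _ "\<phi> g"]) auto
  next
    fix g assume "g \<in> inv_into U \<phi> ` W"
    then obtain w where w: "w \<in> W" "g = inv_into U \<phi> w" by blast
    then have "w \<in> \<phi> ` U" using assms(3) by blast
    then show "g \<in> {g \<in> U. \<phi> g \<in> W}" using w by (simp add: inv_into_into f_inv_into_f)
  qed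
  ultimately show ?thesis by simp
qed

lemma lie_group_translate:
  assumes L: "lie_group G T A" and g: "g \<in> carrier G" and V: "openin T V"
  shows "openin T ((\<lambda>h. g \<otimes>\<^bsub>G\<^esub> h) ` V)"
proof -
  have "group G" and top: "topspace T = carrier G"
    and mult: "continuous_map (prod_topology T T) T (\<lambda>(x, y). x \<otimes>\<^bsub>G\<^esub> y)"
    using L by (auto simp: lie_group_def)
  interpret group G by fact
  have "continuous_map T (prod_topology T T) (\<lambda>h. (inv\<^bsub>G\<^esub> g, h))"
    using g top by (intro continuous_map_pairedI) (simp_all add: id_def[symmetric])
  from continuous_map_compose[OF this mult]
  have "continuous_map T T (\<lambda>h. inv\<^bsub>G\<^esub> g \<otimes>\<^bsub>G\<^esub> h)" by (simp add: o_def)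
  from openin_continuous_map_preimage[OF this V]
  have "openin T {h \<in> carrier G. inv\<^bsub>G\<^esub> g \<otimes>\<^bsub>G\<^esub> h \<in> V}" using top by simp
  moreover have "{h \<in> carrier G. inv\<^bsub>G\<^esub> g \<otimes>\<^bsub>G\<^esub> h \<in> V} = (\<lambda>h. g \<otimes>\<^bsub>G\<^esub> h) ` V"
  proof (intro equalityI subsetI)
    fix h assume h: "h \<in> {h \<in> carrier G. inv\<^bsub>G\<^esub> g \<otimes>\<^bsub>G\<^esub> h \<in> V}"
    then have "h = g \<otimes>\<^bsub>G\<^esub> (inv\<^bsub>G\<^esub> g \<otimes>\<^bsub>G\<^esub> h)" using g by (simp flip: m_assoc)
    then show "h \<in> (\<lambda>h. g \<otimes>\<^bsub>G\<^esub> h) ` V" using h by blast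
  next
    fix h assume "h \<in> (\<lambda>h. g \<otimes>\<^bsub>G\<^esub> h) ` V"
    then obtain k where k: "k \<in> V" "h = g \<otimes>\<^bsub>G\<^esub> k" by blast
    then have "k \<in> carrier G" using openin_subset[OF V] top by blast
    then show "h \<in> {h \<in> carrier G. inv\<^bsub>G\<^esub> g \<otimes>\<^bsub>G\<^esub> h \<in> V}" using k g by (simp flip: m_assoc)
  qed
  ultimately show ?thesis by simp
qed

lemma lie_group_lie_chart:
  fixes \<phi> :: "'g \<Rightarrow> 'e::euclidean_space"
  assumes L: "lie_group G T A" and c: "(U, \<phi>) \<in> A" and one: "\<one>\<^bsub>G\<^esub> \<in> U"
  shows "lie_chart G U \<phi>"
proof -
  let ?\<psi> = "inv_into U \<phi>" and ?D = "\<phi> ` U"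
  have grp: "group G" and top: "topspace T = carrier G"
    and mult: "continuous_map (prod_topology T T) T (\<lambda>(x, y). x \<otimes>\<^bsub>G\<^esub> y)"
    and minv: "continuous_map T T (m_inv G)"
    and ch: "chart_on T (U, \<phi>)"
    using L c by (auto simp: lie_group_def smooth_manifold_def smooth_atlas_def)
  have U: "openin T U" and D: "open ?D"
    and h: "homeomorphic_map (subtopology T U) (top_of_set ?D) \<phi>"
    using ch by (auto simp: chart_on_def)
  have UC: "U \<subseteq> carrier G" using openin_subset[OF U] top by simp
  have \<psi>: "continuous_map (top_of_set ?D) T ?\<psi>"
    unfolding continuous_map_def
  proof (intro conjI allI impI)
    show "?\<psi> \<in> topspace (top_of_set ?D) \<rightarrow> topspace T"
      using UC top by (auto simp: inv_into_into dest: inv_into_into)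
    fix V assume "openin T V"
    from chart_on_inv_open[OF ch this] D
    show "openin (top_of_set ?D) {x \<in> topspace (top_of_set ?D). ?\<psi> x \<in> V}"
      by (simp add: openin_open_eq)
  qed
  have "open {(u, v). u \<in> ?D \<and> v \<in> ?D \<and> ?\<psi> u \<otimes>\<^bsub>G\<^esub> ?\<psi> v \<in> U}"
  proof -
    have "continuous_map (top_of_set (?D \<times> ?D)) (top_of_set ?D) fst" "continuous_map (top_of_set (?D \<times> ?D)) (top_of_set ?D) snd"
      by (auto intro!: continuous_on_fst continuous_on_snd continuous_on_id)
    from this[THEN continuous_map_compose, OF \<psi>]
    have "continuous_map (top_of_set (?D \<times> ?D)) (prod_topology T T) (\<lambda>z. (?\<psi> (fst z), ?\<psi> (snd z)))"
      by (intro continuous_map_pairedI) (simp_all add: o_def)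
    from continuous_map_compose[OF this mult]
    have "continuous_map (top_of_set (?D \<times> ?D)) T (\<lambda>z. ?\<psi> (fst z) \<otimes>\<^bsub>G\<^esub> ?\<psi> (snd z))" by (simp add: o_def)
    from openin_continuous_map_preimage[OF this U]
    have "open {z \<in> ?D \<times> ?D. ?\<psi> (fst z) \<otimes>\<^bsub>G\<^esub> ?\<psi> (snd z) \<in> U}"
      using open_Times[OF D D] by (simp add: openin_open_eq)
    moreover have "{z \<in> ?D \<times> ?D. ?\<psi> (fst z) \<otimes>\<^bsub>G\<^esub> ?\<psi> (snd z) \<in> U} = {(u, v). u \<in> ?D \<and> v \<in> ?D \<and> ?\<psi> u \<otimes>\<^bsub>G\<^esub> ?\<psi> v \<in> U}"
      by auto
    ultimately show ?thesis by simp
  qed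
  moreover have "open {u \<in> ?D. inv\<^bsub>G\<^esub> (?\<psi> u) \<in> U}"
    using openin_continuous_map_preimage[OF continuous_map_compose[OF \<psi> minv] U] D
    by (simp add: openin_open_eq)
  moreover have "inj_on \<phi> U"
    using homeomorphic_imp_injective_map[OF h] openin_subset[OF U] by (simp add: Int_absorb1)
  moreover have "Ck_on 2 {(u, v). u \<in> ?D \<and> v \<in> ?D \<and> ?\<psi> u \<otimes>\<^bsub>G\<^esub> ?\<psi> v \<in> U} (\<lambda>(u, v). \<phi> (?\<psi> u \<otimes>\<^bsub>G\<^esub> ?\<psi> v))"
    "Ck_on 1 {u \<in> ?D. inv\<^bsub>G\<^esub> (?\<psi> u) \<in> U} (\<lambda>u. \<phi> (inv\<^bsub>G\<^esub> (?\<psi> u)))"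
  proof -
    have "\<forall>c1\<in>A. \<forall>c2\<in>A. \<forall>c3\<in>A. smooth_on
          {(u, v). u \<in> chart_image c1 \<and> v \<in> chart_image c2 \<and> chart_inv c1 u \<otimes>\<^bsub>G\<^esub> chart_inv c2 v \<in> fst c3}
          (\<lambda>(u, v). snd c3 (chart_inv c1 u \<otimes>\<^bsub>G\<^esub> chart_inv c2 v))"
      "\<forall>c1\<in>A. \<forall>c2\<in>A. smooth_on {u \<in> chart_image c1. inv\<^bsub>G\<^esub> (chart_inv c1 u) \<in> fst c2}
          (\<lambda>u. snd c2 (inv\<^bsub>G\<^esub> (chart_inv c1 u)))"
      using L by (simp_all add: lie_group_def)
    from this(1)[THEN bspec, OF c, THEN bspec, OF c, THEN bspec, OF c] this(2)[THEN bspec, OF c, THEN bspec, OF c]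
    show "Ck_on 2 {(u, v). u \<in> ?D \<and> v \<in> ?D \<and> ?\<psi> u \<otimes>\<^bsub>G\<^esub> ?\<psi> v \<in> U} (\<lambda>(u, v). \<phi> (?\<psi> u \<otimes>\<^bsub>G\<^esub> ?\<psi> v))"
      "Ck_on 1 {u \<in> ?D. inv\<^bsub>G\<^esub> (?\<psi> u) \<in> U} (\<lambda>u. \<phi> (inv\<^bsub>G\<^esub> (?\<psi> u)))"
      unfolding smooth_on_def fst_conv snd_conv by blast+
  qed
  ultimately show ?thesis
    using grp one UC D by (intro lie_chart.intro lie_chart_axioms.intro)
qed

theorem RF_bounded_below_lie_group:
  fixes A :: "('g, 'e::euclidean_space) chart set"
  assumes L: "lie_group G T A" and conn: "connected_space T"
    and nd: "nondegenerate_split_lie_group G A" and lat: "cocompact_lattice G T \<Gamma>"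
  shows "RF_bounded_below_by (G\<lparr>carrier := \<Gamma>\<rparr>) (\<lambda>n. n)"
proof -
  obtain U \<phi> where c: "(U, \<phi>) \<in> A" "\<one>\<^bsub>G\<^esub> \<in> U" and alg: "nondegenerate_split_lie_algebra (lie_bracket G (U, \<phi>))"
    using nd unfolding nondegenerate_split_lie_group_def by (metis prod.collapse)
  have ch: "chart_on T (U, \<phi>)" using L c(1) by (auto simp: lie_group_def smooth_manifold_def smooth_atlas_def)
  have grp: "group G" and top: "topspace T = carrier G" using L by (auto simp: lie_group_def)
  interpret lie_chart G U \<phi> by (rule lie_group_lie_chart[OF L c])
  obtain q \<rho> where model: "lie_model q \<rho> br" using nondegenerate_split_lie_algebra_model[OF alg] by blast
  interpret lm: lie_model q \<rho> br by (rule model)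
  have inv_image_open: "\<forall>W. open W \<longrightarrow> W \<subseteq> D \<longrightarrow> openin T (\<psi> ` W)"
    using chart_on_inv_image_open[OF ch] by simp
  have inv_open: "\<forall>V. openin T V \<longrightarrow> open {u \<in> D. \<psi> u \<in> V}"
    using chart_on_inv_open[OF ch] by simp
  have "\<exists>s \<epsilon>. local_model_iso q \<rho> br G T s \<epsilon>"
    using ex_local_inverse[OF model inv_image_open inv_open]
  proof (elim ex_forward conjE)
    fix s \<epsilon>
    assume s: "\<epsilon> > 0" "\<forall>x\<in>ball 0 \<epsilon>. s x \<in> carrier G" "inj_on s (ball 0 \<epsilon>)"
      "\<forall>x\<in>ball 0 \<epsilon>. \<forall>y\<in>ball 0 \<epsilon>. x + \<rho> x y \<in> ball 0 \<epsilon> \<longrightarrow> s (x + \<rho> x y) = s x \<otimes>\<^bsub>G\<^esub> s y"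
      "\<forall>W. open W \<longrightarrow> W \<subseteq> ball 0 \<epsilon> \<longrightarrow> openin T (s ` W)"
      "\<forall>V. openin T V \<longrightarrow> open {x \<in> ball 0 \<epsilon>. s x \<in> V}"
    show "local_model_iso q \<rho> br G T s \<epsilon>"
    proof (intro local_model_iso.intro model grp local_model_iso_axioms.intro)
      show "openin T ((\<lambda>h. g \<otimes>\<^bsub>G\<^esub> h) ` V)" if "g \<in> carrier G" "openin T V" for g V
        using lie_group_translate[OF L that] .
    qed (use s top conn in \<open>auto simp: lm.mul_def\<close>)
  qed
  then obtain s \<epsilon> where iso: "local_model_iso q \<rho> br G T s \<epsilon>" by (elim exE)
  interpret local_model_iso q \<rho> br G T s \<epsilon> by (rule iso)
  show ?thesis
    using lm.RF_bounded_below_cocompact_lattice[OF grp \<sigma>_iso \<sigma>_homeo lat] .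
qed

theorem corollary1p2:
  shows
    "(\<forall>\<Gamma>. cocompact_lattice Sol euclidean \<Gamma> \<longrightarrow>
        RF_bounded_below_by (Sol\<lparr>carrier := \<Gamma>\<rparr>) (\<lambda>n. n)) \<and>
     (\<forall>(M::real^'d^'d) \<Gamma>.
        positive_definite M \<and> (\<forall>c. mat_eigenvalue M c \<longrightarrow> c \<noteq> 1) \<and>
        cocompact_lattice (semidirect_line (mat_rpow M)) euclidean \<Gamma> \<longrightarrow>
        RF_bounded_below_by (semidirect_line (mat_rpow M)\<lparr>carrier := \<Gamma>\<rparr>) (\<lambda>n. n)) \<and>
     (\<forall>(G::'g monoid) (T::'g topology) (A::('g, 'e::euclidean_space) chart set) \<Gamma>.
        lie_group G T A \<and> connected_space T \<and> simply_connected_space T \<and> solvable G \<and>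
        nondegenerate_split_lie_group G A \<and>
        cocompact_lattice G T \<Gamma> \<longrightarrow>
        RF_bounded_below_by (G\<lparr>carrier := \<Gamma>\<rparr>) (\<lambda>n. n))"
proof (intro conjI allI impI)
  fix \<Gamma> assume "cocompact_lattice Sol euclidean \<Gamma>"
  then show "RF_bounded_below_by (Sol\<lparr>carrier := \<Gamma>\<rparr>) (\<lambda>n. n)"
    unfolding Sol_def by (rule RF_bounded_below_semidirect_line[OF Sol_eigenvectors])
next
  fix M :: "real^'d^'d" and \<Gamma>
  assume "positive_definite M \<and> (\<forall>c. mat_eigenvalue M c \<longrightarrow> c \<noteq> 1) \<and>
    cocompact_lattice (semidirect_line (mat_rpow M)) euclidean \<Gamma>"
  then show "RF_bounded_below_by (semidirect_line (mat_rpow M)\<lparr>carrier := \<Gamma>\<rparr>) (\<lambda>n. n)"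
    using RF_bounded_below_semidirect_line[OF mat_rpow_eigenvectors] by blast
next
  fix G :: "'g monoid" and T :: "'g topology" and A :: "('g, 'e::euclidean_space) chart set" and \<Gamma>
  assume "lie_group G T A \<and> connected_space T \<and> simply_connected_space T \<and> solvable G \<and>
    nondegenerate_split_lie_group G A \<and> cocompact_lattice G T \<Gamma>"
  then show "RF_bounded_below_by (G\<lparr>carrier := \<Gamma>\<rparr>) (\<lambda>n. n)"
    using RF_bounded_below_lie_group by blast
qed

end
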